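(* Let $\hat\beta$ be an estimator of $\beta^0$ and let $\hat\gamma\in\arg\min_{c\in\mathbb{R}^{p-1}}\{\|X_1-X_{-1}c\|_2^2/n+2\lambda^{\rm Lasso}\|c\|_1\}$, $$\hat\Theta_1:=\begin{pmatrix}1\\-\hat\gamma\end{pmatrix}\Big/\big(\|X_1-X_{-1}\hat\gamma\|_2^2/n+\lambda^{\rm Lasso}\|\hat\gamma\|_1\big),\qquad \hat b_1:=\hat\beta_1+\hat\Theta_1^TX^T(Y-X\hat\beta)/n .$$ Let $(\gamma^\sharp,\lambda^\sharp)$ be an eligible pair with $\lambda^\sharp=\mathcal{O}(\sqrt{\log p/n})$ and $\sqrt{\log p/n}\,\|\gamma^\sharp\|_1=o(1)$, and let $\lambda^{\rm Lasso}\asymp\sqrt{\log p/n}$ be sufficiently large (depending only on $\lambda^\sharp$). Suppose that uniformly in $\beta^0\in\mathcal{B}$, $\sqrt{\log p}\,\|\hat\beta-\beta^0\|_1=o_{\mathbb{P}_{\beta^0}}(1)$. Then uniformly in $\beta^0\in\mathcal{B}$, $$\hat b_1-\beta^0_1=\hat\Theta_1^TX^T\epsilon/n+o_{\mathbb{P}_{\beta^0}}(1/\sqrt n).$$ Moreover, $$\lim_{n\to\infty}\sup_{\beta^0\in\mathcal{B}}\mathbb{P}_{\beta^0}\Big(\sqrt n\,\frac{\hat b_1-\beta^0_1}{\sqrt{\hat\Theta_1^T\hat\Sigma\hat\Theta_1}}\le z\Big)=\Phi(z)\quad\text{for all }z\in\mathbb{R},$$ and $\hat\Theta_1^T\hat\Sigma\hat\Theta_1=\Theta^\sharp_{1,1}+o_{\mathbb{P}}(1)$,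 where $\Theta^\sharp_{1,1}:=1/(1-\gamma^{0T}\Sigma_{-1,-1}\gamma^\sharp)$ is the first entry of $\Theta_1^\sharp:=(1,-\gamma^{\sharp T})^T/(1-\gamma^{0T}\Sigma_{-1,-1}\gamma^\sharp)$.
   Context: Asymptotic framework: all quantities may depend on $n$; limits as $n\to\infty$. The rows of $(X,Y)\in\mathbb{R}^{n\times(p+1)}$ are i.i.d. copies of a zero-mean Gaussian row vector $(\mathbf{x},\mathbf{y})$, $\mathbf{x}=(\mathbf{x}_1,\dots,\mathbf{x}_p)$, with $\Sigma:=\mathbb{E}\mathbf{x}^T\mathbf{x}$ (unknown) nonsingular, all diagonal entries $1$, smallest eigenvalue $\Lambda^2_{\min}$ with $1/\Lambda^2_{\min}=\mathcal{O}(1)$. $\beta^0=\Sigma^{-1}\mathbb{E}\mathbf{x}^T\mathbf{y}$ lies in a given model class $\mathcal{B}\subseteq\mathbb{R}^p$, $\epsilon:=Y-X\beta^0$, $\mathbb{E}(\mathbf{y}-\mathbf{x}\beta^0)^2=1$. $\hat\Sigma:=X^TX/n$; $X_1$ is the first column of $X$ and $X_{-1}$ the remaining columns. $\mathbf{x}_{-1}=(\mathbf{x}_2,\dots,\mathbf{x}_p)$, $\Sigma_{-1,-1}=\mathbb{E}\mathbf{x}_{-1}^T\mathbf{x}_{-1}$, $\gamma^0:=\Sigma_{-1,-1}^{-1}\mathbb{E}\mathbf{x}_{-1}^T\mathbf{x}_1$. A pair $(\gamma^\sharp,\lambda^\sharp)$ is eligible if $\|\Sigma_{-1,-1}(\gamma^\sharp-\gamma^0)\|_\infty\le\lambda^\sharp$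 and $\lambda^\sharp\|\gamma^\sharp\|_1\to0$. $\Phi$ is the standard normal cdf; $a_n\asymp b_n$ means $a_n/b_n$ bounded and bounded away from zero. $Z_n=o_{\mathbb{P}_{\beta^0}}(r_n)$ uniformly in $\beta^0\in\mathcal{B}$ means $\lim_n\sup_{\beta^0\in\mathcal{B}}\mathbb{P}_{\beta^0}(|Z_n|>\eta r_n)=0$ for all $\eta>0$. *)

theory Defs
  imports "HOL-Probability.Probability"
begin

text \<open>Conventions: coordinates are 0-based, so the paper's coordinate 1 is index 0 and
  X_{-1} consists of the columns 1..p-1. Vectors and matrices are functions on nat,
  only the entries with indices below the dimension are used.\<close>

text \<open>Joint law of the data (X, eps) on a probability space M: the n x p matrix X has
  i.i.d. N(0,S) rows, eps has i.i.d. N(0,1) entries independent of X. Stated via the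
  standard definition of a (jointly) Gaussian vector: every nondegenerate linear
  combination of the entries is centred normal with the corresponding variance.\<close>
definition gaussian_data ::
  "'a measure \<Rightarrow> nat \<Rightarrow> nat \<Rightarrow> (nat \<Rightarrow> nat \<Rightarrow> real) \<Rightarrow> ('a \<Rightarrow> nat \<Rightarrow> nat \<Rightarrow> real) \<Rightarrow> ('a \<Rightarrow> nat \<Rightarrow> real) \<Rightarrow> bool" where
  "gaussian_data M n p S X E \<longleftrightarrow>
    (\<forall>(A :: nat \<Rightarrow> nat \<Rightarrow> real) (b :: nat \<Rightarrow> real).
      let v = (\<Sum>i<n. \<Sum>j<p. \<Sum>l<p. A i j * S j l * A i l) + (\<Sum>i<n. (b i)\<^sup>2) in
      v > 0 \<longrightarrow>
      distributed M lborel
        (\<lambda>\<omega>. (\<Sum>i<n. \<Sum>j<p. A i j * X \<omega> i j) + (\<Sum>i<n. b i * E \<omega> i))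
        (normal_density 0 (sqrt v)))"

definition min_eig :: "nat \<Rightarrow> (nat \<Rightarrow> nat \<Rightarrow> real) \<Rightarrow> real" where
  "min_eig p S = Inf {(\<Sum>j<p. \<Sum>l<p. a j * S j l * a l) / (\<Sum>j<p. (a j)\<^sup>2) | a. \<exists>j<p. a j \<noteq> 0}"

text \<open>gamma^0 = Sigma_{-1,-1}^{-1} E x_{-1}^T x_1, vectors indexed by {1..<p}.\<close>
definition gamma0 :: "nat \<Rightarrow> (nat \<Rightarrow> nat \<Rightarrow> real) \<Rightarrow> nat \<Rightarrow> real" where
  "gamma0 p S = (THE g. (\<forall>j. j \<notin> {1..<p} \<longrightarrow> g j = 0) \<and>
       (\<forall>k\<in>{1..<p}. (\<Sum>j\<in>{1..<p}. S k j * g j) = S k 0))"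

definition rate :: "nat \<Rightarrow> nat \<Rightarrow> real" where
  "rate n p = sqrt (ln (real p) / real n)"

definition lasso_obj :: "nat \<Rightarrow> nat \<Rightarrow> real \<Rightarrow> (nat \<Rightarrow> nat \<Rightarrow> real) \<Rightarrow> (nat \<Rightarrow> real) \<Rightarrow> real" where
  "lasso_obj n p lam Xm c =
     (\<Sum>i<n. (Xm i 0 - (\<Sum>k\<in>{1..<p}. Xm i k * c k))\<^sup>2) / real n + 2 * lam * (\<Sum>k\<in>{1..<p}. \<bar>c k\<bar>)"

definition thetahat :: "nat \<Rightarrow> nat \<Rightarrow> real \<Rightarrow> (nat \<Rightarrow> nat \<Rightarrow> real) \<Rightarrow> (nat \<Rightarrow> real) \<Rightarrow> nat \<Rightarrow> real" where
  "thetahat n p lam Xm g j =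
     (if j = 0 then 1 else if j \<in> {1..<p} then - g j else 0) /
     ((\<Sum>i<n. (Xm i 0 - (\<Sum>k\<in>{1..<p}. Xm i k * g k))\<^sup>2) / real n + lam * (\<Sum>k\<in>{1..<p}. \<bar>g k\<bar>))"

definition debiased :: "nat \<Rightarrow> nat \<Rightarrow> real \<Rightarrow> (nat \<Rightarrow> nat \<Rightarrow> real) \<Rightarrow> (nat \<Rightarrow> real) \<Rightarrow> (nat \<Rightarrow> real) \<Rightarrow> (nat \<Rightarrow> real) \<Rightarrow> real" where
  "debiased n p lam Xm Yv g bh =
     bh 0 + (\<Sum>j<p. thetahat n p lam Xm g j * (\<Sum>i<n. Xm i j * (Yv i - (\<Sum>k<p. Xm i k * bh k)))) / real n"

definition sighat :: "nat \<Rightarrow> nat \<Rightarrow> real \<Rightarrow> (nat \<Rightarrow> nat \<Rightarrow> real) \<Rightarrow> (nat \<Rightarrow> real) \<Rightarrow> real" where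
  "sighat n p lam Xm g = (\<Sum>i<n. (\<Sum>j<p. Xm i j * thetahat n p lam Xm g j)\<^sup>2) / real n"

text \<open>Response Y = X beta0 + eps (coupling realising P_beta0 for every beta0).\<close>
definition resp :: "nat \<Rightarrow> (nat \<Rightarrow> nat \<Rightarrow> real) \<Rightarrow> (nat \<Rightarrow> real) \<Rightarrow> (nat \<Rightarrow> real) \<Rightarrow> nat \<Rightarrow> real" where
  "resp p Xm e beta i = (\<Sum>k<p. Xm i k * beta k) + e i"

definition unif_oP :: "(nat \<Rightarrow> 'a measure) \<Rightarrow> (nat \<Rightarrow> 'b set) \<Rightarrow> (nat \<Rightarrow> 'b \<Rightarrow> 'a \<Rightarrow> real) \<Rightarrow> (nat \<Rightarrow> real) \<Rightarrow> bool" where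
  "unif_oP M B Z r \<longleftrightarrow>
     (\<forall>\<eta>>0. \<forall>\<delta>>0. eventually (\<lambda>n. \<forall>\<beta>\<in>B n.
        measure (M n) {\<omega> \<in> space (M n). \<bar>Z n \<beta> \<omega>\<bar> > \<eta> * r n} \<le> \<delta>) sequentially)"

definition Phi :: "real \<Rightarrow> real" where
  "Phi z = measure (density lborel std_normal_density) {..z}"

end

theory Submission
  imports Defs
begin

text \<open>The KKT conditions of the Lasso for \<open>\<gamma>\<close> bound the remainder of the debiased estimator by
  \<open>\<lambda> / \<tau>\<^sup>2\<close> times the \<open>\<ell>\<^sub>1\<close>-error of the initial estimator, where \<open>\<tau>\<^sup>2\<close> is the denominator of
  \<open>\<Theta>\<^sub>1\<close>. Both \<open>\<tau>\<^sup>2\<close> and the mean squared Lasso residual converge to \<open>1 / \<Theta>\<^sup>\<sharp>\<^sub>1\<^sub>1\<close>: comparing the Lasso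
  with \<open>\<gamma>\<^sup>\<sharp>\<close> gives a slow-rate bound without any compatibility condition as soon as \<open>\<lambda>\<close> dominates
  the correlations of the columns with \<open>U = X\<^sub>1 - X\<^sub>-\<^sub>1 \<gamma>\<^sup>\<sharp>\<close>, which eligibility and a union bound
  guarantee when \<open>p\<close> is large. The Lasso residual is a
  measurable function of the design, hence independent of the noise, and its normalised inner product
  with the noise is exactly standard normal; this gives the limit law by Slutsky's argument.\<close>

section \<open>Uniqueness of multivariate characteristic functions\<close>

text \<open>The data are specified only through the laws of scalar linear combinations. Independence
  of noise and design, or of two uncorrelated row combinations, must therefore be recovered from the
  factorisation of characteristic functions, and this calls for a multivariate uniqueness theorem.
  The constant in front of \<open>\<lambda>\<close> may depend on \<open>Cs\<close> alone, while the
  admissible failure probability \<open>\<delta>\<close> is arbitrary. The union bound needs a level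
  of order \<open>sqrt (ln (p / \<delta>) / n)\<close>, which a fixed multiple of
  \<open>rate n p\<close> reaches once \<open>p \<ge> 2 / \<delta>\<close>. Otherwise
  \<open>p\<close> is bounded in terms of \<open>\<delta>\<close>; the eigenvalue bound then passes
  to the empirical Gram matrix, and the resulting compatibility gives an error of order
  \<open>1 / n\<close> without any domination by \<open>\<lambda>\<close>. The selection
  \<open>ghat\<close> of minimisers is arbitrary and is known to be measurable only along the
  sample, so it need not be a Borel function of the design. The residual does not depend on the
  selection and is continuous in the design, and this yields the Borel map that the independence
  argument requires.\<close>

lemma weighted_law:
  fixes D V :: "'a \<Rightarrow> real"
  assumes "prob_space M" and [measurable]: "V \<in> borel_measurable M" "D \<in> borel_measurable M"
    and D: "\<And>x. 0 \<le> D x" "\<And>x. D x \<le> C" and m: "m = (LINT x|M. D x)" "m > 0"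
  defines "N \<equiv> distr (density M (\<lambda>x. ennreal (D x / m))) borel V"
  shows "real_distribution N"
    and "char N t = (CLINT x|M. of_real (D x) * iexp (t * V x)) / of_real m"
    and "A \<in> sets borel \<Longrightarrow> measure N A = (LINT x|M. D x * indicator A (V x)) / m"
proof -
  interpret prob_space M by fact
  have iD: "integrable M D"
    by (rule integrable_const_bound[where B=C]) (use D in auto)
  have pd: "prob_space (density M (\<lambda>x. ennreal (D x / m)))"
  proof
    have "emeasure (density M (\<lambda>x. ennreal (D x / m))) (space M) = (\<integral>\<^sup>+x. ennreal (D x / m) \<partial>M)"
      by (subst emeasure_density) (auto intro!: nn_integral_cong)
    also have "\<dots> = ennreal (LINT x|M. D x / m)"
      by (rule nn_integral_eq_integral) (use iD D m in auto)
    also have "\<dots> = 1" using m by simp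
    finally show "emeasure (density M (\<lambda>x. ennreal (D x / m))) (space (density M (\<lambda>x. ennreal (D x / m)))) = 1"
      by simp
  qed
  interpret d: prob_space "density M (\<lambda>x. ennreal (D x / m))" by fact
  have "prob_space N" unfolding N_def by (rule d.prob_space_distr) simp
  then show rd: "real_distribution N"
    unfolding N_def by (intro d.real_distribution_distr) auto
  have "char N t = (CLINT x|density M (\<lambda>x. ennreal (D x / m)). iexp (t * V x))"
    unfolding char_def N_def by (subst integral_distr) auto
  also have "\<dots> = (CLINT x|M. (D x / m) *\<^sub>R iexp (t * V x))"
    by (subst integral_density) (use D m in auto)
  also have "\<dots> = (CLINT x|M. (of_real (D x) * iexp (t * V x)) / of_real m)"
    by (rule Bochner_Integration.integral_cong) (auto simp: scaleR_conv_of_real)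
  finally show "char N t = (CLINT x|M. of_real (D x) * iexp (t * V x)) / of_real m" by simp
  assume A[measurable]: "A \<in> sets borel"
  have VA: "V -` A \<inter> space M \<in> sets M" by simp
  have "measure N A = (LINT x|N. indicator A x)"
    using A by (simp add: N_def)
  also have "\<dots> = (LINT x|density M (\<lambda>x. ennreal (D x / m)). indicator A (V x))"
    unfolding N_def by (subst integral_distr) auto
  also have "\<dots> = (LINT x|M. (D x / m) * indicator A (V x))"
    by (subst integral_density) (use D m in auto)
  also have "\<dots> = (LINT x|M. (D x * indicator A (V x)) / m)"
    by (rule Bochner_Integration.integral_cong) auto
  finally show "measure N A = (LINT x|M. D x * indicator A (V x)) / m" by simp
qed

text \<open>Dividing by the total mass turns the weights into densities, so one-dimensional
  uniqueness applies to the tilted laws; frequency \<open>s = 0\<close> shows that the masses agree.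
  A weight of mass zero cannot be normalised, but it vanishes almost everywhere and both sides are
  0.\<close>

lemma weighted_uniqueness:
  fixes D1 V1 :: "'a \<Rightarrow> real" and D2 V2 :: "'b \<Rightarrow> real"
  assumes ps: "prob_space M1" "prob_space M2"
    and [measurable]: "V1 \<in> borel_measurable M1" "D1 \<in> borel_measurable M1"
      "V2 \<in> borel_measurable M2" "D2 \<in> borel_measurable M2"
    and D: "\<And>x. 0 \<le> D1 x" "\<And>x. D1 x \<le> C" "\<And>x. 0 \<le> D2 x" "\<And>x. D2 x \<le> C"
    and eq: "\<And>s. (CLINT x|M1. of_real (D1 x) * iexp (s * V1 x)) = (CLINT x|M2. of_real (D2 x) * iexp (s * V2 x))"
    and A[measurable]: "A \<in> sets borel"
  shows "(LINT x|M1. D1 x * indicator A (V1 x)) = (LINT x|M2. D2 x * indicator A (V2 x))"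
proof -
  interpret p1: prob_space M1 by fact
  interpret p2: prob_space M2 by fact
  define m where "m = (LINT x|M1. D1 x)"
  have iD1: "integrable M1 D1"
    by (rule p1.integrable_const_bound[where B=C]) (use D in auto)
  have iD2: "integrable M2 D2"
    by (rule p2.integrable_const_bound[where B=C]) (use D in auto)
  have m2: "m = (LINT x|M2. D2 x)"
  proof -
    have "complex_of_real (LINT x|M1. D1 x) = of_real (LINT x|M2. D2 x)"
      using eq[of 0] by simp
    then show ?thesis unfolding m_def by (simp only: of_real_eq_iff)
  qed
  have m0: "0 \<le> m" unfolding m_def using D by (intro integral_nonneg_AE) auto
  show ?thesis
  proof (cases "m = 0")
    case True
    have "AE x in M1. D1 x = 0"
      using integral_nonneg_eq_0_iff_AE[OF iD1] D True m_def by auto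
    then have 1: "(LINT x|M1. D1 x * indicator A (V1 x)) = (LINT x|M1. 0)"
      by (intro integral_cong_AE) auto
    have "AE x in M2. D2 x = 0"
      using integral_nonneg_eq_0_iff_AE[OF iD2] D True m2 by auto
    then have 2: "(LINT x|M2. D2 x * indicator A (V2 x)) = (LINT x|M2. 0)"
      by (intro integral_cong_AE) auto
    show ?thesis using 1 2 by simp
  next
    case False
    then have mp: "m > 0" using m0 by simp
    note w1 = weighted_law[OF ps(1) \<open>V1 \<in> _\<close> \<open>D1 \<in> _\<close> D(1,2) m_def mp]
    note w2 = weighted_law[OF ps(2) \<open>V2 \<in> _\<close> \<open>D2 \<in> _\<close> D(3,4) m2 mp]
    have "distr (density M1 (\<lambda>x. ennreal (D1 x / m))) borel V1 = distr (density M2 (\<lambda>x. ennreal (D2 x / m))) borel V2"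
      by (rule Levy_uniqueness[OF w1(1) w2(1)]) (simp only: fun_eq_iff w1(2) w2(2) eq simp_thms)
    then have "(LINT x|M1. D1 x * indicator A (V1 x)) / m = (LINT x|M2. D2 x * indicator A (V2 x)) / m"
      using w1(3)[OF A] w2(3)[OF A] by (simp only:)
    then show ?thesis using mp by simp
  qed
qed

lemma complex_of_real_cos_iexp: "complex_of_real (cos x) = (iexp x + iexp (- x)) / 2"
  by (simp add: complex_eq_iff Re_exp Im_exp)

lemma complex_of_real_sin_iexp: "complex_of_real (sin x) = (iexp x - iexp (- x)) / (2 * \<i>)"
  by (simp add: complex_eq_iff Re_exp Im_exp Re_divide Im_divide power2_eq_square)

lemma iexp_add: "iexp (x + y) = iexp x * iexp y"
  by (simp add: exp_add distrib_left)

text \<open>Induction on \<open>J\<close> turns one coordinate after another into an indicator. The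
  exponential keeps all of \<open>I\<close>, so that the induction hypothesis remains available at
  shifted frequencies of the new coordinate. Uniqueness asks for nonnegative weights, hence the
  detour through \<open>1 + cos\<close> and \<open>1 + sin\<close>.\<close>

lemma fourier_rectangle_eq:
  fixes V1 :: "'k \<Rightarrow> 'a \<Rightarrow> real" and V2 :: "'k \<Rightarrow> 'b \<Rightarrow> real"
  assumes ps: "prob_space M1" "prob_space M2" and fin: "finite I"
    and m1[measurable]: "\<And>k. k \<in> I \<Longrightarrow> V1 k \<in> borel_measurable M1"
    and m2[measurable]: "\<And>k. k \<in> I \<Longrightarrow> V2 k \<in> borel_measurable M2"
    and eq: "\<And>t. (CLINT x|M1. iexp (\<Sum>k\<in>I. t k * V1 k x)) = (CLINT x|M2. iexp (\<Sum>k\<in>I. t k * V2 k x))"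
    and B: "\<And>k. k \<in> I \<Longrightarrow> B k \<in> sets borel"
    and J: "J \<subseteq> I"
  shows "(CLINT x|M1. of_real (\<Prod>k\<in>J. indicator (B k) (V1 k x)) * iexp (\<Sum>k\<in>I. t k * V1 k x)) =
         (CLINT x|M2. of_real (\<Prod>k\<in>J. indicator (B k) (V2 k x)) * iexp (\<Sum>k\<in>I. t k * V2 k x))"
proof -
  interpret p1: prob_space M1 by fact
  interpret p2: prob_space M2 by fact
  have "finite J" using J fin finite_subset by blast
  then show ?thesis using J
  proof (induction J arbitrary: t)
    case empty
    then show ?case using eq by simp
  next
    case (insert j J)
    define T1 where "T1 t x = (\<Sum>k\<in>I. t k * V1 k x)" for t x
    define T2 where "T2 t x = (\<Sum>k\<in>I. t k * V2 k x)" for t x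
    define P1 where "P1 x = (\<Prod>k\<in>J. indicator (B k) (V1 k x) :: real)" for x
    define P2 where "P2 x = (\<Prod>k\<in>J. indicator (B k) (V2 k x) :: real)" for x
    have jI: "j \<in> I" and JI: "J \<subseteq> I" using insert by auto
    have [measurable]: "T1 t \<in> borel_measurable M1" "T2 t \<in> borel_measurable M2" for t
      unfolding T1_def T2_def by (auto intro!: borel_measurable_sum borel_measurable_times m1 m2)
    have [measurable]: "V1 j \<in> borel_measurable M1" "V2 j \<in> borel_measurable M2" "B j \<in> sets borel"
      using jI m1 m2 B by auto
    have [measurable]: "P1 \<in> borel_measurable M1" 
      unfolding P1_def
    proof (intro borel_measurable_prod)
      fix k assume "k \<in> J"
      then have [measurable]: "B k \<in> sets borel" "V1 k \<in> borel_measurable M1" using B m1 JI by auto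
      show "(\<lambda>x. indicator (B k) (V1 k x) :: real) \<in> borel_measurable M1" by simp
    qed
    have [measurable]: "P2 \<in> borel_measurable M2" 
      unfolding P2_def
    proof (intro borel_measurable_prod)
      fix k assume "k \<in> J"
      then have [measurable]: "B k \<in> sets borel" "V2 k \<in> borel_measurable M2" using B m2 JI by auto
      show "(\<lambda>x. indicator (B k) (V2 k x) :: real) \<in> borel_measurable M2" by simp
    qed
    have P1b: "0 \<le> P1 x" "P1 x \<le> 1" for x
      unfolding P1_def by (auto intro!: prod_nonneg prod_le_1 simp: indicator_def)
    have P2b: "0 \<le> P2 x" "P2 x \<le> 1" for x
      unfolding P2_def by (auto intro!: prod_nonneg prod_le_1 simp: indicator_def)
    have IH: "(CLINT x|M1. of_real (P1 x) * iexp (T1 t x)) = (CLINT x|M2. of_real (P2 x) * iexp (T2 t x))" for t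
      using insert.IH[OF JI] unfolding P1_def P2_def T1_def T2_def by simp
    have i1: "integrable M1 (\<lambda>x. of_real (P1 x) * iexp (T1 t x))" for t
      by (rule p1.integrable_const_bound[where B=1]) (use P1b in \<open>auto simp: norm_mult\<close>)
    have i2: "integrable M2 (\<lambda>x. of_real (P2 x) * iexp (T2 t x))" for t
      by (rule p2.integrable_const_bound[where B=1]) (use P2b in \<open>auto simp: norm_mult\<close>)
    \<comment> \<open>Shifting the frequency of coordinate \<open>j\<close> by \<open>s\<close>
      multiplies the exponential by \<open>iexp (s * V j)\<close>, the factor whose transform
      determines the weighted law of \<open>V j\<close>.\<close>
    define a where "a t s k = t k + (if k = j then s else 0 :: real)" for t s k
    have Ta1: "T1 (a t s) x = T1 t x + s * V1 j x" for t s x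
    proof -
      have "T1 (a t s) x = (\<Sum>k\<in>I. t k * V1 k x + (if k = j then s * V1 k x else 0))"
        unfolding T1_def a_def by (intro sum.cong) (auto simp: algebra_simps)
      then show ?thesis using fin jI by (simp add: sum.distrib T1_def)
    qed
    have Ta2: "T2 (a t s) x = T2 t x + s * V2 j x" for t s x
    proof -
      have "T2 (a t s) x = (\<Sum>k\<in>I. t k * V2 k x + (if k = j then s * V2 k x else 0))"
        unfolding T2_def a_def by (intro sum.cong) (auto simp: algebra_simps)
      then show ?thesis using fin jI by (simp add: sum.distrib T2_def)
    qed
    have Tn: "T1 (\<lambda>k. - t k) x = - T1 t x" "T2 (\<lambda>k. - t k) y = - T2 t y" "T1 (\<lambda>k. 0) x = 0" "T2 (\<lambda>k. 0) y = 0" for t x y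
      unfolding T1_def T2_def by (auto simp: sum_negf)
    have gen_cos: "P * (1 + (x + y) / 2) * z = P * (iexp 0 * z) + (P * (x * z) + P * (y * z)) / 2"
      and gen_sin: "P * (1 + (x - y) / (2 * \<i>)) * z = P * (iexp 0 * z) + (P * (x * z) - P * (y * z)) / (2 * \<i>)"
      for P x y z :: complex by (simp_all add: field_simps)
    \<comment> \<open>Written with exponentials, the weight has the frequencies 0, \<open>t\<close>
      and \<open>- t\<close>; after the shift by \<open>s\<close> each of the three terms is an
      instance of the induction hypothesis.\<close>
    have cos_eq: "(LINT x|M1. (P1 x * (1 + cos (T1 t x))) * indicator (B j) (V1 j x)) =
        (LINT x|M2. (P2 x * (1 + cos (T2 t x))) * indicator (B j) (V2 j x))" for t
    proof (rule weighted_uniqueness[where C=2, OF ps])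
      show "0 \<le> P1 x * (1 + cos (T1 t x))" "0 \<le> P2 y * (1 + cos (T2 t y))" for x y
        using P1b P2b by (auto intro!: mult_nonneg_nonneg simp: add_increasing cos_ge_minus_one 
            add.commute minus_le_iff) (metis cos_ge_minus_one add.commute le_minus_iff neg_le_iff_le real_0_le_add_iff)+
      show "P1 x * (1 + cos (T1 t x)) \<le> 2" "P2 y * (1 + cos (T2 t y)) \<le> 2" for x y
        using mult_mono[of "P1 x" 1 "1 + cos (T1 t x)" 2] mult_mono[of "P2 y" 1 "1 + cos (T2 t y)" 2]
          P1b P2b cos_ge_minus_one[of "T1 t x"] cos_ge_minus_one[of "T2 t y"] by auto
      fix s
      have 1: "of_real (P1 x * (1 + cos (T1 t x))) * iexp (s * V1 j x) =
          of_real (P1 x) * iexp (T1 (a (\<lambda>k. 0) s) x) + (of_real (P1 x) * iexp (T1 (a t s) x)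
           + of_real (P1 x) * iexp (T1 (a (\<lambda>k. - t k) s) x)) / 2" for x
        unfolding Ta1 Tn iexp_add unfolding of_real_mult of_real_add of_real_1 complex_of_real_cos_iexp
        by (rule gen_cos)
      have 2: "of_real (P2 x * (1 + cos (T2 t x))) * iexp (s * V2 j x) =
          of_real (P2 x) * iexp (T2 (a (\<lambda>k. 0) s) x) + (of_real (P2 x) * iexp (T2 (a t s) x)
           + of_real (P2 x) * iexp (T2 (a (\<lambda>k. - t k) s) x)) / 2" for x
        unfolding Ta2 Tn iexp_add unfolding of_real_mult of_real_add of_real_1 complex_of_real_cos_iexp
        by (rule gen_cos)
      show "(CLINT x|M1. of_real (P1 x * (1 + cos (T1 t x))) * iexp (s * V1 j x)) =
        (CLINT x|M2. of_real (P2 x * (1 + cos (T2 t x))) * iexp (s * V2 j x))"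
        unfolding 1 2 using i1 i2 IH by (simp del: of_real_add of_real_mult)
    qed simp_all
    have sin_eq: "(LINT x|M1. (P1 x * (1 + sin (T1 t x))) * indicator (B j) (V1 j x)) =
        (LINT x|M2. (P2 x * (1 + sin (T2 t x))) * indicator (B j) (V2 j x))" for t
    proof (rule weighted_uniqueness[where C=2, OF ps])
      show "0 \<le> P1 x * (1 + sin (T1 t x))" "0 \<le> P2 y * (1 + sin (T2 t y))" for x y
        using P1b P2b by (auto intro!: mult_nonneg_nonneg) (metis sin_ge_minus_one add.commute le_minus_iff neg_le_iff_le real_0_le_add_iff)+
      show "P1 x * (1 + sin (T1 t x)) \<le> 2" "P2 y * (1 + sin (T2 t y)) \<le> 2" for x y
        using mult_mono[of "P1 x" 1 "1 + sin (T1 t x)" 2] mult_mono[of "P2 y" 1 "1 + sin (T2 t y)" 2]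
          P1b P2b sin_ge_minus_one[of "T1 t x"] sin_ge_minus_one[of "T2 t y"] by auto
      fix s
      have 1: "of_real (P1 x * (1 + sin (T1 t x))) * iexp (s * V1 j x) =
          of_real (P1 x) * iexp (T1 (a (\<lambda>k. 0) s) x) + (of_real (P1 x) * iexp (T1 (a t s) x)
           - of_real (P1 x) * iexp (T1 (a (\<lambda>k. - t k) s) x)) / (2 * \<i>)" for x
        unfolding Ta1 Tn iexp_add unfolding of_real_mult of_real_add of_real_1 complex_of_real_sin_iexp
        by (rule gen_sin)
      have 2: "of_real (P2 x * (1 + sin (T2 t x))) * iexp (s * V2 j x) =
          of_real (P2 x) * iexp (T2 (a (\<lambda>k. 0) s) x) + (of_real (P2 x) * iexp (T2 (a t s) x)
           - of_real (P2 x) * iexp (T2 (a (\<lambda>k. - t k) s) x)) / (2 * \<i>)" for x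
        unfolding Ta2 Tn iexp_add unfolding of_real_mult of_real_add of_real_1 complex_of_real_sin_iexp
        by (rule gen_sin)
      show "(CLINT x|M1. of_real (P1 x * (1 + sin (T1 t x))) * iexp (s * V1 j x)) =
        (CLINT x|M2. of_real (P2 x * (1 + sin (T2 t x))) * iexp (s * V2 j x))"
        unfolding 1 2 using i1 i2 IH by (simp del: of_real_add of_real_mult)
    qed simp_all
    have I1: "integrable M1 (\<lambda>x. P1 x * f (T1 t x) * indicator (B j) (V1 j x))"
      if [measurable]: "f \<in> borel_measurable borel" and f: "\<And>y. \<bar>f y\<bar> \<le> 1" for f :: "real \<Rightarrow> real"
      by (rule p1.integrable_const_bound[where B=1])
        (use P1b f in \<open>auto simp: abs_mult indicator_def intro!: mult_le_one\<close>)
    have I2: "integrable M2 (\<lambda>x. P2 x * f (T2 t x) * indicator (B j) (V2 j x))"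
      if [measurable]: "f \<in> borel_measurable borel" and f: "\<And>y. \<bar>f y\<bar> \<le> 1" for f :: "real \<Rightarrow> real"
      by (rule p2.integrable_const_bound[where B=1])
        (use P2b f in \<open>auto simp: abs_mult indicator_def intro!: mult_le_one\<close>)
    have split: "P * (1 + c) * i = P * 1 * i + P * c * i" for P c i :: real
      by (simp add: algebra_simps)
    note J1 = I1[of "\<lambda>_. 1", simplified] I2[of "\<lambda>_. 1", simplified] I1[of cos] I1[of sin] I2[of cos] I2[of sin]
    \<comment> \<open>At frequency 0 the weight is \<open>2 * P\<close>, so the constant part of
      \<open>1 + cos\<close> and \<open>1 + sin\<close> agrees on both sides and can be
      subtracted.\<close>
    have one: "(LINT x|M1. P1 x * indicator (B j) (V1 j x)) = (LINT x|M2. P2 x * indicator (B j) (V2 j x))"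
      using cos_eq[of "\<lambda>k. 0"] unfolding Tn
      by (simp add: mult.commute[of _ 2] mult.assoc[of 2])
    have C: "(LINT x|M1. P1 x * cos (T1 t x) * indicator (B j) (V1 j x)) = (LINT x|M2. P2 x * cos (T2 t x) * indicator (B j) (V2 j x))"
      using cos_eq[of t] one J1 unfolding split by simp
    have S: "(LINT x|M1. P1 x * sin (T1 t x) * indicator (B j) (V1 j x)) = (LINT x|M2. P2 x * sin (T2 t x) * indicator (B j) (V2 j x))"
      using sin_eq[of t] one J1 unfolding split by simp
    have e: "of_real (indicator A v * P) * iexp T = of_real (P * cos T * indicator A v) + \<i> * of_real (P * sin T * indicator A v)"
      for A and v P T :: real
      by (simp add: cis_conv_exp[symmetric] complex_eq_iff)
    have 1: "(CLINT x|M1. of_real (\<Prod>k\<in>insert j J. indicator (B k) (V1 k x)) * iexp (\<Sum>k\<in>I. t k * V1 k x)) =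
       of_real (LINT x|M1. P1 x * cos (T1 t x) * indicator (B j) (V1 j x)) + \<i> * of_real (LINT x|M1. P1 x * sin (T1 t x) * indicator (B j) (V1 j x))"
      unfolding prod.insert[OF insert.hyps(1,2)] P1_def[symmetric] T1_def[symmetric] e
      using J1 by (simp del: of_real_mult)
    have 2: "(CLINT x|M2. of_real (\<Prod>k\<in>insert j J. indicator (B k) (V2 k x)) * iexp (\<Sum>k\<in>I. t k * V2 k x)) =
       of_real (LINT x|M2. P2 x * cos (T2 t x) * indicator (B j) (V2 j x)) + \<i> * of_real (LINT x|M2. P2 x * sin (T2 t x) * indicator (B j) (V2 j x))"
      unfolding prod.insert[OF insert.hyps(1,2)] P2_def[symmetric] T2_def[symmetric] e
      using J1 by (simp del: of_real_mult)
    show ?case unfolding 1 2 C S ..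
  qed
qed

text \<open>Rectangles determine a finite measure on a finite product, and their probabilities are
  the case \<open>J = I\<close> at frequency 0 of the preceding lemma.\<close>

theorem Levy_uniqueness_PiM:
  fixes V1 :: "'k \<Rightarrow> 'a \<Rightarrow> real" and V2 :: "'k \<Rightarrow> 'b \<Rightarrow> real"
  assumes ps: "prob_space M1" "prob_space M2" and fin: "finite I"
    and m1[measurable]: "\<And>k. k \<in> I \<Longrightarrow> V1 k \<in> borel_measurable M1"
    and m2[measurable]: "\<And>k. k \<in> I \<Longrightarrow> V2 k \<in> borel_measurable M2"
    and eq: "\<And>t. (CLINT x|M1. iexp (\<Sum>k\<in>I. t k * V1 k x)) = (CLINT x|M2. iexp (\<Sum>k\<in>I. t k * V2 k x))"
  shows "distr M1 (PiM I (\<lambda>_. borel)) (\<lambda>x. \<lambda>k\<in>I. V1 k x) = distr M2 (PiM I (\<lambda>_. borel)) (\<lambda>x. \<lambda>k\<in>I. V2 k x)"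
    (is "?N1 = ?N2")
proof (rule measure_eqI_PiM_finite[OF fin])
  interpret p1: prob_space M1 by fact
  interpret p2: prob_space M2 by fact
  have r1[measurable]: "(\<lambda>x. \<lambda>k\<in>I. V1 k x) \<in> measurable M1 (PiM I (\<lambda>_. borel))"
    and r2[measurable]: "(\<lambda>x. \<lambda>k\<in>I. V2 k x) \<in> measurable M2 (PiM I (\<lambda>_. borel))"
    by (intro measurable_restrict m1 m2; assumption)+
  interpret q1: prob_space ?N1 by (rule p1.prob_space_distr) simp
  show "sets ?N1 = sets (PiM I (\<lambda>_. borel))" "sets ?N2 = sets (PiM I (\<lambda>_. borel))" by auto
  fix B :: "'k \<Rightarrow> real set" assume B: "\<And>i. i \<in> I \<Longrightarrow> B i \<in> sets borel"
  have S: "Pi\<^sub>E I B \<in> sets (PiM I (\<lambda>_. borel))" using B fin by (intro sets_PiM_I_finite) auto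
  have e1: "(CLINT x|M1. of_real (\<Prod>k\<in>I. indicator (B k) (V1 k x))) = of_real (measure M1 ((\<lambda>x. \<lambda>k\<in>I. V1 k x) -` Pi\<^sub>E I B \<inter> space M1))"
  proof -
    have "(CLINT x|M1. of_real (\<Prod>k\<in>I. indicator (B k) (V1 k x))) = 
      complex_of_real (LINT x|M1. indicator ((\<lambda>x. \<lambda>k\<in>I. V1 k x) -` Pi\<^sub>E I B \<inter> space M1) x)"
      unfolding integral_complex_of_real[symmetric]
      by (rule Bochner_Integration.integral_cong[OF refl])
        (auto simp: indicator_def prod_eq_1_iff fin PiE_iff simp del: of_real_prod)
    then show ?thesis using measurable_sets[OF r1 S] by simp
  qed
  have e2: "(CLINT x|M2. of_real (\<Prod>k\<in>I. indicator (B k) (V2 k x))) = of_real (measure M2 ((\<lambda>x. \<lambda>k\<in>I. V2 k x) -` Pi\<^sub>E I B \<inter> space M2))"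
  proof -
    have "(CLINT x|M2. of_real (\<Prod>k\<in>I. indicator (B k) (V2 k x))) = 
      complex_of_real (LINT x|M2. indicator ((\<lambda>x. \<lambda>k\<in>I. V2 k x) -` Pi\<^sub>E I B \<inter> space M2) x)"
      unfolding integral_complex_of_real[symmetric]
      by (rule Bochner_Integration.integral_cong[OF refl])
        (auto simp: indicator_def prod_eq_1_iff fin PiE_iff simp del: of_real_prod)
    then show ?thesis using measurable_sets[OF r2 S] by simp
  qed
  have "complex_of_real (measure M1 ((\<lambda>x. \<lambda>k\<in>I. V1 k x) -` Pi\<^sub>E I B \<inter> space M1)) = of_real (measure M2 ((\<lambda>x. \<lambda>k\<in>I. V2 k x) -` Pi\<^sub>E I B \<inter> space M2))"
    using fourier_rectangle_eq[OF ps fin m1 m2 eq B order_refl, where t="\<lambda>k. 0"] e1 e2 by simp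
  then have "measure M1 ((\<lambda>x. \<lambda>k\<in>I. V1 k x) -` Pi\<^sub>E I B \<inter> space M1) = measure M2 ((\<lambda>x. \<lambda>k\<in>I. V2 k x) -` Pi\<^sub>E I B \<inter> space M2)"
    by (simp only: of_real_eq_iff)
  then show "emeasure ?N1 (Pi\<^sub>E I B) = emeasure ?N2 (Pi\<^sub>E I B)"
    using S by (simp add: emeasure_distr p1.emeasure_eq_measure p2.emeasure_eq_measure)
next
  interpret p1: prob_space M1 by fact
  have r1[measurable]: "(\<lambda>x. \<lambda>k\<in>I. V1 k x) \<in> measurable M1 (PiM I (\<lambda>_. borel))"
    by (intro measurable_restrict m1)
  interpret q1: prob_space ?N1 by (rule p1.prob_space_distr) simp
  show "range (\<lambda>_::nat. space (PiM I (\<lambda>_. borel :: real measure))) \<subseteq> prod_algebra I (\<lambda>_. borel)"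
    unfolding space_PiM by (auto intro!: prod_algebraI_finite fin)
  show "(\<Union>i::nat. space (PiM I (\<lambda>_. borel :: real measure))) = space (PiM I (\<lambda>_. borel))" by simp
  show "emeasure ?N1 (space (PiM I (\<lambda>_. borel :: real measure))) \<noteq> \<infinity>" for i :: nat
    using q1.emeasure_finite by simp
qed

text \<open>The joint law is compared with the one on \<open>M \<Otimes>\<^sub>M M\<close> in which the \<open>IA\<close>-coordinates are read
  from the first factor and the \<open>IB\<close>-coordinates from the second.\<close>

lemma distr_randomized_sum:
  fixes Z :: "'k \<Rightarrow> 'a \<Rightarrow> real" and h :: "'k \<Rightarrow> ('k \<Rightarrow> real) \<Rightarrow> real"
  assumes "prob_space M" and fin: "finite IA" "finite IB" and disj: "IA \<inter> IB = {}"
    and Z: "\<And>k. k \<in> IA \<union> IB \<Longrightarrow> Z k \<in> borel_measurable M"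
    and fact: "\<And>t. (CLINT x|M. iexp (\<Sum>k\<in>IA \<union> IB. t k * Z k x)) =
        (CLINT x|M. iexp (\<Sum>k\<in>IA. t k * Z k x)) * (CLINT x|M. iexp (\<Sum>k\<in>IB. t k * Z k x))"
    and h: "\<And>l. l \<in> IB \<Longrightarrow> h l \<in> borel_measurable (PiM IA (\<lambda>_. borel))"
    and N: "\<And>a. distr M borel (\<lambda>x. \<Sum>l\<in>IB. h l a * Z l x) = N"
  shows "distr M borel (\<lambda>x. \<Sum>l\<in>IB. h l (\<lambda>k\<in>IA. Z k x) * Z l x) = N"
proof -
  interpret prob_space M by fact
  interpret P: pair_prob_space M M ..
  let ?I = "IA \<union> IB"
  define Z' where "Z' k = (\<lambda>(x, y). if k \<in> IA then Z k x else Z k y)" for k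
  have Zm[measurable]: "Z k \<in> borel_measurable M" if "k \<in> ?I" for k using Z that by auto
  have Z'm[measurable]: "Z' k \<in> borel_measurable (M \<Otimes>\<^sub>M M)" if "k \<in> ?I" for k
    using Zm[OF that] unfolding Z'_def by (cases "k \<in> IA") auto
  have hm: "(\<lambda>x. h l (restrict x IA)) \<in> borel_measurable (PiM ?I (\<lambda>_. borel))" if "l \<in> IB" for l
    by (rule measurable_compose[OF measurable_restrict_subset h[OF that]]) auto
  have eq: "distr M (PiM ?I (\<lambda>_. borel)) (\<lambda>x. \<lambda>k\<in>?I. Z k x) =
      distr (M \<Otimes>\<^sub>M M) (PiM ?I (\<lambda>_. borel)) (\<lambda>x. \<lambda>k\<in>?I. Z' k x)"
  proof (rule Levy_uniqueness_PiM)
    show "prob_space M" by fact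
    show "prob_space (M \<Otimes>\<^sub>M M)" by (rule P.prob_space_axioms)
    show "finite ?I" using fin by auto
    fix t :: "'k \<Rightarrow> real"
    have mA: "(\<lambda>x. \<Sum>k\<in>IA. t k * Z k x) \<in> borel_measurable M"
      by (intro borel_measurable_sum borel_measurable_times Z) auto
    have mB: "(\<lambda>x. \<Sum>k\<in>IB. t k * Z k x) \<in> borel_measurable M"
      by (intro borel_measurable_sum borel_measurable_times Z) auto
    have e: "(\<Sum>k\<in>?I. t k * Z' k (x, y)) = (\<Sum>k\<in>IA. t k * Z k x) + (\<Sum>k\<in>IB. t k * Z k y)" for x y
    proof -
      have "(\<Sum>k\<in>IB. t k * Z' k (x, y)) = (\<Sum>k\<in>IB. t k * Z k y)"
        using disj by (intro sum.cong) (auto simp: Z'_def)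
      then show ?thesis
        by (subst sum.union_disjoint[OF fin disj]) (auto simp: Z'_def)
    qed
    \<comment> \<open>On the product the two groups of coordinates are independent by construction,
      so Fubini produces the product on the right of \<open>fact\<close>.\<close>
    have "(CLINT x|M \<Otimes>\<^sub>M M. iexp (\<Sum>k\<in>?I. t k * Z' k x)) =
        (CLINT x|M. (CLINT y|M. iexp (\<Sum>k\<in>?I. t k * Z' k (x, y))))"
    proof (rule P.integral_fst'[symmetric])
      have [measurable]: "(\<lambda>x. \<Sum>k\<in>?I. t k * Z' k x) \<in> borel_measurable (M \<Otimes>\<^sub>M M)"
        by (intro borel_measurable_sum borel_measurable_times Z'm) auto
      show "integrable (M \<Otimes>\<^sub>M M) (\<lambda>x. iexp (\<Sum>k\<in>?I. t k * Z' k x))"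
        by (rule P.integrable_iexp) auto
    qed
    also have "\<dots> = (CLINT x|M. iexp (\<Sum>k\<in>IA. t k * Z k x)) * (CLINT x|M. iexp (\<Sum>k\<in>IB. t k * Z k x))"
      unfolding e iexp_add by simp
    finally show "(CLINT x|M. iexp (\<Sum>k\<in>?I. t k * Z k x)) = (CLINT x|M \<Otimes>\<^sub>M M. iexp (\<Sum>k\<in>?I. t k * Z' k x))"
      unfolding fact by simp
  qed (use Zm Z'm in auto)
  define G where "G x = (\<Sum>l\<in>IB. h l (restrict x IA) * x l)" for x :: "'k \<Rightarrow> real"
  have G[measurable]: "G \<in> borel_measurable (PiM ?I (\<lambda>_. borel))"
    unfolding G_def
    by (intro borel_measurable_sum borel_measurable_times hm measurable_component_singleton) auto
  have r[measurable]: "(\<lambda>x. \<lambda>k\<in>?I. Z k x) \<in> measurable M (PiM ?I (\<lambda>_. borel))"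
    by (intro measurable_restrict Z)
  have r'[measurable]: "(\<lambda>x. \<lambda>k\<in>?I. Z' k x) \<in> measurable (M \<Otimes>\<^sub>M M) (PiM ?I (\<lambda>_. borel))"
    by (intro measurable_restrict Z'm)
  have restr: "restrict (restrict f ?I) IA = restrict f IA" for f :: "'k \<Rightarrow> real"
    by (auto simp: fun_eq_iff)
  have G1: "G (\<lambda>k\<in>?I. Z k x) = (\<Sum>l\<in>IB. h l (\<lambda>k\<in>IA. Z k x) * Z l x)" for x
    unfolding G_def restr by (intro sum.cong) auto
  have G2: "G (\<lambda>k\<in>?I. Z' k (x, y)) = (\<Sum>l\<in>IB. h l (\<lambda>k\<in>IA. Z k x) * Z l y)" for x y
    unfolding G_def restr using disj
    by (intro sum.cong refl arg_cong2[where f="(*)"] arg_cong[where f="h _"]) (auto simp: Z'_def fun_eq_iff)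
  have "distr M borel (\<lambda>x. G (\<lambda>k\<in>?I. Z k x)) = distr (distr M (PiM ?I (\<lambda>_. borel)) (\<lambda>x. \<lambda>k\<in>?I. Z k x)) borel G"
    by (subst distr_distr) (auto simp: comp_def)
  also have "\<dots> = distr (M \<Otimes>\<^sub>M M) borel (\<lambda>x. G (\<lambda>k\<in>?I. Z' k x))"
    unfolding eq by (subst distr_distr) (auto simp: comp_def)
  also have "\<dots> = N"
  proof (rule measure_eqI)
    show sN: "sets (distr (M \<Otimes>\<^sub>M M) borel (\<lambda>x. G (\<lambda>k\<in>?I. Z' k x))) = sets N"
      using N[of "\<lambda>_. 0", symmetric] by simp
    fix A assume "A \<in> sets (distr (M \<Otimes>\<^sub>M M) borel (\<lambda>x. G (\<lambda>k\<in>?I. Z' k x)))"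
    then have A[measurable]: "A \<in> sets borel" by simp
    let ?W = "(\<lambda>x. G (\<lambda>k\<in>?I. Z' k x)) -` A \<inter> space (M \<Otimes>\<^sub>M M)"
    have mG: "(\<lambda>x. G (\<lambda>k\<in>?I. Z' k x)) \<in> borel_measurable (M \<Otimes>\<^sub>M M)"
      by (rule measurable_compose[OF r' G])
    have W: "?W \<in> sets (M \<Otimes>\<^sub>M M)"
      by (rule measurable_sets[OF mG A])
    have "emeasure (distr (M \<Otimes>\<^sub>M M) borel (\<lambda>x. G (\<lambda>k\<in>?I. Z' k x))) A = emeasure (M \<Otimes>\<^sub>M M) ?W"
      by (rule emeasure_distr[OF mG A])
    also have "\<dots> = (\<integral>\<^sup>+x. emeasure M (Pair x -` ?W) \<partial>M)"
      by (rule emeasure_pair_measure_alt[OF W])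
    \<comment> \<open>With the first factor fixed the coefficients are constants, so
      \<open>N\<close> applies to every slice, and the slice measures do not depend on
      \<open>x\<close>.\<close>
    also have "\<dots> = (\<integral>\<^sup>+x. emeasure N A \<partial>M)"
    proof (rule nn_integral_cong)
      fix x assume x: "x \<in> space M"
      have "Pair x -` ?W = (\<lambda>y. \<Sum>l\<in>IB. h l (\<lambda>k\<in>IA. Z k x) * Z l y) -` A \<inter> space M"
        using x by (auto simp: G2 space_pair_measure)
      moreover have "(\<lambda>y. \<Sum>l\<in>IB. h l (\<lambda>k\<in>IA. Z k x) * Z l y) \<in> borel_measurable M"
        by (intro borel_measurable_sum borel_measurable_times Z) auto
      ultimately show "emeasure M (Pair x -` ?W) = emeasure N A"
        using A by (simp add: N[of "\<lambda>k\<in>IA. Z k x", symmetric] emeasure_distr)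
    qed
    also have "\<dots> = emeasure N A" by (simp add: emeasure_space_1)
    finally show "emeasure (distr (M \<Otimes>\<^sub>M M) borel (\<lambda>x. G (\<lambda>k\<in>?I. Z' k x))) A = emeasure N A" .
  qed
  finally show ?thesis unfolding G1 .
qed

section \<open>Characteristic function, moments and tails of a centred normal variable\<close>

lemma (in prob_space) iexp_normal:
  assumes "distributed M lborel T (normal_density 0 \<sigma>)" "0 < \<sigma>"
  shows "(CLINT x|M. iexp (T x)) = of_real (exp (- \<sigma>\<^sup>2 / 2))"
proof -
  have d: "distributed M lborel (\<lambda>x. T x / \<sigma>) std_normal_density"
    using assms normal_standard_normal_convert[OF assms(2), of T 0] by simp
  have [measurable]: "(\<lambda>x. T x / \<sigma>) \<in> borel_measurable M"
    using distributed_measurable[OF d] by simp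
  have e: "distr M borel (\<lambda>x. T x / \<sigma>) = std_normal_distribution"
    using distributed_distr_eq_density[OF d] by (simp cong: distr_cong)
  have "of_real (exp (- \<sigma>\<^sup>2 / 2)) = char (distr M borel (\<lambda>x. T x / \<sigma>)) \<sigma>"
    unfolding e by (simp add: char_std_normal_distribution)
  also have "\<dots> = (CLINT x|M. iexp (\<sigma> * (T x / \<sigma>)))"
    unfolding char_def by (subst integral_distr) auto
  also have "\<dots> = (CLINT x|M. iexp (T x))" using assms(2) by simp
  finally show ?thesis by simp
qed

lemma (in prob_space) normal_moments_2_4:
  assumes d: "distributed M lborel T (normal_density 0 \<sigma>)" and s: "0 < \<sigma>"
  shows "integrable M (\<lambda>x. T x ^ k)" "expectation (\<lambda>x. T x ^ 2) = \<sigma>\<^sup>2" "expectation (\<lambda>x. T x ^ 4) = 3 * \<sigma> ^ 4"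
proof -
  show "integrable M (\<lambda>x. T x ^ k)"
    using integrable_normal_moment[OF s, of 0 k] distributed_integrable[OF d, of "\<lambda>x. x ^ k"] by simp
  have "expectation (\<lambda>x. T x ^ 2) = (LINT x|lborel. normal_density 0 \<sigma> x * x ^ 2)"
    using distributed_integral[OF d, of "\<lambda>x. x ^ 2"] by simp
  also have "\<dots> = \<sigma>\<^sup>2" using integral_normal_moment_even[OF s, of 0 1] s by (simp add: power2_eq_square)
  finally show "expectation (\<lambda>x. T x ^ 2) = \<sigma>\<^sup>2" .
  have "expectation (\<lambda>x. T x ^ 4) = (LINT x|lborel. normal_density 0 \<sigma> x * x ^ 4)"
    using distributed_integral[OF d, of "\<lambda>x. x ^ 4"] by simp
  also have "\<dots> = 3 * \<sigma> ^ 4" using integral_normal_moment_even[OF s, of 0 2] s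
    by (simp add: field_simps fact_numeral power2_eq_square power4_eq_xxxx)
  finally show "expectation (\<lambda>x. T x ^ 4) = 3 * \<sigma> ^ 4" .
qed

text \<open>Chernoff bound at the exponents \<open>t\<close> and \<open>- t\<close>. The condition
  \<open>\<sigma> \<le> 1\<close> removes the variance from the bound, which is later used for many
  columns at once.\<close>

lemma (in prob_space) normal_tail:
  assumes d: "distributed M lborel T (normal_density 0 \<sigma>)" and s: "0 < \<sigma>" "\<sigma> \<le> 1" and t: "0 \<le> t"
  shows "prob {x \<in> space M. \<bar>T x\<bar> > t} \<le> 2 * exp (- t\<^sup>2 / 2)"
proof -
  \<comment> \<open>Completing the square: an exponential times a normal density is a multiple of a
    shifted normal density, which gives integrability and the moment generating function
    together.\<close>
  have mgf: "normal_density 0 \<sigma> x * exp (a * x) = exp (a\<^sup>2 * \<sigma>\<^sup>2 / 2) * normal_density (a * \<sigma>\<^sup>2) \<sigma> x" for a x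
  proof -
    have "- (x\<^sup>2 / (2 * \<sigma>\<^sup>2)) + a * x = a\<^sup>2 * \<sigma>\<^sup>2 / 2 + - ((x - a * \<sigma>\<^sup>2)\<^sup>2 / (2 * \<sigma>\<^sup>2))"
      using s by (simp add: field_simps power2_eq_square)
    then show ?thesis using s
      unfolding normal_density_def by (simp add: exp_add[symmetric])
  qed
  have Tm[measurable]: "T \<in> borel_measurable M" using distributed_measurable[OF d] by simp
  have iE: "integrable M (\<lambda>x. exp (a * T x))" for a
    using distributed_integrable[OF d, of "\<lambda>x. exp (a * x)"] s unfolding mgf by simp
  have E: "expectation (\<lambda>x. exp (a * T x)) = exp (a\<^sup>2 * \<sigma>\<^sup>2 / 2)" for a
    using distributed_integral[OF d, of "\<lambda>x. exp (a * x)", symmetric] s unfolding mgf by simp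
  have s2: "t\<^sup>2 * \<sigma>\<^sup>2 \<le> t\<^sup>2"
    using s by (intro mult_left_le power_le_one) auto
  have bnd: "expectation (\<lambda>x. exp (a * T x - t\<^sup>2)) \<le> exp (- t\<^sup>2 / 2)" if "a\<^sup>2 = t\<^sup>2" for a
  proof -
    have "expectation (\<lambda>x. exp (a * T x - t\<^sup>2)) = exp (a\<^sup>2 * \<sigma>\<^sup>2 / 2) / exp (t\<^sup>2)"
      unfolding exp_diff E[symmetric] by simp
    also have "\<dots> = exp (t\<^sup>2 * \<sigma>\<^sup>2 / 2 - t\<^sup>2)" by (simp add: exp_diff that)
    also have "\<dots> \<le> exp (- t\<^sup>2 / 2)" using s2 by simp
    finally show ?thesis .
  qed
  have i2: "integrable M (\<lambda>x. exp (a * T x - t\<^sup>2))" for a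
    unfolding exp_diff using iE by simp
  have "prob {x \<in> space M. \<bar>T x\<bar> > t} = expectation (indicator {x \<in> space M. \<bar>T x\<bar> > t})"
    by simp
  also have "\<dots> \<le> expectation (\<lambda>x. exp (t * T x - t\<^sup>2) + exp (- t * T x - t\<^sup>2))"
  proof (rule integral_mono)
    show "integrable M (\<lambda>x. exp (t * T x - t\<^sup>2) + exp (- t * T x - t\<^sup>2))"
      by (intro Bochner_Integration.integrable_add i2)
    fix x
    have "1 \<le> exp (t * T x - t\<^sup>2) + exp (- t * T x - t\<^sup>2)" if "\<bar>T x\<bar> > t"
    proof (cases "T x > t")
      case True
      then have "1 \<le> exp (t * T x - t\<^sup>2)" using t by (simp add: power2_eq_square mult_left_mono)
      then show ?thesis using exp_ge_zero[of "- t * T x - t\<^sup>2"] by linarith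
    next
      case False
      then have "- T x \<ge> t" using that by linarith
      then have "t * t \<le> t * (- T x)" using t by (intro mult_left_mono) auto
      then have "1 \<le> exp (- t * T x - t\<^sup>2)" by (simp add: power2_eq_square)
      then show ?thesis using exp_ge_zero[of "t * T x - t\<^sup>2"] by linarith
    qed
    then show "indicator {x \<in> space M. \<bar>T x\<bar> > t} x \<le> exp (t * T x - t\<^sup>2) + exp (- t * T x - t\<^sup>2)"
      by (auto simp: indicator_def add_nonneg_nonneg)
  next
    have "{x \<in> space M. \<bar>T x\<bar> > t} \<in> sets M" by measurable
    then show "integrable M (indicator {x \<in> space M. \<bar>T x\<bar> > t} :: 'a \<Rightarrow> real)"
      by (simp add: integrable_indicator_iff less_top[symmetric])
  qed
  also have "\<dots> \<le> exp (- t\<^sup>2 / 2) + exp (- t\<^sup>2 / 2)"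
    by (subst Bochner_Integration.integral_add[OF i2 i2]) (intro add_mono bnd; simp)
  finally show ?thesis by simp
qed

section \<open>Gaussian designs\<close>

definition qform :: "nat \<Rightarrow> (nat \<Rightarrow> nat \<Rightarrow> real) \<Rightarrow> (nat \<Rightarrow> real) \<Rightarrow> (nat \<Rightarrow> real) \<Rightarrow> real" where
  "qform p S a b = (\<Sum>j<p. \<Sum>l<p. a j * S j l * b l)"

definition rowcomb :: "nat \<Rightarrow> (nat \<Rightarrow> nat \<Rightarrow> real) \<Rightarrow> (nat \<Rightarrow> real) \<Rightarrow> nat \<Rightarrow> real" where
  "rowcomb p x w i = (\<Sum>j<p. x i j * w j)"

definition sqnorm :: "nat \<Rightarrow> (nat \<Rightarrow> real) \<Rightarrow> real" where
  "sqnorm n r = (\<Sum>i<n. (r i)\<^sup>2)"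

definition inner_upto :: "nat \<Rightarrow> (nat \<Rightarrow> real) \<Rightarrow> (nat \<Rightarrow> real) \<Rightarrow> real" where
  "inner_upto n r s = (\<Sum>i<n. r i * s i)"

text \<open>The default unit vector at \<open>r = 0\<close> makes the norm equal to 1 without
  exception when \<open>n > 0\<close>, so projections on a random direction are exactly normal and
  no null set has to be removed.\<close>

definition normalized :: "nat \<Rightarrow> (nat \<Rightarrow> real) \<Rightarrow> nat \<Rightarrow> real" where
  "normalized n r i = (if sqnorm n r = 0 then (if i = 0 then 1 else 0) else r i / sqrt (sqnorm n r))"

lemma sqnorm_nonneg [simp]: "0 \<le> sqnorm n r"
  unfolding sqnorm_def by (intro sum_nonneg) auto

lemma sqnorm_normalized: "n > 0 \<Longrightarrow> sqnorm n (normalized n r) = 1"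
proof (cases "sqnorm n r = 0")
  case True
  assume "n > 0"
  have "(\<Sum>i<n. (if i = 0 then 1 else 0 :: real)\<^sup>2) = (\<Sum>i<n. if i = 0 then 1 else 0)"
    by (intro sum.cong) auto
  then show ?thesis using True \<open>n > 0\<close> unfolding normalized_def sqnorm_def by simp
next
  case False
  then have "sqnorm n (normalized n r) = (\<Sum>i<n. (r i)\<^sup>2 / sqnorm n r)"
    unfolding normalized_def by (simp add: sqnorm_def[of n "\<lambda>i. r i / _"] power_divide)
  also have "\<dots> = 1" using False by (simp add: sum_divide_distrib[symmetric] sqnorm_def)
  finally show ?thesis .
qed

lemma inner_normalized:
  "sqnorm n r \<noteq> 0 \<Longrightarrow> inner_upto n (normalized n r) s = inner_upto n r s / sqrt (sqnorm n r)"
  unfolding normalized_def inner_upto_def by (simp add: sum_divide_distrib)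

lemma qform_add_left: "qform p S (\<lambda>j. a j + b j) c = qform p S a c + qform p S b c"
  unfolding qform_def by (simp add: algebra_simps sum.distrib)

lemma qform_add_right: "qform p S c (\<lambda>j. a j + b j) = qform p S c a + qform p S c b"
  unfolding qform_def by (simp add: algebra_simps sum.distrib)

lemma qform_scale_left: "qform p S (\<lambda>j. s * a j) c = s * qform p S a c"
  unfolding qform_def by (simp add: sum_distrib_left mult_ac)

lemma qform_scale_right: "qform p S c (\<lambda>j. s * a j) = s * qform p S c a"
  unfolding qform_def by (simp add: sum_distrib_left mult_ac)

lemma rowcomb_add: "rowcomb p x (\<lambda>j. a j + b j) i = rowcomb p x a i + rowcomb p x b i"
  unfolding rowcomb_def by (simp add: algebra_simps sum.distrib)

lemma rowcomb_scale: "rowcomb p x (\<lambda>j. s * a j) i = s * rowcomb p x a i"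
  unfolding rowcomb_def by (simp add: sum_distrib_left mult_ac)

text \<open>The setting at one sample size. The eigenvalue condition enters as plain positive
  definiteness; a quantitative lower bound is added only where compatibility and the residual
  variance call for it.\<close>

locale gaussian_design = prob_space M for M :: "'a measure" +
  fixes n p :: nat and S :: "nat \<Rightarrow> nat \<Rightarrow> real"
    and X :: "'a \<Rightarrow> nat \<Rightarrow> nat \<Rightarrow> real" and E :: "'a \<Rightarrow> nat \<Rightarrow> real"
  assumes n_pos: "n > 0" and p_ge2: "p \<ge> 2"
    and S_sym: "\<And>j l. S j l = S l j"
    and S_diag: "\<And>j. j < p \<Longrightarrow> S j j = 1"
    and S_pd: "\<And>w. \<exists>j<p. w j \<noteq> 0 \<Longrightarrow> 0 < qform p S w w"
    and gauss: "gaussian_data M n p S X E"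
begin

lemma qform_sym: "qform p S a b = qform p S b a"
proof -
  have "qform p S a b = (\<Sum>l<p. \<Sum>j<p. a j * S j l * b l)"
    unfolding qform_def by (rule sum.swap)
  also have "\<dots> = qform p S b a"
    unfolding qform_def by (intro sum.cong refl) (metis S_sym mult.assoc mult.commute)
  finally show ?thesis .
qed

lemma qform_nonneg: "0 \<le> qform p S w w"
proof (cases "\<exists>j<p. w j \<noteq> 0")
  case False then show ?thesis by (auto simp: qform_def)
qed (use S_pd in \<open>auto intro: less_imp_le\<close>)

lemma qform_zero: "qform p S w w = 0 \<Longrightarrow> j < p \<Longrightarrow> w j = 0"
  using S_pd[of w] by auto

abbreviation Z :: "(nat \<Rightarrow> real) \<Rightarrow> nat \<Rightarrow> 'a \<Rightarrow> real" where
  "Z w i \<omega> \<equiv> rowcomb p (X \<omega>) w i"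

lemma linear_normal:
  assumes v: "v = (\<Sum>i<n. qform p S (A i) (A i)) + (\<Sum>i<n. (b i)\<^sup>2)" "v > 0"
  shows "distributed M lborel (\<lambda>\<omega>. (\<Sum>i<n. \<Sum>j<p. A i j * X \<omega> i j) + (\<Sum>i<n. b i * E \<omega> i))
    (normal_density 0 (sqrt v))"
  using gauss v unfolding gaussian_data_def qform_def Let_def by blast

text \<open>The Gaussian hypothesis speaks of combinations with positive variance only. If the
  variance is 0, positive definiteness forces all coefficients to vanish, so the formula extends to
  every frequency.\<close>

lemma linear_iexp:
  "(CLINT \<omega>|M. iexp ((\<Sum>i<n. \<Sum>j<p. A i j * X \<omega> i j) + (\<Sum>i<n. b i * E \<omega> i))) =
    of_real (exp (- ((\<Sum>i<n. qform p S (A i) (A i)) + (\<Sum>i<n. (b i)\<^sup>2)) / 2))"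
proof -
  define v where "v = (\<Sum>i<n. qform p S (A i) (A i)) + (\<Sum>i<n. (b i)\<^sup>2)"
  have nn: "0 \<le> (\<Sum>i<n. qform p S (A i) (A i))" "0 \<le> (\<Sum>i<n. (b i)\<^sup>2)"
    by (auto intro!: sum_nonneg qform_nonneg)
  show ?thesis
  proof (cases "v > 0")
    case True
    then show ?thesis
      using iexp_normal[OF linear_normal[OF v_def True]] by (simp add: v_def)
  next
    case False
    then have z: "(\<Sum>i<n. qform p S (A i) (A i)) = 0" "(\<Sum>i<n. (b i)\<^sup>2) = 0"
      using nn unfolding v_def by linarith+
    have A: "A i j = 0" if "i < n" "j < p" for i j
      using z(1) that by (subst (asm) sum_nonneg_eq_0_iff) (auto intro!: qform_nonneg qform_zero[of "A i" j])
    have b: "b i = 0" if "i < n" for i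
      using z(2) that by (subst (asm) sum_nonneg_eq_0_iff) auto
    show ?thesis by (simp add: A b z prob_space qform_def)
  qed
qed

text \<open>Measurability is contained in \<open>distributed\<close>: a single entry is a linear
  combination of positive variance.\<close>

lemma X_measurable [measurable]:
  assumes "i < n" "j < p" shows "(\<lambda>\<omega>. X \<omega> i j) \<in> borel_measurable M"
proof -
  define A where "A k l = (if k = i \<and> l = j then 1 else 0 :: real)" for k l
  have e: "(\<Sum>k<n. \<Sum>l<p. A k l * f k l) = f i j" for f :: "nat \<Rightarrow> nat \<Rightarrow> real"
  proof -
    have "(\<Sum>k<n. \<Sum>l<p. A k l * f k l) = (\<Sum>k<n. if k = i then f i j else 0)"
    proof (intro sum.cong refl)
      fix k
      have "(\<Sum>l<p. A k l * f k l) = (\<Sum>l<p. if l = j then (if k = i then f i j else 0) else 0)"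
        by (intro sum.cong) (auto simp: A_def)
      then show "(\<Sum>l<p. A k l * f k l) = (if k = i then f i j else 0)" using assms by simp
    qed
    then show ?thesis using assms by simp
  qed
  have "(\<Sum>k<n. qform p S (A k) (A k)) \<ge> qform p S (A i) (A i)"
    using assms by (intro member_le_sum) (auto intro: qform_nonneg)
  moreover have "qform p S (A i) (A i) > 0" using assms by (intro S_pd) (auto simp: A_def)
  ultimately have "(\<Sum>k<n. qform p S (A k) (A k)) + (\<Sum>k<n. (0::real)\<^sup>2) > 0" by simp
  from distributed_measurable[OF linear_normal[OF refl this]] show ?thesis by (simp add: e)
qed

lemma E_measurable [measurable]:
  assumes "i < n" shows "(\<lambda>\<omega>. E \<omega> i) \<in> borel_measurable M"
proof -
  define b where "b k = (if k = i then 1 else 0 :: real)" for k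
  have e: "(\<Sum>k<n. b k * f k) = f i" for f :: "nat \<Rightarrow> real"
  proof -
    have "(\<Sum>k<n. b k * f k) = (\<Sum>k<n. if k = i then f i else 0)"
      by (intro sum.cong) (auto simp: b_def)
    then show ?thesis using assms by simp
  qed
  have "(b i)\<^sup>2 \<le> (\<Sum>k<n. (b k)\<^sup>2)" using assms by (intro member_le_sum) auto
  then have "(\<Sum>k<n. qform p S (\<lambda>_. 0) (\<lambda>_. 0)) + (\<Sum>k<n. (b k)\<^sup>2) > 0"
    by (simp add: qform_def b_def)
  from distributed_measurable[OF linear_normal[OF refl this]] show ?thesis by (simp add: e)
qed

lemma Z_measurable [measurable]: "i < n \<Longrightarrow> Z w i \<in> borel_measurable M"
  unfolding rowcomb_def by (intro borel_measurable_sum borel_measurable_times X_measurable) auto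

lemma Z_normal:
  assumes "v = qform p S w w * sqnorm n u" "v > 0"
  shows "distributed M lborel (\<lambda>\<omega>. \<Sum>i<n. u i * Z w i \<omega>) (normal_density 0 (sqrt v))"
proof -
  have "v = (\<Sum>i<n. qform p S (\<lambda>j. u i * w j) (\<lambda>j. u i * w j)) + (\<Sum>i<n. 0\<^sup>2)"
    unfolding assms(1) qform_scale_left qform_scale_right sqnorm_def sum_distrib_left
    by (simp add: power2_eq_square mult_ac)
  from linear_normal[OF this assms(2)] show ?thesis
    by (simp add: rowcomb_def sum_distrib_left mult_ac)
qed

lemma E_normal:
  assumes "sqnorm n u = 1"
  shows "distributed M lborel (\<lambda>\<omega>. \<Sum>i<n. u i * E \<omega> i) (normal_density 0 1)"
  using linear_normal[of 1 "\<lambda>_ _. 0" u] assms by (simp add: sqnorm_def qform_def)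

text \<open>Mixed moments come from polarisation: \<open>Z w i\<close> plus or minus
  \<open>Z w k\<close> is normal with variance \<open>2 * v\<close> for \<open>i \<noteq> k\<close>,
  so fourth moments of linear combinations suffice and independence of the rows is never
  invoked.\<close>

lemma Z_pair_moments:
  assumes "i < n" "k < n"
  shows "integrable M (\<lambda>\<omega>. (Z w i \<omega>)\<^sup>2)" "expectation (\<lambda>\<omega>. (Z w i \<omega>)\<^sup>2) = qform p S w w"
    "integrable M (\<lambda>\<omega>. (Z w i \<omega>)\<^sup>2 * (Z w k \<omega>)\<^sup>2)"
    "expectation (\<lambda>\<omega>. (Z w i \<omega>)\<^sup>2 * (Z w k \<omega>)\<^sup>2) = (if i = k then 3 else 1) * (qform p S w w)\<^sup>2"
proof -
  define v where "v = qform p S w w"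
  have "integrable M (\<lambda>\<omega>. (Z w i \<omega>)\<^sup>2) \<and> expectation (\<lambda>\<omega>. (Z w i \<omega>)\<^sup>2) = v \<and>
    integrable M (\<lambda>\<omega>. (Z w i \<omega>)\<^sup>2 * (Z w k \<omega>)\<^sup>2) \<and>
    expectation (\<lambda>\<omega>. (Z w i \<omega>)\<^sup>2 * (Z w k \<omega>)\<^sup>2) = (if i = k then 3 else 1) * v\<^sup>2"
  proof (cases "v = 0")
    case True
    then have "w j = 0" if "j < p" for j using qform_zero that unfolding v_def by blast
    then have "Z w i \<omega> = 0" for i \<omega> by (simp add: rowcomb_def)
    then show ?thesis using True by simp
  next
    case False
    then have v: "v > 0" using qform_nonneg[of w] unfolding v_def by simp
    have one: "distributed M lborel (Z w i) (normal_density 0 (sqrt v))" if "i < n" for i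
    proof -
      have e: "(\<Sum>l<n. (if l = i then 1 else 0) * f l) = f i" for f :: "nat \<Rightarrow> real"
      proof -
        have "(\<Sum>l<n. (if l = i then 1 else 0) * f l) = (\<Sum>l<n. if l = i then f l else 0)"
          by (intro sum.cong) auto
        then show ?thesis using that by simp
      qed
      have "sqnorm n (\<lambda>l. if l = i then 1 else 0) = 1"
        unfolding sqnorm_def power2_eq_square using e[of "\<lambda>l. if l = i then 1 else 0"] by simp
      from Z_normal[of v w "\<lambda>l. if l = i then 1 else 0"] this v show ?thesis
        by (simp add: e v_def)
    qed
    have two: "distributed M lborel (\<lambda>\<omega>. Z w i \<omega> + s * Z w k \<omega>) (normal_density 0 (sqrt (2 * v)))"
      if "i \<noteq> k" "s\<^sup>2 = 1" for s
    proof -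
      let ?u = "\<lambda>l. (if l = i then 1 else if l = k then s else 0)"
      have e: "(\<Sum>l<n. ?u l * f l) = f i + s * f k" for f :: "nat \<Rightarrow> real"
      proof -
        have "(\<Sum>l<n. ?u l * f l) = (\<Sum>l<n. (if l = i then f l else 0) + (if l = k then s * f l else 0))"
          using that by (intro sum.cong) auto
        then show ?thesis using assms by (simp add: sum.distrib)
      qed
      have "sqnorm n ?u = 2"
        unfolding sqnorm_def power2_eq_square using e[of ?u] that by (simp add: power2_eq_square)
      from Z_normal[of "2 * v" w ?u] this v show ?thesis
        by (simp add: e v_def)
    qed
    have s4: "sqrt v ^ 4 = v\<^sup>2" "sqrt (2 * v) ^ 4 = 4 * v\<^sup>2"
      using v power_mult[of "sqrt v" 2 2] power_mult[of "sqrt (2 * v)" 2 2] by (simp_all add: power_mult_distrib)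
    note m1 = normal_moments_2_4[OF one[OF assms(1)]] and m2 = normal_moments_2_4[OF one[OF assms(2)]]
    have i2: "integrable M (\<lambda>\<omega>. (Z w i \<omega>)\<^sup>2) \<and> expectation (\<lambda>\<omega>. (Z w i \<omega>)\<^sup>2) = v"
      using m1(1)[of 2] m1(2) v by simp
    show ?thesis
    proof (cases "i = k")
      case True
      have "(Z w i \<omega>)\<^sup>2 * (Z w k \<omega>)\<^sup>2 = Z w i \<omega> ^ 4" for \<omega>
        using True by (simp add: power4_eq_xxxx power2_eq_square)
      then show ?thesis using i2 m1(1)[of 4] m1(3) v True s4 by simp
    next
      case False
      note p1 = normal_moments_2_4[OF two[OF False, of 1]] and p2 = normal_moments_2_4[OF two[OF False, of "-1"]]
      \<comment> \<open>The sum of the fourth powers of \<open>x + y\<close> and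
        \<open>x - y\<close> is \<open>2 x^4 + 12 x^2 y^2 + 2 y^4\<close>.\<close>
      have e: "(Z w i \<omega>)\<^sup>2 * (Z w k \<omega>)\<^sup>2 = ((Z w i \<omega> + 1 * Z w k \<omega>) ^ 4 + (Z w i \<omega> + (-1) * Z w k \<omega>) ^ 4
          - 2 * Z w i \<omega> ^ 4 - 2 * Z w k \<omega> ^ 4) / 12" for \<omega>
        by (simp add: power4_eq_xxxx power2_eq_square algebra_simps)
      note I = p1(1)[of 4] p2(1)[of 4] m1(1)[of 4] m2(1)[of 4]
      have "integrable M (\<lambda>\<omega>. (Z w i \<omega>)\<^sup>2 * (Z w k \<omega>)\<^sup>2)"
        unfolding e using v I by (intro integrable_divide Bochner_Integration.integrable_diff Bochner_Integration.integrable_add integrable_mult_right) auto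
      moreover have "expectation (\<lambda>\<omega>. (Z w i \<omega>)\<^sup>2 * (Z w k \<omega>)\<^sup>2) = (12 * v\<^sup>2 + 12 * v\<^sup>2 - 2 * (3 * v\<^sup>2) - 2 * (3 * v\<^sup>2)) / 12"
        unfolding e using v I p1(3) p2(3) m1(3) m2(3) s4 by simp
      ultimately show ?thesis using i2 False by simp
    qed
  qed
  then show "integrable M (\<lambda>\<omega>. (Z w i \<omega>)\<^sup>2)" "expectation (\<lambda>\<omega>. (Z w i \<omega>)\<^sup>2) = qform p S w w"
    "integrable M (\<lambda>\<omega>. (Z w i \<omega>)\<^sup>2 * (Z w k \<omega>)\<^sup>2)"
    "expectation (\<lambda>\<omega>. (Z w i \<omega>)\<^sup>2 * (Z w k \<omega>)\<^sup>2) = (if i = k then 3 else 1) * (qform p S w w)\<^sup>2"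
    unfolding v_def by auto
qed

text \<open>Chebyshev: in the second moment of the mean square, all \<open>n^2\<close> pairs
  contribute \<open>v\<^sup>2\<close> and the \<open>n\<close> diagonal ones an excess of
  \<open>2 * v\<^sup>2\<close>, so the variance is \<open>2 * v\<^sup>2 / n\<close>.\<close>

lemma sqnorm_concentration:
  assumes "\<eta> > 0"
  shows "prob {\<omega> \<in> space M. \<eta> \<le> \<bar>sqnorm n (rowcomb p (X \<omega>) w) / real n - qform p S w w\<bar>}
    \<le> 2 * (qform p S w w)\<^sup>2 / (real n * \<eta>\<^sup>2)"
proof -
  define v where "v = qform p S w w"
  define f where "f \<omega> = sqnorm n (rowcomb p (X \<omega>) w) / real n" for \<omega>
  have fm[measurable]: "f \<in> borel_measurable M"
    unfolding f_def sqnorm_def by (intro borel_measurable_divide borel_measurable_sum borel_measurable_power Z_measurable) auto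
  have f2: "(f \<omega>)\<^sup>2 = (\<Sum>i<n. \<Sum>k<n. (Z w i \<omega>)\<^sup>2 * (Z w k \<omega>)\<^sup>2) / (real n)\<^sup>2" for \<omega>
    unfolding f_def sqnorm_def by (simp add: power_divide power2_eq_square[of "sum _ _"] sum_product)
  have Ef: "expectation f = v"
    using n_pos by (simp add: f_def[abs_def] sqnorm_def Z_pair_moments v_def)
  have If: "integrable M f"
    unfolding f_def[abs_def] sqnorm_def by (auto intro!: Bochner_Integration.integrable_sum Z_pair_moments)
  have If2: "integrable M (\<lambda>\<omega>. (f \<omega>)\<^sup>2)"
    unfolding f2 by (auto intro!: Bochner_Integration.integrable_sum Z_pair_moments)
  have "expectation (\<lambda>\<omega>. (f \<omega>)\<^sup>2) = (\<Sum>i<n. \<Sum>k<n. (if i = k then 3 else 1) * v\<^sup>2) / (real n)\<^sup>2"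
  proof -
    have "expectation (\<lambda>\<omega>. \<Sum>i<n. \<Sum>k<n. (Z w i \<omega>)\<^sup>2 * (Z w k \<omega>)\<^sup>2) =
        (\<Sum>i<n. expectation (\<lambda>\<omega>. \<Sum>k<n. (Z w i \<omega>)\<^sup>2 * (Z w k \<omega>)\<^sup>2))"
      by (intro Bochner_Integration.integral_sum Bochner_Integration.integrable_sum Z_pair_moments) auto
    also have "\<dots> = (\<Sum>i<n. \<Sum>k<n. expectation (\<lambda>\<omega>. (Z w i \<omega>)\<^sup>2 * (Z w k \<omega>)\<^sup>2))"
      by (intro sum.cong refl Bochner_Integration.integral_sum Z_pair_moments) auto
    also have "\<dots> = (\<Sum>i<n. \<Sum>k<n. (if i = k then 3 else 1) * v\<^sup>2)"
      by (intro sum.cong refl) (simp add: Z_pair_moments v_def)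
    finally show ?thesis unfolding f2 by simp
  qed
  also have "(\<Sum>i<n. \<Sum>k<n. (if i = k then 3 else 1) * v\<^sup>2) = (\<Sum>i<n. \<Sum>k<n. v\<^sup>2 + (if i = k then 2 * v\<^sup>2 else 0))"
    by (intro sum.cong) auto
  also have "\<dots> = (real n)\<^sup>2 * v\<^sup>2 + real n * (2 * v\<^sup>2)"
    by (simp add: sum.distrib power2_eq_square algebra_simps)
  finally have Ef2: "expectation (\<lambda>\<omega>. (f \<omega>)\<^sup>2) = v\<^sup>2 + 2 * v\<^sup>2 / real n"
    using n_pos by (simp add: add_divide_distrib power2_eq_square)
  have "variance f = 2 * v\<^sup>2 / real n"
    by (subst variance_eq[OF If If2]) (simp add: Ef Ef2)
  with Chebyshev_inequality[OF fm If2 assms] show ?thesis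
    unfolding Ef by (simp add: f_def v_def)
qed

text \<open>Orthogonality means that the two Gaussian columns are uncorrelated, so their joint
  characteristic function factorises. The direction of the first is then a random unit vector
  independent of the second, and projecting a centred normal vector with covariance \<open>v\<close>
  times the identity on any unit vector gives variance \<open>v\<close>. In the index set,
  \<open>True\<close> marks the coordinates of \<open>w\<close> and \<open>False\<close> those of
  \<open>w'\<close>.\<close>

lemma distr_self_normalized:
  assumes orth: "qform p S w w' = 0" and v: "v = qform p S w' w'" "v > 0"
  shows "distributed M lborel (\<lambda>\<omega>. inner_upto n (normalized n (rowcomb p (X \<omega>) w)) (rowcomb p (X \<omega>) w'))
    (normal_density 0 (sqrt v))"
proof -
  define V where "V = (\<lambda>(i, c :: bool) \<omega>. if c then Z w i \<omega> else Z w' i \<omega>)"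
  define IA where "IA = {..<n} \<times> {True}"
  define IB where "IB = {..<n} \<times> {False}"
  define h where "h = (\<lambda>(i, c :: bool) (a :: nat \<times> bool \<Rightarrow> real). normalized n (\<lambda>k. a (k, True)) i)"
  have A: "(\<Sum>k\<in>IA. g k) = (\<Sum>i<n. g (i, True))" for g :: "_ \<Rightarrow> real"
    unfolding IA_def by (intro sum.reindex_cong[of "\<lambda>i. (i, True)"]) (auto simp: inj_on_def)
  have B: "(\<Sum>k\<in>IB. g k) = (\<Sum>i<n. g (i, False))" for g :: "_ \<Rightarrow> real"
    unfolding IB_def by (intro sum.reindex_cong[of "\<lambda>i. (i, False)"]) (auto simp: inj_on_def)
  have AB: "(\<Sum>k\<in>IA \<union> IB. g k) = (\<Sum>k\<in>IA. g k) + (\<Sum>k\<in>IB. g k)" for g :: "_ \<Rightarrow> real"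
    by (rule sum.union_disjoint) (auto simp: IA_def IB_def)
  have comb: "(CLINT \<omega>|M. iexp ((\<Sum>i<n. s i * Z w i \<omega>) + (\<Sum>i<n. t i * Z w' i \<omega>))) =
      of_real (exp (- (qform p S w w * sqnorm n s + v * sqnorm n t) / 2))" for s t :: "nat \<Rightarrow> real"
  proof -
    have "qform p S (\<lambda>j. s i * w j + t i * w' j) (\<lambda>j. s i * w j + t i * w' j) = (s i)\<^sup>2 * qform p S w w + (t i)\<^sup>2 * v" for i
      unfolding qform_add_left qform_add_right qform_scale_left qform_scale_right
      using orth qform_sym[of w' w] v by (simp add: power2_eq_square)
    then have 1: "(\<Sum>i<n. qform p S (\<lambda>j. s i * w j + t i * w' j) (\<lambda>j. s i * w j + t i * w' j)) = qform p S w w * sqnorm n s + v * sqnorm n t"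
      by (simp add: sqnorm_def sum.distrib sum_distrib_left mult_ac)
    have "(\<Sum>i<n. \<Sum>j<p. (s i * w j + t i * w' j) * X \<omega> i j) = (\<Sum>i<n. s i * Z w i \<omega>) + (\<Sum>i<n. t i * Z w' i \<omega>)" for \<omega>
      by (simp add: rowcomb_def algebra_simps sum.distrib sum_distrib_left)
    then show ?thesis
      using linear_iexp[of "\<lambda>i j. s i * w j + t i * w' j" "\<lambda>_. 0"] 1 by simp
  qed
  have "distr M borel (\<lambda>\<omega>. \<Sum>l\<in>IB. h l (\<lambda>k\<in>IA. V k \<omega>) * V l \<omega>) = density lborel (normal_density 0 (sqrt v))"
  proof (rule distr_randomized_sum)
    show "prob_space M" by (rule prob_space_axioms)
    show "finite IA" "finite IB" "IA \<inter> IB = {}" unfolding IA_def IB_def by auto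
    show "V k \<in> borel_measurable M" if "k \<in> IA \<union> IB" for k
      using that unfolding V_def IA_def IB_def by auto
    show "(CLINT x|M. iexp (\<Sum>k\<in>IA \<union> IB. t k * V k x)) =
        (CLINT x|M. iexp (\<Sum>k\<in>IA. t k * V k x)) * (CLINT x|M. iexp (\<Sum>k\<in>IB. t k * V k x))" for t
      unfolding AB unfolding A B
      using comb[of "\<lambda>i. t (i, True)" "\<lambda>i. t (i, False)"] comb[of "\<lambda>i. t (i, True)" "\<lambda>i. 0"]
        comb[of "\<lambda>i. 0" "\<lambda>i. t (i, False)"]
      by (simp add: V_def sqnorm_def[of n "\<lambda>_. 0"] exp_add[symmetric] add_divide_distrib del: of_real_add flip: of_real_mult)
    fix l assume "l \<in> IB"
    have [measurable]: "(\<lambda>a. a (i, True)) \<in> borel_measurable (PiM IA (\<lambda>_. borel))" if "i < n" for i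
      using that by (intro measurable_component_singleton) (auto simp: IA_def)
    have [measurable]: "(\<lambda>a. sqnorm n (\<lambda>k. a (k, True))) \<in> borel_measurable (PiM IA (\<lambda>_. borel))"
      unfolding sqnorm_def by simp
    show "h l \<in> borel_measurable (PiM IA (\<lambda>_. borel))"
      using \<open>l \<in> IB\<close> unfolding h_def IB_def normalized_def by auto
  next
    fix a :: "nat \<times> bool \<Rightarrow> real"
    have "distributed M lborel (\<lambda>\<omega>. \<Sum>l<n. normalized n (\<lambda>k. a (k, True)) l * Z w' l \<omega>) (normal_density 0 (sqrt v))"
      using v n_pos by (intro Z_normal) (auto simp: sqnorm_normalized)
    from distributed_distr_eq_density[OF this]
    show "distr M borel (\<lambda>x. \<Sum>l\<in>IB. h l a * V l x) = density lborel (normal_density 0 (sqrt v))"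
      by (simp add: B h_def V_def cong: distr_cong)
  qed
  moreover have "(\<Sum>l\<in>IB. h l (\<lambda>k\<in>IA. V k \<omega>) * V l \<omega>) =
      inner_upto n (normalized n (rowcomb p (X \<omega>) w)) (rowcomb p (X \<omega>) w')" for \<omega>
  proof -
    have "normalized n (\<lambda>k. (\<lambda>k\<in>IA. V k \<omega>) (k, True)) i = normalized n (rowcomb p (X \<omega>) w) i" if "i < n" for i
      using that unfolding normalized_def sqnorm_def by (auto simp: IA_def V_def)
    then show ?thesis by (simp add: B h_def V_def inner_upto_def)
  qed
  moreover have "(\<lambda>\<omega>. inner_upto n (normalized n (rowcomb p (X \<omega>) w)) (rowcomb p (X \<omega>) w')) \<in> borel_measurable M"
    unfolding inner_upto_def normalized_def sqnorm_def by simp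
  ultimately show ?thesis unfolding distributed_def by (auto cong: distr_cong)
qed

text \<open>The noise projected on a direction that is a Borel function of the design. The design is
  truncated to its \<open>n\<close> by \<open>p\<close> block because the hypotheses control these
  entries only; the untruncated matrix need not be measurable.\<close>

lemma distr_noise_projection:
  fixes r :: "(nat \<Rightarrow> nat \<Rightarrow> real) \<Rightarrow> nat \<Rightarrow> real"
  assumes r: "\<And>i. i < n \<Longrightarrow> (\<lambda>x. r x i) \<in> borel_measurable borel"
  shows "distributed M lborel
    (\<lambda>\<omega>. inner_upto n (normalized n (r (\<lambda>i j. if i < n \<and> j < p then X \<omega> i j else 0))) (E \<omega>)) std_normal_density"
proof -
  \<comment> \<open>Column index \<open>p\<close>, one past the last column of the design, carries
    the noise.\<close>
  define V where "V = (\<lambda>(i, j) \<omega>. if j < p then X \<omega> i j else E \<omega> i)"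
  define IA where "IA = {..<n} \<times> {..<p}"
  define IB where "IB = {..<n} \<times> {p}"
  define trunc where "trunc = (\<lambda>(a :: nat \<times> nat \<Rightarrow> real) i j. if i < n \<and> j < p then a (i, j) else 0)"
  define h where "h = (\<lambda>(i, j :: nat) a. normalized n (r (trunc a)) i)"
  have A: "(\<Sum>k\<in>IA. g k) = (\<Sum>i<n. \<Sum>j<p. g (i, j))" for g :: "_ \<Rightarrow> real"
    unfolding IA_def by (simp add: sum.cartesian_product)
  have B: "(\<Sum>k\<in>IB. g k) = (\<Sum>i<n. g (i, p))" for g :: "_ \<Rightarrow> real"
    unfolding IB_def by (intro sum.reindex_cong[of "\<lambda>i. (i, p)"]) (auto simp: inj_on_def)
  have AB: "(\<Sum>k\<in>IA \<union> IB. g k) = (\<Sum>k\<in>IA. g k) + (\<Sum>k\<in>IB. g k)" for g :: "_ \<Rightarrow> real"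
    by (rule sum.union_disjoint) (auto simp: IA_def IB_def)
  have tm: "trunc \<in> measurable (PiM IA (\<lambda>_. borel)) borel"
    unfolding trunc_def
  proof (intro measurable_coordinatewise_then_product)
    fix i j
    show "(\<lambda>a. if i < n \<and> j < p then a (i, j) else 0) \<in> borel_measurable (PiM IA (\<lambda>_. borel :: real measure))"
      by (cases "i < n \<and> j < p") (auto intro!: measurable_component_singleton simp: IA_def)
  qed
  have rm[measurable]: "(\<lambda>a. r (trunc a) i) \<in> borel_measurable (PiM IA (\<lambda>_. borel))" if "i < n" for i
    by (rule measurable_compose[OF tm r[OF that]])
  have "distr M borel (\<lambda>\<omega>. \<Sum>l\<in>IB. h l (\<lambda>k\<in>IA. V k \<omega>) * V l \<omega>) = std_normal_distribution"
  proof (rule distr_randomized_sum)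
    show "prob_space M" by (rule prob_space_axioms)
    show "finite IA" "finite IB" "IA \<inter> IB = {}" unfolding IA_def IB_def by auto
    show "V k \<in> borel_measurable M" if "k \<in> IA \<union> IB" for k
      using that unfolding V_def IA_def IB_def by auto
    show "(CLINT x|M. iexp (\<Sum>k\<in>IA \<union> IB. t k * V k x)) =
        (CLINT x|M. iexp (\<Sum>k\<in>IA. t k * V k x)) * (CLINT x|M. iexp (\<Sum>k\<in>IB. t k * V k x))" for t
      unfolding AB unfolding A B
      using linear_iexp[of "\<lambda>i j. t (i, j)" "\<lambda>i. t (i, p)"] linear_iexp[of "\<lambda>i j. t (i, j)" "\<lambda>_. 0"]
        linear_iexp[of "\<lambda>_ _. 0" "\<lambda>i. t (i, p)"]
      by (simp add: V_def qform_def[of _ _ "\<lambda>_. 0"] exp_add[symmetric] add_divide_distrib del: of_real_add flip: of_real_mult)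
    fix l assume "l \<in> IB"
    have [measurable]: "(\<lambda>a. sqnorm n (r (trunc a))) \<in> borel_measurable (PiM IA (\<lambda>_. borel))"
      unfolding sqnorm_def by simp
    show "h l \<in> borel_measurable (PiM IA (\<lambda>_. borel))"
      using \<open>l \<in> IB\<close> unfolding h_def IB_def normalized_def by auto
  next
    fix a :: "nat \<times> nat \<Rightarrow> real"
    have "distributed M lborel (\<lambda>\<omega>. \<Sum>l<n. normalized n (r (trunc a)) l * E \<omega> l) (normal_density 0 1)"
      using n_pos by (intro E_normal) (auto simp: sqnorm_normalized)
    from distributed_distr_eq_density[OF this]
    show "distr M borel (\<lambda>x. \<Sum>l\<in>IB. h l a * V l x) = std_normal_distribution"
      by (simp add: B h_def V_def cong: distr_cong)
  qed
  moreover have tr: "trunc (\<lambda>k\<in>IA. V k \<omega>) = (\<lambda>i j. if i < n \<and> j < p then X \<omega> i j else 0)" for \<omega>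
    by (auto simp: trunc_def fun_eq_iff IA_def V_def)
  moreover have "(\<Sum>l\<in>IB. h l (\<lambda>k\<in>IA. V k \<omega>) * V l \<omega>) =
      inner_upto n (normalized n (r (\<lambda>i j. if i < n \<and> j < p then X \<omega> i j else 0))) (E \<omega>)" for \<omega>
    by (simp add: B h_def tr inner_upto_def) (simp add: V_def)
  moreover have "(\<lambda>\<omega>. inner_upto n (normalized n (r (\<lambda>i j. if i < n \<and> j < p then X \<omega> i j else 0))) (E \<omega>)) \<in> borel_measurable M"
  proof -
    have "(\<lambda>\<omega>. (\<lambda>i j. if i < n \<and> j < p then X \<omega> i j else 0)) \<in> measurable M borel"
    proof (intro measurable_coordinatewise_then_product)
      fix i j show "(\<lambda>\<omega>. if i < n \<and> j < p then X \<omega> i j else 0) \<in> borel_measurable M"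
        by (cases "i < n \<and> j < p") auto
    qed
    from measurable_compose[OF this r]
    have [measurable]: "(\<lambda>\<omega>. r (\<lambda>i j. if i < n \<and> j < p then X \<omega> i j else 0) i) \<in> borel_measurable M" if "i < n" for i
      using that by simp
    show ?thesis unfolding inner_upto_def normalized_def sqnorm_def by simp
  qed
  ultimately show ?thesis unfolding distributed_def by (auto cong: distr_cong)
qed

end

section \<open>The Lasso\<close>

definition l1norm :: "nat \<Rightarrow> (nat \<Rightarrow> real) \<Rightarrow> real" where
  "l1norm p c = (\<Sum>k\<in>{1..<p}. \<bar>c k\<bar>)"

definition fit :: "nat \<Rightarrow> (nat \<Rightarrow> nat \<Rightarrow> real) \<Rightarrow> (nat \<Rightarrow> real) \<Rightarrow> nat \<Rightarrow> real" where
  "fit p x c i = (\<Sum>k\<in>{1..<p}. x i k * c k)"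

definition resid :: "nat \<Rightarrow> (nat \<Rightarrow> nat \<Rightarrow> real) \<Rightarrow> (nat \<Rightarrow> real) \<Rightarrow> nat \<Rightarrow> real" where
  "resid p x c i = x i 0 - fit p x c i"

definition is_lasso :: "nat \<Rightarrow> nat \<Rightarrow> real \<Rightarrow> (nat \<Rightarrow> nat \<Rightarrow> real) \<Rightarrow> (nat \<Rightarrow> real) \<Rightarrow> bool" where
  "is_lasso n p lam x g \<longleftrightarrow> (\<forall>c. lasso_obj n p lam x g \<le> lasso_obj n p lam x c)"

lemma lasso_obj_eq: "lasso_obj n p lam x c = sqnorm n (resid p x c) / real n + 2 * lam * l1norm p c"
  unfolding lasso_obj_def sqnorm_def resid_def fit_def l1norm_def ..

lemma l1norm_nonneg [simp]: "0 \<le> l1norm p c"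
  unfolding l1norm_def by (intro sum_nonneg) auto

lemma l1norm_triangle: "l1norm p (\<lambda>k. a k + b k) \<le> l1norm p a + l1norm p b"
  unfolding l1norm_def sum.distrib[symmetric] by (intro sum_mono abs_triangle_ineq)

lemma l1norm_scale: "l1norm p (\<lambda>k. s * a k) = \<bar>s\<bar> * l1norm p a"
  unfolding l1norm_def by (simp add: abs_mult sum_distrib_left)

lemma l1norm_diff: "l1norm p (\<lambda>k. a k - b k) \<le> l1norm p a + l1norm p b"
  unfolding l1norm_def sum.distrib[symmetric] by (intro sum_mono abs_triangle_ineq4)

lemma l1norm_triangle_sub: "l1norm p b \<le> l1norm p a + l1norm p (\<lambda>k. a k - b k)"
  unfolding l1norm_def sum.distrib[symmetric] by (intro sum_mono) auto

lemma fit_add: "fit p x (\<lambda>k. a k + b k) i = fit p x a i + fit p x b i"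
  unfolding fit_def by (simp add: algebra_simps sum.distrib)

lemma fit_diff: "fit p x (\<lambda>k. a k - b k) i = fit p x a i - fit p x b i"
  unfolding fit_def by (simp add: algebra_simps sum_subtractf)

lemma fit_scale: "fit p x (\<lambda>k. s * a k) i = s * fit p x a i"
  unfolding fit_def by (simp add: sum_distrib_left mult_ac)

lemma resid_shift: "resid p x (\<lambda>k. g k + v k) i = resid p x g i - fit p x v i"
  unfolding resid_def fit_add by simp

lemma sqnorm_diff: "sqnorm n (\<lambda>i. r i - f i) = sqnorm n r - 2 * inner_upto n r f + sqnorm n f"
  unfolding sqnorm_def inner_upto_def
  by (simp add: power2_diff sum.distrib sum_subtractf sum_distrib_left algebra_simps)

lemma sqnorm_scale: "sqnorm n (\<lambda>i. s * f i) = s\<^sup>2 * sqnorm n f"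
  unfolding sqnorm_def by (simp add: power_mult_distrib sum_distrib_left)

lemma inner_scale_right: "inner_upto n r (\<lambda>i. s * f i) = s * inner_upto n r f"
  unfolding inner_upto_def by (simp add: sum_distrib_left mult_ac)

lemma inner_diff_right: "inner_upto n r (\<lambda>i. f i - g i) = inner_upto n r f - inner_upto n r g"
  unfolding inner_upto_def by (simp add: algebra_simps sum_subtractf)

lemma inner_fit: "inner_upto n r (fit p x c) = (\<Sum>k\<in>{1..<p}. c k * inner_upto n r (\<lambda>i. x i k))"
  unfolding inner_upto_def fit_def sum_distrib_left by (subst sum.swap) (simp add: mult_ac)

lemma abs_inner_fit_le:
  assumes "\<And>k. k \<in> {1..<p} \<Longrightarrow> \<bar>inner_upto n r (\<lambda>i. x i k)\<bar> \<le> b"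
  shows "\<bar>inner_upto n r (fit p x c)\<bar> \<le> b * l1norm p c"
proof -
  have "\<bar>inner_upto n r (fit p x c)\<bar> \<le> (\<Sum>k\<in>{1..<p}. \<bar>c k\<bar> * b)"
    unfolding inner_fit using assms
    by (intro order_trans[OF sum_abs] sum_mono) (auto simp: abs_mult intro!: mult_left_mono)
  then show ?thesis by (simp add: l1norm_def sum_distrib_left mult.commute)
qed

section \<open>Optimality conditions and dependence of the residual on the design\<close>

lemma lasso_obj_shift:
  "lasso_obj n p lam x (\<lambda>k. g k + v k) = sqnorm n (resid p x g) / n - 2 * inner_upto n (resid p x g) (fit p x v) / n
    + sqnorm n (fit p x v) / n + 2 * lam * l1norm p (\<lambda>k. g k + v k)"
proof -
  have "resid p x (\<lambda>k. g k + v k) = (\<lambda>i. resid p x g i - fit p x v i)"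
    by (simp add: fun_eq_iff resid_shift)
  then show ?thesis unfolding lasso_obj_eq by (simp add: sqnorm_diff add_divide_distrib diff_divide_distrib)
qed

lemma tendsto_mult_null_bounded:
  fixes u v :: "nat \<Rightarrow> real"
  assumes "u \<longlonglongrightarrow> 0" "\<And>m. \<bar>v m\<bar> \<le> C"
  shows "(\<lambda>m. u m * v m) \<longlonglongrightarrow> 0"
  by (rule tendsto_0_le[OF assms(1), of _ C]) (use assms(2) in \<open>auto simp: abs_mult intro!: mult_left_mono always_eventually\<close>)

text \<open>First-order optimality along the segment from \<open>g\<close> to \<open>c\<close>: the
  loss is quadratic on it and the penalty convex, so dividing the comparison by the step length and
  letting the step shrink leaves this inequality. It avoids subgradients of the absolute
  value.\<close>

lemma lasso_variational:
  assumes "is_lasso n p lam x g" and lam: "0 \<le> lam"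
  shows "inner_upto n (resid p x g) (fit p x (\<lambda>k. c k - g k)) / n \<le> lam * (l1norm p c - l1norm p g)"
proof (rule ccontr)
  define v where "v k = c k - g k" for k
  define a where "a = inner_upto n (resid p x g) (fit p x v) / n"
  define Q where "Q = sqnorm n (fit p x v) / n"
  define d where "d = lam * (l1norm p c - l1norm p g)"
  assume "\<not> ?thesis"
  then have ad: "a > d" unfolding a_def d_def v_def by simp
  have Q0: "0 \<le> Q" unfolding Q_def by simp
  have line: "2 * a \<le> s * Q + 2 * d" if s: "0 < s" "s \<le> 1" for s
  proof -
    have fv: "fit p x (\<lambda>k. s * v k) = (\<lambda>i. s * fit p x v i)" by (simp add: fun_eq_iff fit_scale)
    have "lasso_obj n p lam x g \<le> lasso_obj n p lam x (\<lambda>k. g k + s * v k)"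
      using assms(1) unfolding is_lasso_def by blast
    then have "0 \<le> - 2 * s * a + s\<^sup>2 * Q + 2 * lam * (l1norm p (\<lambda>k. g k + s * v k) - l1norm p g)"
      unfolding lasso_obj_shift lasso_obj_eq fv by (simp add: sqnorm_scale inner_scale_right a_def Q_def algebra_simps)
    also have "l1norm p (\<lambda>k. g k + s * v k) \<le> (1 - s) * l1norm p g + s * l1norm p c"
    proof -
      have "l1norm p (\<lambda>k. (1 - s) * g k + s * c k) \<le> (1 - s) * l1norm p g + s * l1norm p c"
        using l1norm_triangle[of p "\<lambda>k. (1 - s) * g k" "\<lambda>k. s * c k"] s
        unfolding l1norm_scale by simp
      moreover have "(\<lambda>k. g k + s * v k) = (\<lambda>k. (1 - s) * g k + s * c k)"
        by (simp add: fun_eq_iff v_def algebra_simps)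
      ultimately show ?thesis by simp
    qed
    then have "2 * lam * (l1norm p (\<lambda>k. g k + s * v k) - l1norm p g) \<le> 2 * lam * (s * (l1norm p c - l1norm p g))"
      using lam by (intro mult_left_mono) (auto simp: algebra_simps)
    finally have "0 \<le> s * (- 2 * a + s * Q + 2 * d)"
      by (simp add: d_def algebra_simps power2_eq_square)
    then show ?thesis using s by (simp add: zero_le_mult_iff)
  qed
  \<comment> \<open>Small enough that \<open>s * Q \<le> a - d\<close>, whereas \<open>line\<close>
    demands \<open>2 * (a - d) \<le> s * Q\<close>. The summand 1 guards against
    \<open>Q = 0\<close>.\<close>
  define s where "s = min 1 ((a - d) / (Q + 1))"
  have "s > 0" "s \<le> 1" unfolding s_def using ad Q0 by auto
  moreover have "s * Q \<le> (a - d) / (Q + 1) * Q" unfolding s_def using Q0 by (intro mult_right_mono) auto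
  moreover have "(a - d) / (Q + 1) * Q \<le> a - d" using ad Q0 by (simp add: field_simps)
  ultimately show False using line[of s] ad by linarith
qed

text \<open>Quadratic growth, measured in the fitted values: the cross term in the expansion around
  \<open>g\<close> has the right sign by the variational inequality. Uniqueness and continuity of
  the residual both rest on this.\<close>

lemma lasso_gap:
  assumes "is_lasso n p lam x g" "0 \<le> lam"
  shows "lasso_obj n p lam x g + sqnorm n (fit p x (\<lambda>k. c k - g k)) / n \<le> lasso_obj n p lam x c"
  using lasso_variational[OF assms, of c] lasso_obj_shift[of n p lam x g "\<lambda>k. c k - g k"]
  unfolding lasso_obj_eq by (simp add: algebra_simps)

text \<open>Test vectors in the variational inequality: \<open>2 * g\<close> and 0 give the two
  halves of the equality, and moving one coordinate by 1 or -1 gives the bound for its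
  column.\<close>

lemma lasso_KKT:
  assumes "is_lasso n p lam x g" "0 \<le> lam" "n > 0"
  shows "k \<in> {1..<p} \<Longrightarrow> \<bar>inner_upto n (resid p x g) (\<lambda>i. x i k)\<bar> \<le> n * lam"
    and "inner_upto n (resid p x g) (fit p x g) = n * (lam * l1norm p g)"
proof -
  note V = lasso_variational[OF assms(1,2)]
  have "inner_upto n (resid p x g) (fit p x g) / n = lam * l1norm p g"
  proof (rule antisym)
    show "inner_upto n (resid p x g) (fit p x g) / n \<le> lam * l1norm p g"
      using V[of "\<lambda>k. 2 * g k"] by (simp add: l1norm_scale)
    have "fit p x (\<lambda>k. 0 - g k) = (\<lambda>i. (-1) * fit p x g i)" by (simp add: fun_eq_iff fit_def sum_negf)
    then have "inner_upto n (resid p x g) (fit p x (\<lambda>k. 0 - g k)) = - inner_upto n (resid p x g) (fit p x g)"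
      by (simp only: inner_scale_right)
    then show "lam * l1norm p g \<le> inner_upto n (resid p x g) (fit p x g) / n"
      using V[of "\<lambda>k. 0"] by (simp add: l1norm_def)
  qed
  then show "inner_upto n (resid p x g) (fit p x g) = n * (lam * l1norm p g)"
    using assms(3) by (simp add: field_simps)
  assume k: "k \<in> {1..<p}"
  have one: "s * inner_upto n (resid p x g) (\<lambda>i. x i k) / n \<le> lam" if "\<bar>s\<bar> = 1" for s
  proof -
    define c where "c j = g j + (if j = k then s else 0)" for j
    have "fit p x (\<lambda>j. c j - g j) = (\<lambda>i. s * x i k)"
    proof
      fix i
      have "fit p x (\<lambda>j. c j - g j) i = (\<Sum>j\<in>{1..<p}. if j = k then s * x i j else 0)"
        unfolding fit_def c_def by (intro sum.cong) auto
      then show "fit p x (\<lambda>j. c j - g j) i = s * x i k" using k by simp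
    qed
    moreover have "l1norm p c - l1norm p g \<le> 1"
    proof -
      have "l1norm p c \<le> l1norm p g + (\<Sum>j\<in>{1..<p}. if j = k then \<bar>s\<bar> else 0)"
        unfolding l1norm_def c_def sum.distrib[symmetric] by (intro sum_mono) auto
      then show ?thesis using k that by simp
    qed
    then have "lam * (l1norm p c - l1norm p g) \<le> lam" using assms(2) by (simp add: mult_left_le)
    ultimately show ?thesis using V[of c] by (simp add: inner_scale_right)
  qed
  show "\<bar>inner_upto n (resid p x g) (\<lambda>i. x i k)\<bar> \<le> n * lam"
    using one[of 1] one[of "-1"] assms(3) by (auto simp: field_simps abs_le_iff)
qed

lemma resid_cong:
  assumes "0 < p" "\<And>j. j < p \<Longrightarrow> x i j = y i j"
  shows "resid p x c i = resid p y c i"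
proof -
  have "fit p x c i = fit p y c i" unfolding fit_def using assms by (intro sum.cong) auto
  then show ?thesis using assms unfolding resid_def by simp
qed

lemma sqnorm_cong: "(\<And>i. i < n \<Longrightarrow> r i = s i) \<Longrightarrow> sqnorm n r = sqnorm n s"
  unfolding sqnorm_def by (intro sum.cong) auto

text \<open>Two minimisers have the same fit by the growth inequality. Allowing two designs that
  agree on the relevant block permits the passage to the truncated design.\<close>

lemma lasso_resid_unique:
  assumes g: "is_lasso n p lam x g" and h: "is_lasso n p lam y h" and "0 \<le> lam" "n > 0" "0 < p"
    and eq: "\<And>i j. i < n \<Longrightarrow> j < p \<Longrightarrow> x i j = y i j" and i: "i < n"
  shows "resid p x g i = resid p y h i"
proof -
  have "lasso_obj n p lam y c = lasso_obj n p lam x c" for c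
  proof -
    have "sqnorm n (resid p y c) = sqnorm n (resid p x c)"
      by (intro sqnorm_cong resid_cong) (auto simp: assms)
    then show ?thesis by (simp add: lasso_obj_eq)
  qed
  then have "is_lasso n p lam x h" using h unfolding is_lasso_def by simp
  then have "sqnorm n (fit p x (\<lambda>k. h k - g k)) / n \<le> 0"
  proof -
    have "lasso_obj n p lam x h \<le> lasso_obj n p lam x g" using \<open>is_lasso n p lam x h\<close> unfolding is_lasso_def by blast
    then show ?thesis using lasso_gap[OF g \<open>0 \<le> lam\<close>, of h] by linarith
  qed
  then have "sqnorm n (fit p x (\<lambda>k. h k - g k)) \<le> 0"
    using \<open>n > 0\<close> by (simp add: divide_le_0_iff)
  then have "sqnorm n (fit p x (\<lambda>k. h k - g k)) = 0" by (intro antisym) auto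
  then have "fit p x (\<lambda>k. h k - g k) i = 0"
    using i unfolding sqnorm_def by (subst (asm) sum_nonneg_eq_0_iff) auto
  then have "resid p x g i = resid p x h i" by (simp add: resid_def fit_diff)
  also have "\<dots> = resid p y h i" by (intro resid_cong) (auto simp: assms)
  finally show ?thesis .
qed

text \<open>Minimisers need not depend continuously on the design, but their residuals do: by
  \<open>lasso_gap\<close> the fits of near-minimisers are close.\<close>

lemma lasso_resid_continuous:
  fixes ghat :: "(nat \<Rightarrow> nat \<Rightarrow> real) \<Rightarrow> nat \<Rightarrow> real"
  assumes ghat: "\<And>x. is_lasso n p lam x (ghat x)" and lam: "lam > 0" and n: "n > 0" and i: "i < n"
  shows "continuous_on UNIV (\<lambda>x. resid p x (ghat x) i)"
proof (subst continuous_on_sequentially, intro allI ballI impI)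
  fix x :: "nat \<Rightarrow> nat \<Rightarrow> real" and X :: "nat \<Rightarrow> nat \<Rightarrow> nat \<Rightarrow> real"
  assume "(\<forall>m. X m \<in> UNIV) \<and> X \<longlonglongrightarrow> x"
  then have "X \<longlonglongrightarrow> x" by simp
  moreover have "continuous_on UNIV (\<lambda>y :: nat \<Rightarrow> nat \<Rightarrow> real. y i j)" for i j
  proof -
    have "continuous_on UNIV (\<lambda>y :: nat \<Rightarrow> nat \<Rightarrow> real. y i)"
      by (rule continuous_on_product_then_coordinatewise[OF continuous_on_id])
    then show ?thesis by (rule continuous_on_product_then_coordinatewise)
  qed
  ultimately have lim: "(\<lambda>m. X m i j) \<longlonglongrightarrow> x i j" for i j
    using continuous_on_tendsto_compose[of UNIV "\<lambda>y. y i j" X x sequentially] by auto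
  define gm where "gm m = ghat (X m)" for m
  define g where "g = ghat x"
  define f0 where "f0 m = lasso_obj n p lam (X m) (\<lambda>_. 0)" for m
  have rlim: "(\<lambda>m. resid p (X m) c l) \<longlonglongrightarrow> resid p x c l" for c l
    unfolding resid_def fit_def by (intro tendsto_intros lim)
  have "f0 \<longlonglongrightarrow> lasso_obj n p lam x (\<lambda>_. 0)"
    unfolding f0_def lasso_obj_eq sqnorm_def by (intro tendsto_intros rlim) (use n in auto)
  then have "Bseq f0" by (intro convergent_imp_Bseq convergentI)
  then obtain B where B: "B > 0" "\<And>m. \<bar>f0 m\<bar> \<le> B" unfolding Bseq_def by auto
  \<comment> \<open>Comparison with the zero vector bounds the objective along the sequence; since
    \<open>lam > 0\<close>, it bounds the minimisers as well as their residuals.\<close>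
  have fm: "lasso_obj n p lam (X m) (gm m) \<le> B" for m
    using ghat[of "X m"] B(2)[of m] unfolding is_lasso_def f0_def gm_def by (meson abs_le_iff order_trans)
  have pos: "0 \<le> sqnorm n r / n" for r by simp
  have l1b: "l1norm p (gm m) \<le> B / (2 * lam)" for m
  proof -
    have "l1norm p (gm m) * (2 * lam) \<le> B"
      using fm[of m] pos[of "resid p (X m) (gm m)"] unfolding lasso_obj_eq mult.commute[of "l1norm p (gm m)"] by linarith
    then show ?thesis using lam by (subst pos_le_divide_eq) auto
  qed
  have rb: "\<bar>resid p (X m) (gm m) l\<bar> \<le> sqrt (n * B)" if "l < n" for m l
  proof -
    have "sqnorm n (resid p (X m) (gm m)) / n \<le> B"
    proof -
      have "0 \<le> 2 * lam * l1norm p (gm m)" using lam by simp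
      then show ?thesis using fm[of m] unfolding lasso_obj_eq by linarith
    qed
    then have "sqnorm n (resid p (X m) (gm m)) \<le> n * B" using n by (simp add: field_simps)
    moreover have "(resid p (X m) (gm m) l)\<^sup>2 \<le> sqnorm n (resid p (X m) (gm m))"
      unfolding sqnorm_def using that by (intro member_le_sum) auto
    ultimately have "sqrt ((resid p (X m) (gm m) l)\<^sup>2) \<le> sqrt (n * B)" by (intro real_sqrt_le_mono) linarith
    then show ?thesis by simp
  qed
  \<comment> \<open>The change of the residual when the design alone is moved, with the coefficients
    \<open>gm m\<close> kept; it vanishes in the limit because these coefficients are
    bounded.\<close>
  define e where "e m l = resid p x (gm m) l - resid p (X m) (gm m) l" for m l
  have gb: "\<bar>gm m k\<bar> \<le> B / (2 * lam)" if "k \<in> {1..<p}" for m k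
  proof -
    have "\<bar>gm m k\<bar> \<le> l1norm p (gm m)"
      unfolding l1norm_def using that by (intro member_le_sum) auto
    then show ?thesis using l1b[of m] by linarith
  qed
  have elim: "(\<lambda>m. e m l) \<longlonglongrightarrow> 0" for l
  proof -
    have "(\<lambda>m. (x l k - X m l k) * gm m k) \<longlonglongrightarrow> 0" if "k \<in> {1..<p}" for k
      using tendsto_diff[OF tendsto_const lim[of l k], of "x l k"] gb[OF that]
      by (intro tendsto_mult_null_bounded) auto
    then have "(\<lambda>m. (x l 0 - X m l 0) - (\<Sum>k\<in>{1..<p}. (x l k - X m l k) * gm m k)) \<longlonglongrightarrow> (x l 0 - x l 0) - (\<Sum>k\<in>{1..<p}. 0)"
      by (intro tendsto_intros lim)
    moreover have "e m l = (x l 0 - X m l 0) - (\<Sum>k\<in>{1..<p}. (x l k - X m l k) * gm m k)" for m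
      unfolding e_def resid_def fit_def by (simp add: algebra_simps sum_subtractf)
    ultimately show ?thesis by simp
  qed
  \<comment> \<open>Bounds the excess of the objective of \<open>gm m\<close> over its minimum at
    the limiting design: the first part is the cost of changing the design at \<open>gm m\<close>,
    the second that of changing it back at \<open>g\<close>.\<close>
  define \<delta> where "\<delta> m = (\<Sum>l<n. 2 * (e m l * resid p (X m) (gm m) l) + (e m l)\<^sup>2) / n
      + (lasso_obj n p lam (X m) g - lasso_obj n p lam x g)" for m
  have "(\<lambda>m. e m l * resid p (X m) (gm m) l) \<longlonglongrightarrow> 0" if "l < n" for l
    using elim rb[OF that] by (rule tendsto_mult_null_bounded)
  then have "\<delta> \<longlonglongrightarrow> (\<Sum>l<n. 2 * 0 + 0\<^sup>2) / n + (lasso_obj n p lam x g - lasso_obj n p lam x g)"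
    unfolding \<delta>_def lasso_obj_eq sqnorm_def by (intro tendsto_intros elim rlim) (use n in auto)
  then have \<delta>0: "\<delta> \<longlonglongrightarrow> 0" by simp
  have gap: "sqnorm n (fit p x (\<lambda>k. gm m k - g k)) / n \<le> \<delta> m" for m
  proof -
    have "sqnorm n (resid p x (gm m)) - sqnorm n (resid p (X m) (gm m)) =
        (\<Sum>l<n. 2 * (e m l * resid p (X m) (gm m) l) + (e m l)\<^sup>2)"
      unfolding sqnorm_def sum_subtractf[symmetric] e_def
      by (intro sum.cong) (auto simp: power2_eq_square algebra_simps)
    then have "lasso_obj n p lam x (gm m) - lasso_obj n p lam (X m) (gm m) =
        (\<Sum>l<n. 2 * (e m l * resid p (X m) (gm m) l) + (e m l)\<^sup>2) / n"
      unfolding lasso_obj_eq by (simp add: diff_divide_distrib[symmetric])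
    moreover have "lasso_obj n p lam (X m) (gm m) \<le> lasso_obj n p lam (X m) g"
      using ghat[of "X m"] unfolding is_lasso_def gm_def by blast
    moreover have "lasso_obj n p lam x g + sqnorm n (fit p x (\<lambda>k. gm m k - g k)) / n \<le> lasso_obj n p lam x (gm m)"
      using lasso_gap[OF ghat[of x], of "gm m"] lam unfolding g_def by simp
    ultimately show ?thesis unfolding \<delta>_def by linarith
  qed
  have "(\<lambda>m. (fit p x (\<lambda>k. gm m k - g k) i)\<^sup>2) \<longlonglongrightarrow> 0"
  proof (rule tendsto_sandwich[OF _ _ tendsto_const])
    show "(\<lambda>m. n * \<delta> m) \<longlonglongrightarrow> 0" using tendsto_mult[OF tendsto_const \<delta>0, of "real n"] by simp
    have "(fit p x (\<lambda>k. gm m k - g k) i)\<^sup>2 \<le> n * \<delta> m" for m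
    proof -
      have "(fit p x (\<lambda>k. gm m k - g k) i)\<^sup>2 \<le> sqnorm n (fit p x (\<lambda>k. gm m k - g k))"
        unfolding sqnorm_def using i by (intro member_le_sum) auto
      then show ?thesis using gap[of m] n by (simp add: field_simps)
    qed
    then show "\<forall>\<^sub>F m in sequentially. (fit p x (\<lambda>k. gm m k - g k) i)\<^sup>2 \<le> n * \<delta> m" by simp
  qed simp
  then have "(\<lambda>m. fit p x (\<lambda>k. gm m k - g k) i) \<longlonglongrightarrow> 0"
    using tendsto_real_sqrt[of "\<lambda>m. (fit p x (\<lambda>k. gm m k - g k) i)\<^sup>2" 0 sequentially]
    by (simp add: tendsto_rabs_zero_iff)
  then have "(\<lambda>m. resid p x g i - fit p x (\<lambda>k. gm m k - g k) i - e m i) \<longlonglongrightarrow> resid p x g i - 0 - 0"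
    by (intro tendsto_intros elim)
  moreover have "resid p (X m) (gm m) i = resid p x g i - fit p x (\<lambda>k. gm m k - g k) i - e m i" for m
    unfolding e_def resid_def by (simp add: fit_diff)
  ultimately show "((\<lambda>x. resid p x (ghat x) i) \<circ> X) \<longlonglongrightarrow> resid p x (ghat x) i"
    by (simp add: comp_def gm_def g_def)
qed

text \<open>The objective at \<open>g\<close> is expanded around the comparison vector
  \<open>c\<close>; the cross term is a sum over columns and is at most \<open>\<mu> * D\<close> by
  duality of the maximum norm and the l1 norm. The difference of the mean squares is exactly
  \<open>Q - 2 * a\<close>.\<close>

lemma lasso_basic_inequality:
  assumes g: "is_lasso n p lam x g" and n: "n > 0"
    and b: "\<And>k. k \<in> {1..<p} \<Longrightarrow> \<bar>inner_upto n (resid p x c) (\<lambda>i. x i k)\<bar> \<le> real n * \<mu>"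
  defines "Q \<equiv> sqnorm n (fit p x (\<lambda>k. g k - c k)) / n" and "D \<equiv> l1norm p (\<lambda>k. g k - c k)"
  shows "Q + 2 * lam * l1norm p g \<le> 2 * lam * l1norm p c + 2 * \<mu> * D"
    and "\<bar>sqnorm n (resid p x g) / n - sqnorm n (resid p x c) / n\<bar> \<le> 2 * \<mu> * D + Q"
proof -
  define a where "a = inner_upto n (resid p x c) (fit p x (\<lambda>k. g k - c k)) / n"
  have "\<bar>inner_upto n (resid p x c) (fit p x (\<lambda>k. g k - c k))\<bar> \<le> real n * \<mu> * D"
    unfolding D_def by (rule abs_inner_fit_le[OF b])
  then have a: "\<bar>a\<bar> \<le> \<mu> * D" using n unfolding a_def by (simp add: field_simps)
  have o: "lasso_obj n p lam x g = sqnorm n (resid p x c) / n - 2 * a + Q + 2 * lam * l1norm p g"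
    using lasso_obj_shift[of n p lam x c "\<lambda>k. g k - c k"] unfolding a_def Q_def by simp
  moreover have "lasso_obj n p lam x g \<le> lasso_obj n p lam x c" using g unfolding is_lasso_def by blast
  ultimately show "Q + 2 * lam * l1norm p g \<le> 2 * lam * l1norm p c + 2 * \<mu> * D"
    using a unfolding lasso_obj_eq[of n p lam x c] by linarith
  have "sqnorm n (resid p x g) / n - sqnorm n (resid p x c) / n = Q - 2 * a"
    using o unfolding lasso_obj_eq by simp
  moreover have "0 \<le> Q" unfolding Q_def by simp
  ultimately show "\<bar>sqnorm n (resid p x g) / n - sqnorm n (resid p x c) / n\<bar> \<le> 2 * \<mu> * D + Q"
    using a by linarith
qed

text \<open>With \<open>2 * \<mu> \<le> lam\<close>, the triangle inequality splits the noise term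
  into a part absorbed by the penalty of \<open>g\<close> and one more multiple of the penalty of
  \<open>c\<close>. What remains is
  \<open>Q + lam * l1norm p g \<le> 3 * (lam * l1norm p c)\<close>.\<close>

lemma lasso_close_slow_rate:
  assumes "is_lasso n p lam x g" "n > 0" "0 \<le> \<mu>" "2 * \<mu> \<le> lam"
    and "\<And>k. k \<in> {1..<p} \<Longrightarrow> \<bar>inner_upto n (resid p x c) (\<lambda>i. x i k)\<bar> \<le> real n * \<mu>"
  shows "\<bar>sqnorm n (resid p x g) / n - sqnorm n (resid p x c) / n\<bar> \<le> 4 * (lam * l1norm p c)"
    and "lam * l1norm p g \<le> 3 * (lam * l1norm p c)"
proof -
  define Q where "Q = sqnorm n (fit p x (\<lambda>k. g k - c k)) / n"
  define D where "D = l1norm p (\<lambda>k. g k - c k)"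
  note B = lasso_basic_inequality[OF assms(1,2,5), folded Q_def D_def]
  have "0 \<le> Q" unfolding Q_def by simp
  have "2 * \<mu> * D \<le> lam * (l1norm p g + l1norm p c)"
    using assms(3,4) unfolding D_def by (intro mult_mono l1norm_diff) auto
  then have D: "2 * \<mu> * D \<le> lam * l1norm p g + lam * l1norm p c" by (simp add: algebra_simps)
  have m: "0 \<le> lam * l1norm p g" using assms by (intro mult_nonneg_nonneg) auto
  show "lam * l1norm p g \<le> 3 * (lam * l1norm p c)"
    and "\<bar>sqnorm n (resid p x g) / n - sqnorm n (resid p x c) / n\<bar> \<le> 4 * (lam * l1norm p c)"
    using B D \<open>0 \<le> Q\<close> m by linarith+
qed

text \<open>Compatibility takes the place of the domination of \<open>\<mu>\<close> by
  \<open>lam\<close>: from \<open>a * D\<^sup>2 \<le> Q \<le> t * D\<close> with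
  \<open>t = 2 * lam + 2 * \<mu>\<close> follows \<open>D \<le> t / a\<close>, so all errors are of
  order \<open>t\<^sup>2 / a\<close>.\<close>

lemma lasso_close_fast_rate:
  assumes "is_lasso n p lam x g" "n > 0" "0 \<le> \<mu>" "0 \<le> lam" "a > 0"
    and "\<And>k. k \<in> {1..<p} \<Longrightarrow> \<bar>inner_upto n (resid p x c) (\<lambda>i. x i k)\<bar> \<le> real n * \<mu>"
    and comp: "\<And>v. a * (l1norm p v)\<^sup>2 \<le> sqnorm n (fit p x v) / n"
  shows "\<bar>sqnorm n (resid p x g) / n - sqnorm n (resid p x c) / n\<bar> \<le> 2 * (2 * lam + 2 * \<mu>)\<^sup>2 / a"
    and "lam * l1norm p g \<le> lam * l1norm p c + (2 * lam + 2 * \<mu>)\<^sup>2 / a"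
proof -
  define Q where "Q = sqnorm n (fit p x (\<lambda>k. g k - c k)) / n"
  define D where "D = l1norm p (\<lambda>k. g k - c k)"
  define t where "t = 2 * lam + 2 * \<mu>"
  note B = lasso_basic_inequality[OF assms(1,2,6), folded Q_def D_def]
  have D0: "0 \<le> D" unfolding D_def by simp
  have t0: "0 \<le> t" unfolding t_def using assms by simp
  have tri: "l1norm p c \<le> l1norm p g + D" unfolding D_def by (rule l1norm_triangle_sub)
  have tri2: "l1norm p g \<le> l1norm p c + D"
    using l1norm_triangle[of p c "\<lambda>k. g k - c k"] unfolding D_def by simp
  have "lam * l1norm p c \<le> lam * l1norm p g + lam * D"
    using mult_left_mono[OF tri assms(4)] by (simp add: algebra_simps)
  then have Qt: "Q \<le> t * D" using B(1) unfolding t_def by (simp add: algebra_simps)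
  moreover have "a * D\<^sup>2 \<le> Q" unfolding D_def Q_def by (rule comp)
  ultimately have "a * D * D \<le> t * D" by (simp add: power2_eq_square mult.assoc)
  then have "a * D \<le> t" using D0 t0 by (cases "D = 0") auto
  then have Dt: "D \<le> t / a" using assms(5) by (simp add: field_simps)
  have tD: "t * D \<le> t\<^sup>2 / a" using mult_left_mono[OF Dt t0] by (simp add: power2_eq_square)
  have l: "lam * D \<le> t * D" "2 * \<mu> * D \<le> t * D" unfolding t_def using D0 assms by (intro mult_right_mono; simp)+
  show "\<bar>sqnorm n (resid p x g) / n - sqnorm n (resid p x c) / n\<bar> \<le> 2 * (2 * lam + 2 * \<mu>)\<^sup>2 / a"
    using B(2) Qt tD l unfolding t_def[symmetric] by simp
  have "lam * l1norm p g \<le> lam * l1norm p c + lam * D"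
    using mult_left_mono[OF tri2 assms(4)] by (simp add: algebra_simps)
  then show "lam * l1norm p g \<le> lam * l1norm p c + (2 * lam + 2 * \<mu>)\<^sup>2 / a"
    using tD l unfolding t_def[symmetric] by simp
qed

text \<open>An entrywise error \<open>\<kappa>\<close> changes the quadratic form by at most
  \<open>\<kappa>\<close> times the squared l1 norm, while Cauchy-Schwarz bounds that squared norm
  by \<open>p\<close> times the Euclidean one. The loss of the factor \<open>p\<close> is harmless
  since the lemma serves bounded dimensions.\<close>

lemma gram_compatibility:
  assumes n: "n > 0" and p: "0 < p" and L: "L \<ge> 0"
    and ray: "\<And>v. L * (\<Sum>j<p. (v j)\<^sup>2) \<le> qform p S v v"
    and close: "\<And>j l. j < p \<Longrightarrow> l < p \<Longrightarrow> \<bar>inner_upto n (\<lambda>i. x i j) (\<lambda>i. x i l) / n - S j l\<bar> \<le> \<kappa>"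
  shows "(L / p - \<kappa>) * (l1norm p v)\<^sup>2 \<le> sqnorm n (fit p x v) / n"
proof -
  define w where "w j = (if j = 0 then 0 else v j)" for j
  have split: "(\<Sum>j<p. f j) = f 0 + (\<Sum>j\<in>{1..<p}. f j)" for f :: "nat \<Rightarrow> real"
    using p by (simp add: lessThan_atLeast0 sum.atLeast_Suc_lessThan)
  have fw: "fit p x v i = (\<Sum>j<p. x i j * w j)" for i
    unfolding split by (auto simp: fit_def w_def intro!: sum.cong)
  have lw: "l1norm p v = (\<Sum>j<p. \<bar>w j\<bar>)"
    unfolding split by (auto simp: l1norm_def w_def intro!: sum.cong)
  have "sqnorm n (fit p x v) = (\<Sum>i<n. \<Sum>j<p. \<Sum>l<p. w j * w l * (x i j * x i l))"
    unfolding sqnorm_def fw power2_eq_square sum_product by (simp add: mult_ac)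
  also have "\<dots> = (\<Sum>j<p. \<Sum>l<p. \<Sum>i<n. w j * w l * (x i j * x i l))"
    by (rule trans[OF sum.swap], rule sum.cong[OF refl], rule sum.swap)
  finally have "sqnorm n (fit p x v) / n = (\<Sum>j<p. \<Sum>l<p. w j * w l * (inner_upto n (\<lambda>i. x i j) (\<lambda>i. x i l) / n))"
    by (simp add: inner_upto_def sum_distrib_left sum_divide_distrib)
  also have "\<dots> = qform p S w w + (\<Sum>j<p. \<Sum>l<p. w j * w l * (inner_upto n (\<lambda>i. x i j) (\<lambda>i. x i l) / n - S j l))"
    unfolding qform_def sum.distrib[symmetric] by (simp add: algebra_simps)
  finally have e: "sqnorm n (fit p x v) / n = \<dots>" .
  have "\<bar>\<Sum>j<p. \<Sum>l<p. w j * w l * (inner_upto n (\<lambda>i. x i j) (\<lambda>i. x i l) / n - S j l)\<bar>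
      \<le> (\<Sum>j<p. \<Sum>l<p. \<bar>w j\<bar> * \<bar>w l\<bar> * \<kappa>)"
    using close by (intro order_trans[OF sum_abs] sum_mono) (auto simp: abs_mult intro!: mult_left_mono)
  also have "\<dots> = \<kappa> * (l1norm p v)\<^sup>2"
    unfolding lw power2_eq_square sum_product by (simp add: sum_distrib_left mult_ac)
  finally have 1: "qform p S w w - \<kappa> * (l1norm p v)\<^sup>2 \<le> sqnorm n (fit p x v) / n"
    unfolding e by linarith
  have "(l1norm p v)\<^sup>2 \<le> (\<Sum>j<p. (w j)\<^sup>2) * p"
    unfolding lw using Cauchy_Schwarz_ineq_sum[of "\<lambda>j. \<bar>w j\<bar>" "\<lambda>_. 1" "{..<p}"] by simp
  then have "L / p * (l1norm p v)\<^sup>2 \<le> L / p * ((\<Sum>j<p. (w j)\<^sup>2) * p)"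
    using L by (intro mult_left_mono) auto
  also have "\<dots> \<le> qform p S w w" using ray[of w] p by simp
  finally show ?thesis using 1 by (simp add: algebra_simps)
qed

section \<open>The debiased estimator at a Lasso solution\<close>

definition tautilde :: "nat \<Rightarrow> nat \<Rightarrow> real \<Rightarrow> (nat \<Rightarrow> nat \<Rightarrow> real) \<Rightarrow> (nat \<Rightarrow> real) \<Rightarrow> real" where
  "tautilde n p lam x g = sqnorm n (resid p x g) / n + lam * l1norm p g"

lemma sum_thetahat:
  assumes "0 < p"
  shows "(\<Sum>j<p. thetahat n p lam x g j * f j) = (f 0 - (\<Sum>k\<in>{1..<p}. f k * g k)) / tautilde n p lam x g"
proof -
  have th: "thetahat n p lam x g j = (if j = 0 then 1 else if j \<in> {1..<p} then - g j else 0) / tautilde n p lam x g" for j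
    unfolding thetahat_def tautilde_def sqnorm_def resid_def fit_def l1norm_def ..
  have split: "(\<Sum>j<p. f j) = f 0 + (\<Sum>j\<in>{1..<p}. f j)" for f :: "nat \<Rightarrow> real"
    using assms by (simp add: lessThan_atLeast0 sum.atLeast_Suc_lessThan)
  have "(\<Sum>k\<in>{1..<p}. thetahat n p lam x g k * f k) = (\<Sum>k\<in>{1..<p}. - (f k * g k) / tautilde n p lam x g)"
    unfolding th by (intro sum.cong) auto
  then show ?thesis unfolding split
    by (simp add: th sum_negf sum_divide_distrib[symmetric] diff_divide_distrib)
qed

lemma sum_thetahat_inner:
  assumes "0 < p"
  shows "(\<Sum>j<p. thetahat n p lam x g j * (\<Sum>i<n. x i j * s i)) =
    inner_upto n (resid p x g) s / tautilde n p lam x g"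
proof -
  have "(\<Sum>i<n. x i 0 * s i) - (\<Sum>k\<in>{1..<p}. (\<Sum>i<n. x i k * s i) * g k) = inner_upto n (resid p x g) s"
    unfolding inner_upto_def resid_def fit_def sum_distrib_right left_diff_distrib sum_subtractf
    by (subst sum.swap) (simp add: mult_ac)
  then show ?thesis unfolding sum_thetahat[OF assms] by simp
qed

lemma sighat_eq:
  assumes "0 < p"
  shows "sighat n p lam x g = sqnorm n (resid p x g) / n / (tautilde n p lam x g)\<^sup>2"
  unfolding sighat_def sqnorm_def
  using sum_thetahat[OF assms, of n lam x g "\<lambda>j. x i j" for i]
  by (simp add: mult.commute[of _ "thetahat n p lam x g _"] resid_def fit_def power_divide sum_divide_distrib[symmetric])

text \<open>The KKT equality makes \<open>tautilde\<close> equal to the inner product of the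
  residual with the first column, divided by \<open>n\<close>. Hence the error of \<open>bh\<close>
  in coordinate 0 cancels exactly, and every other coordinate enters with weight at most
  \<open>lam / tautilde\<close>.\<close>

lemma debiased_remainder:
  assumes g: "is_lasso n p lam x g" and lam: "0 \<le> lam" and n: "n > 0" and p: "0 < p"
    and tau: "tautilde n p lam x g > 0"
  shows "\<bar>debiased n p lam x (resp p x e \<beta>) g bh - \<beta> 0
      - (\<Sum>j<p. thetahat n p lam x g j * (\<Sum>i<n. x i j * e i)) / n\<bar>
    \<le> lam / tautilde n p lam x g * (\<Sum>j<p. \<bar>bh j - \<beta> j\<bar>)"
proof -
  define t where "t = tautilde n p lam x g"
  define r where "r = resid p x g"
  have split: "(\<Sum>j<p. f j) = f 0 + (\<Sum>j\<in>{1..<p}. f j)" for f :: "nat \<Rightarrow> real"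
    using p by (simp add: lessThan_atLeast0 sum.atLeast_Suc_lessThan)
  have res: "resp p x e \<beta> i - (\<Sum>k<p. x i k * bh k) = e i - (\<Sum>k<p. x i k * (bh k - \<beta> k))" for i
    unfolding resp_def by (simp add: algebra_simps sum_subtractf)
  \<comment> \<open>The first column is residual plus fit; the inner product of the residual with
    the fit is supplied by the KKT equality.\<close>
  have r0: "inner_upto n r (\<lambda>i. x i 0) = n * t"
  proof -
    have "(\<lambda>i. x i 0) = (\<lambda>i. r i + fit p x g i)" by (simp add: r_def resid_def)
    then have "inner_upto n r (\<lambda>i. x i 0) = sqnorm n r + inner_upto n r (fit p x g)"
      by (simp add: inner_upto_def sqnorm_def power2_eq_square algebra_simps sum.distrib)
    then show ?thesis using lasso_KKT(2)[OF g lam n] n unfolding t_def tautilde_def r_def by (simp add: field_simps)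
  qed
  have "inner_upto n r (\<lambda>i. \<Sum>k<p. x i k * (bh k - \<beta> k)) = (\<Sum>k<p. (bh k - \<beta> k) * inner_upto n r (\<lambda>i. x i k))"
    unfolding inner_upto_def sum_distrib_left by (subst sum.swap) (simp add: mult_ac)
  also have "\<dots> = (bh 0 - \<beta> 0) * (n * t) + (\<Sum>k\<in>{1..<p}. (bh k - \<beta> k) * inner_upto n r (\<lambda>i. x i k))"
    unfolding split r0 ..
  finally have i: "inner_upto n r (\<lambda>i. \<Sum>k<p. x i k * (bh k - \<beta> k)) / (t * n) =
      bh 0 - \<beta> 0 + (\<Sum>k\<in>{1..<p}. (bh k - \<beta> k) * inner_upto n r (\<lambda>i. x i k)) / (t * n)"
    using tau n unfolding t_def[symmetric] by (simp add: add_divide_distrib)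
  have "debiased n p lam x (resp p x e \<beta>) g bh - \<beta> 0
      - (\<Sum>j<p. thetahat n p lam x g j * (\<Sum>i<n. x i j * e i)) / n =
      bh 0 - \<beta> 0 - inner_upto n r (\<lambda>i. \<Sum>k<p. x i k * (bh k - \<beta> k)) / (t * n)"
    unfolding debiased_def sum_thetahat_inner[OF p] t_def[symmetric] r_def[symmetric] res inner_diff_right
    by (simp add: diff_divide_distrib)
  also have "\<dots> = - (\<Sum>k\<in>{1..<p}. (bh k - \<beta> k) * inner_upto n r (\<lambda>i. x i k)) / (t * n)"
    unfolding i by simp
  finally have "\<bar>debiased n p lam x (resp p x e \<beta>) g bh - \<beta> 0
      - (\<Sum>j<p. thetahat n p lam x g j * (\<Sum>i<n. x i j * e i)) / n\<bar> =
      \<bar>\<Sum>k\<in>{1..<p}. (bh k - \<beta> k) * inner_upto n r (\<lambda>i. x i k)\<bar> / (t * n)"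
    using tau unfolding t_def[symmetric] by simp
  also have "\<dots> \<le> (\<Sum>k\<in>{1..<p}. \<bar>bh k - \<beta> k\<bar> * (n * lam)) / (t * n)"
    using lasso_KKT(1)[OF g lam n] tau unfolding t_def[symmetric] r_def
    by (intro divide_right_mono order_trans[OF sum_abs] sum_mono) (auto simp: abs_mult intro!: mult_left_mono)
  also have "\<dots> = lam / t * (\<Sum>k\<in>{1..<p}. \<bar>bh k - \<beta> k\<bar>)"
    using n by (simp add: sum_distrib_right[symmetric])
  also have "\<dots> \<le> lam / t * (\<Sum>j<p. \<bar>bh j - \<beta> j\<bar>)"
    using lam tau unfolding t_def[symmetric] split by (intro mult_left_mono) auto
  finally show ?thesis unfolding t_def .
qed

text \<open>Serves for \<open>s\<close> the mean squared residual, \<open>t\<close> the denominator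
  and \<open>x\<close> their common limit. Since \<open>t + x \<le> 5 / 2 * x\<close>, the numerator
  is at most \<open>7 / 2 * e * x\<close>; the bound \<open>t \<ge> a / 2\<close> then turns
  \<open>7 / 2\<close> into 14.\<close>

lemma abs_ratio_square_le:
  fixes s t x a e :: real
  assumes "a > 0" "a \<le> x" "\<bar>s - x\<bar> \<le> e" "\<bar>t - x\<bar> \<le> e" "e \<le> a / 2"
  shows "\<bar>s / t\<^sup>2 - 1 / x\<bar> \<le> 14 * e / a\<^sup>2"
proof -
  have e: "0 \<le> e" using assms by linarith
  have t: "x / 2 \<le> t" "t \<le> 3 / 2 * x" "0 < t" "0 < x" using assms by linarith+
  have "s / t\<^sup>2 - 1 / x = ((s - x) * x - (t - x) * (t + x)) / (x * t\<^sup>2)"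
    using t by (simp add: field_simps power2_eq_square)
  also have "\<bar>\<dots>\<bar> \<le> (e * x + e * (5 / 2 * x)) / (x * t\<^sup>2)"
  proof -
    have "\<bar>(s - x) * x\<bar> \<le> e * x" using assms t by (auto simp: abs_mult intro!: mult_mono)
    moreover have "\<bar>(t - x) * (t + x)\<bar> \<le> e * (5 / 2 * x)"
      using assms t e unfolding abs_mult by (intro mult_mono) auto
    ultimately have "\<bar>(s - x) * x - (t - x) * (t + x)\<bar> \<le> e * x + e * (5 / 2 * x)" by linarith
    then show ?thesis using t
      by (subst abs_divide, subst abs_of_pos[of "x * t\<^sup>2"]) (auto intro!: divide_right_mono simp del: times_divide_eq_left)
  qed
  also have "\<dots> = 7 / 2 * e / t\<^sup>2" using t by (simp add: field_simps)
  also have "\<dots> \<le> 7 / 2 * e / (a / 2)\<^sup>2"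
    using assms t e by (intro divide_left_mono power_mono mult_pos_pos) auto
  also have "\<dots> = 14 * e / a\<^sup>2" by (simp add: field_simps power2_eq_square)
  finally show ?thesis .
qed

section \<open>Events of high probability\<close>

text \<open>Block elimination by induction on the index set. If \<open>h\<close> solves the old
  system for the new column \<open>m\<close>, then the vector with entry 1 at \<open>m\<close> and
  \<open>- h\<close> elsewhere is mapped to a multiple \<open>s\<close> of the unit vector at
  \<open>m\<close>; its quadratic form is this \<open>s\<close>, the Schur complement, which is
  therefore positive.\<close>

lemma solvable_of_pos_def:
  fixes S :: "nat \<Rightarrow> nat \<Rightarrow> real"
  assumes "finite K" and sym: "\<And>j l. S j l = S l j"
    and pd: "\<And>w. \<exists>j\<in>K. w j \<noteq> 0 \<Longrightarrow> 0 < (\<Sum>j\<in>K. \<Sum>l\<in>K. w j * S j l * w l)"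
  shows "\<exists>g. (\<forall>j. j \<notin> K \<longrightarrow> g j = 0) \<and> (\<forall>k\<in>K. (\<Sum>j\<in>K. S k j * g j) = b k)"
  using assms(1) pd
proof (induction K arbitrary: b)
  case empty
  then show ?case by auto
next
  case (insert m K)
  have pdK: "0 < (\<Sum>j\<in>K. \<Sum>l\<in>K. w j * S j l * w l)" if "\<exists>j\<in>K. w j \<noteq> 0" for w
  proof -
    define w' where "w' j = (if j \<in> K then w j else 0)" for j
    have "0 < (\<Sum>j\<in>insert m K. \<Sum>l\<in>insert m K. w' j * S j l * w' l)"
      using that by (intro insert.prems) (auto simp: w'_def)
    also have "\<dots> = (\<Sum>j\<in>K. \<Sum>l\<in>K. w j * S j l * w l)"
      using insert.hyps by (simp add: w'_def cong: sum.cong)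
    finally show ?thesis .
  qed
  obtain h where h: "\<And>k. k \<in> K \<Longrightarrow> (\<Sum>j\<in>K. S k j * h j) = S k m"
    using insert.IH[OF pdK, of "\<lambda>k. S k m"] by blast
  obtain g where g: "\<And>k. k \<in> K \<Longrightarrow> (\<Sum>j\<in>K. S k j * g j) = b k"
    using insert.IH[OF pdK, of b] by blast
  define s where "s = S m m - (\<Sum>j\<in>K. S m j * h j)"
  define w where "w j = (if j = m then 1 else - h j)" for j
  have Kw: "j \<in> K \<Longrightarrow> w j = - h j" for j using insert.hyps by (auto simp: w_def)
  have row: "(\<Sum>l\<in>insert m K. S k l * w l) = (if k = m then s else 0)" if "k \<in> insert m K" for k
  proof -
    have "(\<Sum>l\<in>insert m K. S k l * w l) = S k m - (\<Sum>l\<in>K. S k l * h l)"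
      using insert.hyps by (simp add: Kw sum_negf w_def[of m])
    then show ?thesis using that h by (auto simp: s_def)
  qed
  have "0 < (\<Sum>j\<in>insert m K. \<Sum>l\<in>insert m K. w j * S j l * w l)"
    by (intro insert.prems) (auto simp: w_def)
  also have "\<dots> = (\<Sum>j\<in>insert m K. w j * (\<Sum>l\<in>insert m K. S j l * w l))"
    by (simp only: sum_distrib_left mult.assoc)
  also have "\<dots> = (\<Sum>j\<in>insert m K. w j * (if j = m then s else 0))"
    by (intro sum.cong refl arg_cong2[where f="(*)"] row)
  also have "\<dots> = s" using insert.hyps by (simp add: w_def if_distrib cong: if_cong)
  finally have s: "s > 0" .
  \<comment> \<open>\<open>g' = g + c * w\<close> keeps the old equations because \<open>w\<close>
    is mapped to 0 there, and \<open>c\<close> is fitted to equation \<open>m\<close>.\<close>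
  define c where "c = (b m - (\<Sum>j\<in>K. S m j * g j)) / s"
  define g' where "g' j = (if j = m then c else if j \<in> K then g j - c * h j else 0)" for j
  have sK: "(\<Sum>j\<in>K. S k j * g' j) = (\<Sum>j\<in>K. S k j * g j) - c * (\<Sum>j\<in>K. S k j * h j)" for k
  proof -
    have "(\<Sum>j\<in>K. S k j * g' j) = (\<Sum>j\<in>K. S k j * g j - c * (S k j * h j))"
      using insert.hyps by (intro sum.cong) (auto simp: g'_def algebra_simps)
    then show ?thesis by (simp add: sum_subtractf sum_distrib_left)
  qed
  have "(\<Sum>j\<in>insert m K. S k j * g' j) = b k" if "k \<in> insert m K" for k
  proof -
    have "(\<Sum>j\<in>insert m K. S k j * g' j) = S k m * c + (\<Sum>j\<in>K. S k j * g j) - c * (\<Sum>j\<in>K. S k j * h j)"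
      using insert.hyps sK by (simp add: g'_def[of m])
    also have "\<dots> = b k"
    proof (cases "k = m")
      case True
      have "S m m * c + (\<Sum>j\<in>K. S m j * g j) - c * (\<Sum>j\<in>K. S m j * h j) = c * s + (\<Sum>j\<in>K. S m j * g j)"
        by (simp add: s_def algebra_simps)
      then show ?thesis using True s by (simp add: c_def)
    next
      case False
      then show ?thesis using that h g by simp
    qed
    finally show ?thesis .
  qed
  then show ?case by (intro exI[of _ g']) (auto simp: g'_def)
qed

text \<open>The property holds on some measurable event whose complement has probability at most
  \<open>d\<close>. It need not be measurable itself, so deterministic inequalities can be applied
  pointwise without discussing the events they describe.\<close>

definition likely :: "'a measure \<Rightarrow> real \<Rightarrow> ('a \<Rightarrow> bool) \<Rightarrow> bool" where
  "likely M d Q \<longleftrightarrow> (\<exists>A\<in>sets M. measure M (space M - A) \<le> d \<and> (\<forall>\<omega>\<in>A. Q \<omega>))"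

context prob_space
begin

lemma likelyI:
  assumes "{\<omega> \<in> space M. R \<omega>} \<in> sets M" "prob {\<omega> \<in> space M. R \<omega>} \<le> d"
  shows "likely M d (\<lambda>\<omega>. \<not> R \<omega>)"
proof -
  have "space M - (space M - {\<omega> \<in> space M. R \<omega>}) = {\<omega> \<in> space M. R \<omega>}" by auto
  then show ?thesis unfolding likely_def using assms
    by (intro bexI[of _ "space M - {\<omega> \<in> space M. R \<omega>}"]) auto
qed

lemma likely_mono:
  assumes "likely M d Q" "\<And>\<omega>. \<omega> \<in> space M \<Longrightarrow> Q \<omega> \<Longrightarrow> R \<omega>" "d \<le> e"
  shows "likely M e R"
  using assms sets.sets_into_space unfolding likely_def by (meson order_trans subsetD)

lemma likely_conj:
  assumes "likely M d Q" "likely M e R"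
  shows "likely M (d + e) (\<lambda>\<omega>. Q \<omega> \<and> R \<omega>)"
proof -
  obtain A where A: "A \<in> sets M" "prob (space M - A) \<le> d" "\<forall>\<omega>\<in>A. Q \<omega>" using assms(1) unfolding likely_def by auto
  obtain B where B: "B \<in> sets M" "prob (space M - B) \<le> e" "\<forall>\<omega>\<in>B. R \<omega>" using assms(2) unfolding likely_def by auto
  have "prob (space M - A \<inter> B) \<le> prob (space M - A) + prob (space M - B)"
    using A B by (subst Diff_Int) (intro measure_Un_le; auto)
  then show ?thesis unfolding likely_def using A B by (intro bexI[of _ "A \<inter> B"]) auto
qed

lemma likely_ball:
  assumes "finite F" "\<And>k. k \<in> F \<Longrightarrow> likely M d (Q k)"
  shows "likely M (real (card F) * d) (\<lambda>\<omega>. \<forall>k\<in>F. Q k \<omega>)"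
  using assms
proof (induction F)
  case empty
  then show ?case unfolding likely_def by (intro bexI[of _ "space M"]) auto
next
  case (insert k F)
  have "likely M (d + real (card F) * d) (\<lambda>\<omega>. Q k \<omega> \<and> (\<forall>k\<in>F. Q k \<omega>))"
    by (intro likely_conj insert) auto
  then show ?case
    by (rule likely_mono) (use insert.hyps in \<open>auto simp: algebra_simps\<close>)
qed

lemma likely_prob_le:
  assumes "likely M d Q" "\<And>\<omega>. \<omega> \<in> space M \<Longrightarrow> Q \<omega> \<Longrightarrow> \<not> R \<omega>"
  shows "prob {\<omega> \<in> space M. R \<omega>} \<le> d"
proof -
  obtain A where A: "A \<in> sets M" "prob (space M - A) \<le> d" "\<forall>\<omega>\<in>A. Q \<omega>" using assms(1) unfolding likely_def by auto
  have "prob {\<omega> \<in> space M. R \<omega>} \<le> prob (space M - A)"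
    using A assms(2) by (intro finite_measure_mono) auto
  then show ?thesis using A by simp
qed

text \<open>The one-sided comparison behind the Slutsky argument: \<open>R\<close> and
  \<open>R'\<close> will be events for two statistics that are close on the likely event, with
  thresholds shifted accordingly.\<close>

lemma likely_prob_le_add:
  assumes "likely M d Q" "\<And>\<omega>. \<omega> \<in> space M \<Longrightarrow> Q \<omega> \<Longrightarrow> R \<omega> \<Longrightarrow> R' \<omega>" "{\<omega> \<in> space M. R' \<omega>} \<in> sets M"
  shows "prob {\<omega> \<in> space M. R \<omega>} \<le> prob {\<omega> \<in> space M. R' \<omega>} + d"
proof -
  obtain A where A: "A \<in> sets M" "prob (space M - A) \<le> d" "\<forall>\<omega>\<in>A. Q \<omega>" using assms(1) unfolding likely_def by auto
  have "prob {\<omega> \<in> space M. R \<omega>} \<le> prob ({\<omega> \<in> space M. R' \<omega>} \<union> (space M - A))"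
    using A assms by (intro finite_measure_mono) auto
  also have "\<dots> \<le> prob {\<omega> \<in> space M. R' \<omega>} + prob (space M - A)"
    using A assms(3) by (intro measure_Un_le) auto
  finally show ?thesis using A by simp
qed

end

section \<open>Residuals and single columns as row combinations\<close>

definition resid_coeff :: "(nat \<Rightarrow> real) \<Rightarrow> nat \<Rightarrow> real" where
  "resid_coeff c j = (if j = 0 then 1 else - c j)"

definition unit_coeff :: "nat \<Rightarrow> nat \<Rightarrow> real" where
  "unit_coeff k j = (if j = k then 1 else 0)"

lemma sum_split_0: "0 < p \<Longrightarrow> (\<Sum>j<p. f j) = f 0 + (\<Sum>j\<in>{1..<p}. f j)" for f :: "nat \<Rightarrow> real"
  by (simp add: lessThan_atLeast0 sum.atLeast_Suc_lessThan)

lemma rowcomb_resid_coeff: "0 < p \<Longrightarrow> rowcomb p x (resid_coeff c) = resid p x c"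
  unfolding rowcomb_def fun_eq_iff resid_def fit_def
  by (auto simp: sum_split_0 resid_coeff_def sum_negf[symmetric] intro!: sum.cong)

lemma rowcomb_unit_coeff: "k < p \<Longrightarrow> rowcomb p x (unit_coeff k) = (\<lambda>i. x i k)"
  unfolding rowcomb_def fun_eq_iff unit_coeff_def by (simp add: if_distrib cong: if_cong)

lemma qform_unit_left: "k < p \<Longrightarrow> qform p S (unit_coeff k) b = (\<Sum>l<p. S k l * b l)"
proof -
  assume k: "k < p"
  have "qform p S (unit_coeff k) b = (\<Sum>j<p. if j = k then (\<Sum>l<p. S j l * b l) else 0)"
    unfolding qform_def unit_coeff_def by (intro sum.cong) (auto simp: sum_distrib_left)
  then show ?thesis using k by simp
qed

lemma qform_expand: "qform p S a b = (\<Sum>j<p. a j * qform p S (unit_coeff j) b)"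
  by (simp add: qform_unit_left) (simp add: qform_def sum_distrib_left mult.assoc)

lemma qform_unit_resid:
  assumes "k < p"
  shows "qform p S (unit_coeff k) (resid_coeff c) = S k 0 - (\<Sum>j\<in>{1..<p}. S k j * c j)"
proof -
  have "(\<Sum>j\<in>{1..<p}. S k j * resid_coeff c j) = - (\<Sum>j\<in>{1..<p}. S k j * c j)"
    unfolding sum_negf[symmetric] by (intro sum.cong) (auto simp: resid_coeff_def)
  moreover have "resid_coeff c 0 = 1" by (simp add: resid_coeff_def)
  ultimately show ?thesis
    using assms by (simp add: qform_unit_left sum_split_0)
qed

lemma abs_add_le: "x = a + b \<Longrightarrow> \<bar>a\<bar> \<le> A \<Longrightarrow> \<bar>b\<bar> \<le> B \<Longrightarrow> \<bar>x\<bar> \<le> A + B" for x a b A B :: real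
  by linarith

lemma abs_polarization_le: "\<bar>a\<bar> < 2 * c \<Longrightarrow> \<bar>b\<bar> < 2 * c \<Longrightarrow> x = (a - b) / 4 \<Longrightarrow> \<bar>x\<bar> \<le> c" for x a b c :: real
  by (simp add: abs_le_iff abs_less_iff)

lemma sqnorm_eq_0: "sqnorm n r = 0 \<Longrightarrow> i < n \<Longrightarrow> r i = 0"
  unfolding sqnorm_def by (subst (asm) sum_nonneg_eq_0_iff) auto

context gaussian_design
begin

text \<open>\<open>gamma0\<close> is a definite description, so the equations hold once existence
  and uniqueness are known; both follow from positive definiteness of the block without index 0. The
  requirement of zeros outside the index range makes the solution unique as a function.\<close>

lemma gamma0_normal_equations:
  assumes "k \<in> {1..<p}"
  shows "(\<Sum>j\<in>{1..<p}. S k j * gamma0 p S j) = S k 0"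
proof -
  have pd: "0 < (\<Sum>j\<in>{1..<p}. \<Sum>l\<in>{1..<p}. w j * S j l * w l)" if "\<exists>j\<in>{1..<p}. w j \<noteq> 0" for w
  proof -
    define w' where "w' j = (if j = 0 then 0 else w j)" for j
    from that obtain j where "j \<in> {1..<p}" "w j \<noteq> 0" by blast
    then have "\<exists>j<p. w' j \<noteq> 0" by (intro exI[of _ j]) (simp add: w'_def)
    then have "0 < qform p S w' w'" by (rule S_pd)
    also have "qform p S w' w' = (\<Sum>j\<in>{1..<p}. \<Sum>l\<in>{1..<p}. w' j * S j l * w' l)"
    proof -
      have "0 < p" "w' 0 = 0" using p_ge2 by (auto simp: w'_def)
      then show ?thesis unfolding qform_def sum_split_0[OF \<open>0 < p\<close>]
        by (simp only: mult_zero_left mult_zero_right sum.neutral_const add_0_left)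
    qed
    also have "\<dots> = (\<Sum>j\<in>{1..<p}. \<Sum>l\<in>{1..<p}. w j * S j l * w l)"
      by (intro sum.cong) (auto simp: w'_def)
    finally show ?thesis .
  qed
  let ?P = "\<lambda>g. (\<forall>j. j \<notin> {1..<p} \<longrightarrow> g j = 0) \<and> (\<forall>k\<in>{1..<p}. (\<Sum>j\<in>{1..<p}. S k j * g j) = S k 0)"
  have "\<exists>!g. ?P g"
  proof (rule ex_ex1I)
    show "\<exists>g. ?P g" by (rule solvable_of_pos_def[OF _ S_sym pd]) auto
    fix g h assume g: "?P g" and h: "?P h"
    have "g j = h j" if j: "j \<in> {1..<p}" for j
    proof (rule ccontr)
      assume "g j \<noteq> h j"
      then have "0 < (\<Sum>j\<in>{1..<p}. \<Sum>l\<in>{1..<p}. (g j - h j) * S j l * (g l - h l))"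
        using j by (intro pd[of "\<lambda>j. g j - h j"]) auto
      also have "\<dots> = (\<Sum>j\<in>{1..<p}. (g j - h j) * ((\<Sum>l\<in>{1..<p}. S j l * g l) - (\<Sum>l\<in>{1..<p}. S j l * h l)))"
      proof (intro sum.cong refl)
        fix j
        show "(\<Sum>l\<in>{1..<p}. (g j - h j) * S j l * (g l - h l)) = (g j - h j) * ((\<Sum>l\<in>{1..<p}. S j l * g l) - (\<Sum>l\<in>{1..<p}. S j l * h l))"
          unfolding sum_subtractf[symmetric] sum_distrib_left by (intro sum.cong) (auto simp: algebra_simps)
      qed
      also have "\<dots> = 0" using g h by (intro sum.neutral) simp
      finally show False by simp
    qed
    then show "g = h" using g h by (intro ext) metis
  qed
  from theI'[OF this] show ?thesis using assms unfolding gamma0_def by blast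
qed

lemma p_pos: "0 < p" using p_ge2 by simp

lemma likely_sqnorm:
  assumes "\<eta> > 0"
  shows "likely M (2 * (qform p S w w)\<^sup>2 / (real n * \<eta>\<^sup>2)) (\<lambda>\<omega>. \<bar>sqnorm n (rowcomb p (X \<omega>) w) / n - qform p S w w\<bar> < \<eta>)"
proof -
  define f where "f \<omega> = sqnorm n (rowcomb p (X \<omega>) w)" for \<omega>
  have f[measurable]: "f \<in> borel_measurable M"
    unfolding f_def sqnorm_def by (intro borel_measurable_sum borel_measurable_power Z_measurable) auto
  have "{\<omega> \<in> space M. \<eta> \<le> \<bar>f \<omega> / real n - qform p S w w\<bar>} \<in> sets M" by measurable
  from likelyI[OF this sqnorm_concentration[OF assms, of w, folded f_def]] show ?thesis
    unfolding f_def[symmetric] by (rule likely_mono) (simp_all only: not_le order_refl)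
qed

text \<open>Polarisation reduces inner products of columns to mean squares of their sum and
  difference. The two variances \<open>2 + 2 * S j k\<close> and \<open>2 - 2 * S j k\<close> are
  nonnegative and add up to 4, so Chebyshev with deviation \<open>2 * \<kappa>\<close> costs
  \<open>8 / (n * \<kappa>\<^sup>2)\<close> for each, and there are \<open>p\<^sup>2\<close>
  pairs.\<close>

lemma likely_gram:
  assumes \<kappa>: "\<kappa> > 0"
  shows "likely M (16 * (real p)\<^sup>2 / (real n * \<kappa>\<^sup>2))
    (\<lambda>\<omega>. \<forall>j<p. \<forall>k<p. \<bar>inner_upto n (\<lambda>i. X \<omega> i j) (\<lambda>i. X \<omega> i k) / n - S j k\<bar> \<le> \<kappa>)"
proof -
  have one: "likely M (16 / (real n * \<kappa>\<^sup>2)) (\<lambda>\<omega>. \<bar>inner_upto n (\<lambda>i. X \<omega> i j) (\<lambda>i. X \<omega> i k) / n - S j k\<bar> \<le> \<kappa>)"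
    if jk: "j < p" "k < p" for j k
  proof -
    define a where "a = (\<lambda>i. unit_coeff j i + unit_coeff k i)"
    define b where "b = (\<lambda>i. unit_coeff j i + (-1) * unit_coeff k i)"
    have e: "qform p S (unit_coeff j) (unit_coeff j) = 1" "qform p S (unit_coeff k) (unit_coeff k) = 1"
        "qform p S (unit_coeff j) (unit_coeff k) = S j k" "qform p S (unit_coeff k) (unit_coeff j) = S j k"
      using jk S_sym[of k j] by (simp_all add: qform_unit_left unit_coeff_def if_distrib S_diag cong: if_cong)
    have qa: "qform p S a a = 2 + 2 * S j k"
      unfolding a_def qform_add_left qform_add_right e by simp
    have qb: "qform p S b b = 2 - 2 * S j k"
      unfolding b_def qform_add_left qform_add_right qform_scale_left qform_scale_right e by simp
    have q4: "(qform p S a a)\<^sup>2 \<le> 4\<^sup>2" "(qform p S b b)\<^sup>2 \<le> 4\<^sup>2"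
    proof -
      have "qform p S a a \<le> 4" "qform p S b b \<le> 4"
        using qform_nonneg[of a] qform_nonneg[of b] qa qb by linarith+
      then show "(qform p S a a)\<^sup>2 \<le> 4\<^sup>2" "(qform p S b b)\<^sup>2 \<le> 4\<^sup>2"
        by (intro power_mono qform_nonneg; simp)+
    qed
    have "likely M (8 / (real n * \<kappa>\<^sup>2)) (\<lambda>\<omega>. \<bar>sqnorm n (rowcomb p (X \<omega>) w) / n - qform p S w w\<bar> < 2 * \<kappa>)"
      if "(qform p S w w)\<^sup>2 \<le> 4\<^sup>2" for w
    proof (rule likely_mono[OF likely_sqnorm])
      have "2 * (qform p S w w)\<^sup>2 / (real n * (2 * \<kappa>)\<^sup>2) \<le> 2 * 4\<^sup>2 / (real n * (2 * \<kappa>)\<^sup>2)"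
        using that by (intro divide_right_mono) auto
      also have "\<dots> = 8 / (real n * \<kappa>\<^sup>2)" by (simp add: power_mult_distrib)
      finally show "2 * (qform p S w w)\<^sup>2 / (real n * (2 * \<kappa>)\<^sup>2) \<le> 8 / (real n * \<kappa>\<^sup>2)" .
    qed (use \<kappa> in auto)
    from likely_conj[OF this[OF q4(1)] this[OF q4(2)]] show ?thesis
    proof (rule likely_mono)
      fix \<omega>
      have pol: "inner_upto n (\<lambda>i. X \<omega> i j) (\<lambda>i. X \<omega> i k) = (sqnorm n (rowcomb p (X \<omega>) a) - sqnorm n (rowcomb p (X \<omega>) b)) / 4"
      proof -
        have "rowcomb p (X \<omega>) a i = X \<omega> i j + X \<omega> i k" "rowcomb p (X \<omega>) b i = X \<omega> i j - X \<omega> i k" for i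
          unfolding a_def b_def rowcomb_add rowcomb_scale using jk by (simp_all add: rowcomb_unit_coeff)
        note Zab = this
        show ?thesis unfolding sqnorm_def inner_upto_def sum_subtractf[symmetric] sum_divide_distrib Zab
          by (intro sum.cong) (auto simp: power2_eq_square algebra_simps)
      qed
      assume "\<bar>sqnorm n (rowcomb p (X \<omega>) a) / n - qform p S a a\<bar> < 2 * \<kappa> \<and> \<bar>sqnorm n (rowcomb p (X \<omega>) b) / n - qform p S b b\<bar> < 2 * \<kappa>"
      moreover have "inner_upto n (\<lambda>i. X \<omega> i j) (\<lambda>i. X \<omega> i k) / n - S j k =
        ((sqnorm n (rowcomb p (X \<omega>) a) / n - qform p S a a) - (sqnorm n (rowcomb p (X \<omega>) b) / n - qform p S b b)) / 4"
        unfolding pol qa qb by (simp add: diff_divide_distrib)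
      ultimately show "\<bar>inner_upto n (\<lambda>i. X \<omega> i j) (\<lambda>i. X \<omega> i k) / n - S j k\<bar> \<le> \<kappa>"
        using abs_polarization_le by blast
    qed simp
  qed
  have "likely M (card ({..<p} \<times> {..<p}) * (16 / (real n * \<kappa>\<^sup>2)))
    (\<lambda>\<omega>. \<forall>q\<in>{..<p} \<times> {..<p}. \<bar>inner_upto n (\<lambda>i. X \<omega> i (fst q)) (\<lambda>i. X \<omega> i (snd q)) / n - S (fst q) (snd q)\<bar> \<le> \<kappa>)"
    by (rule likely_ball) (auto intro!: one)
  then show ?thesis
    by (rule likely_mono) (auto simp: power2_eq_square mult_ac)
qed

section \<open>Variance and noise level of the residual at an eligible vector\<close>

context
  fixes c :: "nat \<Rightarrow> real" and l L :: real
  assumes elig: "\<And>k. k \<in> {1..<p} \<Longrightarrow> \<bar>qform p S (unit_coeff k) (resid_coeff c)\<bar> \<le> l"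
    and ray: "\<And>v. L * (\<Sum>j<p. (v j)\<^sup>2) \<le> qform p S v v" and L_pos: "L > 0"
begin

text \<open>The law of large numbers produces \<open>tau2\<close>, the variance of the population
  residual of \<open>c\<close>; the limit asked for is \<open>tauS\<close>, its covariance with the
  first variable. They coincide at \<open>gamma0\<close> and differ by the eligibility error
  otherwise.\<close>

abbreviation (input) "tau2 \<equiv> qform p S (resid_coeff c) (resid_coeff c)"
abbreviation (input) "tauS \<equiv> qform p S (unit_coeff 0) (resid_coeff c)"

lemma abs_sum_elig: "\<bar>\<Sum>k\<in>{1..<p}. c k * qform p S (unit_coeff k) (resid_coeff c)\<bar> \<le> l * l1norm p c"
proof -
  have "\<bar>\<Sum>k\<in>{1..<p}. c k * qform p S (unit_coeff k) (resid_coeff c)\<bar> \<le> (\<Sum>k\<in>{1..<p}. \<bar>c k\<bar> * l)"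
    using elig by (intro order_trans[OF sum_abs] sum_mono) (auto simp: abs_mult intro!: mult_left_mono)
  then show ?thesis by (simp add: l1norm_def sum_distrib_left mult.commute)
qed

lemma tau2_tauS: "\<bar>tau2 - tauS\<bar> \<le> l * l1norm p c"
proof -
  have "tau2 = tauS + (\<Sum>k\<in>{1..<p}. resid_coeff c k * qform p S (unit_coeff k) (resid_coeff c))"
    by (subst qform_expand, subst sum_split_0[OF p_pos]) (simp add: resid_coeff_def[of c 0])
  also have "(\<Sum>k\<in>{1..<p}. resid_coeff c k * qform p S (unit_coeff k) (resid_coeff c)) =
      - (\<Sum>k\<in>{1..<p}. c k * qform p S (unit_coeff k) (resid_coeff c))"
    unfolding sum_negf[symmetric] by (intro sum.cong) (auto simp: resid_coeff_def)
  finally show ?thesis using abs_sum_elig by simp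
qed

lemma tau2_ge: "L \<le> tau2"
proof -
  have "1 \<le> (\<Sum>j<p. (resid_coeff c j)\<^sup>2)"
    unfolding sum_split_0[OF p_pos] by (auto simp: resid_coeff_def[of c 0] intro!: sum_nonneg)
  then have "L * 1 \<le> L * (\<Sum>j<p. (resid_coeff c j)\<^sup>2)" using L_pos by (intro mult_left_mono) auto
  then show ?thesis using ray[of "resid_coeff c"] by simp
qed

text \<open>\<open>1 - tauS\<close> is the inner product of \<open>c\<close> with the covariances to
  the first variable. Up to the eligibility error this is the quadratic form of \<open>c\<close>,
  which is nonnegative.\<close>

lemma tauS_le: "tauS \<le> 1 + l * l1norm p c"
proof -
  define w where "w j = (if j = 0 then 0 else c j)" for j
  have u: "qform p S (unit_coeff k) w = S k 0 - qform p S (unit_coeff k) (resid_coeff c)" if "k < p" for k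
  proof -
    have "(\<Sum>j\<in>{1..<p}. S k j * w j) = (\<Sum>j\<in>{1..<p}. S k j * c j)"
      by (intro sum.cong) (auto simp: w_def)
    then have "qform p S (unit_coeff k) w = (\<Sum>j\<in>{1..<p}. S k j * c j)"
      unfolding qform_unit_left[OF that] sum_split_0[OF p_pos] by (simp add: w_def[of 0])
    then show ?thesis unfolding qform_unit_resid[OF that] by simp
  qed
  have "0 \<le> qform p S w w" by (rule qform_nonneg)
  also have "\<dots> = (\<Sum>k\<in>{1..<p}. w k * qform p S (unit_coeff k) w)"
    by (subst qform_expand, subst sum_split_0[OF p_pos]) (simp add: w_def[of 0])
  also have "\<dots> = (\<Sum>k\<in>{1..<p}. c k * S k 0) - (\<Sum>k\<in>{1..<p}. c k * qform p S (unit_coeff k) (resid_coeff c))"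
    unfolding sum_subtractf[symmetric] by (intro sum.cong) (auto simp: u w_def algebra_simps)
  finally have "- (l * l1norm p c) \<le> (\<Sum>k\<in>{1..<p}. c k * S k 0)" using abs_sum_elig by linarith
  also have "\<dots> = 1 - tauS"
  proof -
    have "(\<Sum>k\<in>{1..<p}. S 0 k * c k) = (\<Sum>k\<in>{1..<p}. c k * S k 0)"
      by (intro sum.cong refl) (metis S_sym mult.commute)
    then show ?thesis unfolding qform_unit_resid[OF p_pos] S_diag[OF p_pos] by simp
  qed
  finally show ?thesis by simp
qed

abbreviation (input) "U \<omega> \<equiv> resid p (X \<omega>) c"

text \<open>Decompose the \<open>k\<close>-th column as \<open>(d\<^sub>k / \<tau>\<^sup>2) U + W\<^sub>k\<close> with \<open>W\<^sub>k\<close> independent of \<open>U\<close>; the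
  self-normalised product \<open>U\<^sup>T W\<^sub>k / \<parallel>U\<parallel>\<close> is then exactly Gaussian, so the bound below needs no
  restriction on the growth of \<open>p\<close>.\<close>

lemma likely_cross:
  assumes k: "k \<in> {1..<p}" and t: "0 \<le> t"
  shows "likely M (2 * exp (- t\<^sup>2 / 2)) (\<lambda>\<omega>. sqnorm n (U \<omega>) / n < 2 * tau2 \<longrightarrow>
    \<bar>inner_upto n (U \<omega>) (\<lambda>i. X \<omega> i k)\<bar> \<le> n * (2 * l + t * sqrt (2 * tau2 / n)))"
proof -
  let ?u = "resid_coeff c"
  define d where "d = qform p S (unit_coeff k) ?u"
  have t2: "tau2 > 0" using tau2_ge L_pos by linarith
  define w where "w j = unit_coeff k j + (- d / tau2) * ?u j" for j
  have du: "qform p S ?u (unit_coeff k) = d" by (simp add: d_def qform_sym)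
  have w_eq: "w = (\<lambda>j. unit_coeff k j + (- d / tau2) * ?u j)" by (simp add: fun_eq_iff w_def)
  have orth: "qform p S ?u w = 0"
    unfolding w_eq qform_add_right qform_scale_right using t2 du by simp
  have "qform p S w w = qform p S (unit_coeff k) w + (- d / tau2) * qform p S ?u w"
  proof -
    have "qform p S w b = qform p S (unit_coeff k) b + (- d / tau2) * qform p S ?u b" for b
      unfolding w_eq qform_add_left qform_scale_left ..
    then show ?thesis .
  qed
  also have "\<dots> = qform p S (unit_coeff k) (unit_coeff k) + (- d / tau2) * d"
    unfolding orth unfolding w_eq qform_add_right qform_scale_right d_def by simp
  also have "qform p S (unit_coeff k) (unit_coeff k) = 1"
    using k qform_unit_left[of k p S "unit_coeff k"] by (simp add: unit_coeff_def if_distrib S_diag cong: if_cong)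
  finally have ww: "qform p S w w = 1 - d * d / tau2" by simp
  have v1: "qform p S w w \<le> 1" unfolding ww using t2 by simp
  \<comment> \<open>Nondegeneracy of \<open>w\<close>: its entry at index 0 is
    \<open>- d / tau2\<close>, and if \<open>d = 0\<close> its entry at \<open>k\<close> is
    1.\<close>
  have v0: "0 < qform p S w w"
  proof (rule S_pd)
    show "\<exists>j<p. w j \<noteq> 0"
    proof (cases "d = 0")
      case True
      then show ?thesis using k by (intro exI[of _ k]) (auto simp: w_def unit_coeff_def)
    next
      case False
      then show ?thesis using k t2 by (intro exI[of _ 0]) (auto simp: w_def unit_coeff_def resid_coeff_def)
    qed
  qed
  define T where "T \<omega> = inner_upto n (normalized n (rowcomb p (X \<omega>) ?u)) (rowcomb p (X \<omega>) w)" for \<omega>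
  have dT: "distributed M lborel T (normal_density 0 (sqrt (qform p S w w)))"
    unfolding T_def using distr_self_normalized[OF orth refl v0] .
  have [measurable]: "T \<in> borel_measurable M" using distributed_measurable[OF dT] by simp
  have "likely M (2 * exp (- t\<^sup>2 / 2)) (\<lambda>\<omega>. \<not> \<bar>T \<omega>\<bar> > t)"
    by (rule likelyI[OF _ normal_tail[OF dT]]) (use v0 v1 t in auto)
  then show ?thesis
  proof (rule likely_mono)
    fix \<omega> assume T: "\<not> \<bar>T \<omega>\<bar> > t"
    show "sqnorm n (U \<omega>) / n < 2 * tau2 \<longrightarrow>
      \<bar>inner_upto n (U \<omega>) (\<lambda>i. X \<omega> i k)\<bar> \<le> n * (2 * l + t * sqrt (2 * tau2 / n))"
    proof
      assume s: "sqnorm n (U \<omega>) / n < 2 * tau2"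
      have Ue: "rowcomb p (X \<omega>) ?u = U \<omega>" by (rule rowcomb_resid_coeff[OF p_pos])
      have dl: "\<bar>d\<bar> \<le> l" unfolding d_def by (rule elig[OF k])
      have sn: "sqnorm n (U \<omega>) \<le> n * (2 * tau2)" using s n_pos by (simp add: field_simps)
      have col: "X \<omega> i k = d / tau2 * U \<omega> i + rowcomb p (X \<omega>) w i" for i
        unfolding w_eq rowcomb_add rowcomb_scale Ue using k by (simp add: rowcomb_unit_coeff)
      have "inner_upto n (U \<omega>) (\<lambda>i. X \<omega> i k) = d / tau2 * sqnorm n (U \<omega>) + inner_upto n (U \<omega>) (rowcomb p (X \<omega>) w)"
        unfolding col by (simp add: inner_upto_def sqnorm_def power2_eq_square algebra_simps sum.distrib sum_distrib_left)
      \<comment> \<open>The systematic part: eligibility bounds \<open>d\<close> by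
        \<open>l\<close>, and the premise on the mean square cancels \<open>tau2\<close> up to the
        factor 2.\<close>
      moreover have "\<bar>d / tau2 * sqnorm n (U \<omega>)\<bar> \<le> n * (2 * l)"
      proof -
        have "\<bar>d / tau2 * sqnorm n (U \<omega>)\<bar> = \<bar>d\<bar> / tau2 * sqnorm n (U \<omega>)" using t2 by (simp add: abs_mult)
        also have "\<dots> \<le> l / tau2 * (n * (2 * tau2))"
          using dl sn t2 by (intro mult_mono divide_right_mono) auto
        also have "\<dots> = n * (2 * l)" using t2 by simp
        finally show ?thesis .
      qed
      moreover have "\<bar>inner_upto n (U \<omega>) (rowcomb p (X \<omega>) w)\<bar> \<le> n * (t * sqrt (2 * tau2 / n))"
      proof (cases "sqnorm n (U \<omega>) = 0")
        case True
        then have "inner_upto n (U \<omega>) (rowcomb p (X \<omega>) w) = 0"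
          unfolding inner_upto_def by (intro sum.neutral) (auto dest: sqnorm_eq_0)
        then show ?thesis using t t2 by simp
      next
        case False
        then have "sqnorm n (U \<omega>) > 0" using sqnorm_nonneg[of n "U \<omega>"] by linarith
        then have "inner_upto n (U \<omega>) (rowcomb p (X \<omega>) w) = T \<omega> * sqrt (sqnorm n (U \<omega>))"
          using False by (simp add: T_def inner_normalized Ue)
        also have "\<bar>\<dots>\<bar> \<le> t * sqrt (n * (2 * tau2))"
          unfolding abs_mult using T sn t by (intro mult_mono) auto
        also have "sqrt (n * (2 * tau2)) = n * sqrt (2 * tau2 / n)"
        proof -
          have "n * (2 * tau2) = (real n)\<^sup>2 * (2 * tau2 / n)" using n_pos by (simp add: power2_eq_square)
          then show ?thesis by (simp only: real_sqrt_mult) simp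
        qed
        finally show ?thesis by (simp add: mult_ac)
      qed
      ultimately show "\<bar>inner_upto n (U \<omega>) (\<lambda>i. X \<omega> i k)\<bar> \<le> n * (2 * l + t * sqrt (2 * tau2 / n))"
        unfolding distrib_left by (rule abs_add_le)
    qed
  qed simp
qed

lemma likely_cross_all:
  assumes \<delta>: "0 < \<delta>" "\<delta> \<le> 1" and \<eta>: "0 < \<eta>" "\<eta> \<le> tau2" and t2: "tau2 \<le> 2"
  shows "likely M (\<delta> + 8 / (real n * \<eta>\<^sup>2)) (\<lambda>\<omega>. \<bar>sqnorm n (U \<omega>) / n - tau2\<bar> < \<eta> \<and>
    (\<forall>k\<in>{1..<p}. \<bar>inner_upto n (U \<omega>) (\<lambda>i. X \<omega> i k)\<bar> \<le> n * (2 * l + 2 * sqrt (2 * ln (2 * p / \<delta>)) / sqrt n)))"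
proof -
  \<comment> \<open>Chosen so that \<open>2 * exp (- t\<^sup>2 / 2) = \<delta> / p\<close>; the
    union over \<open>p - 1\<close> columns then costs at most \<open>\<delta>\<close>.\<close>
  define t where "t = sqrt (2 * ln (2 * p / \<delta>))"
  have tau0: "0 < tau2" using tau2_ge L_pos by linarith
  have "1 \<le> 2 * p / \<delta>" using \<delta> p_ge2 by (simp add: field_simps)
  then have t0: "0 \<le> 2 * ln (2 * p / \<delta>)" by simp
  then have t: "0 \<le> t" unfolding t_def by simp
  have "t\<^sup>2 / 2 = ln (2 * p / \<delta>)" unfolding t_def using t0 by simp
  then have "exp (- t\<^sup>2 / 2) = inverse (2 * p / \<delta>)"
    using \<delta> p_ge2 by (simp add: exp_minus)
  then have pr: "card {1..<p} * (2 * exp (- t\<^sup>2 / 2)) \<le> \<delta>"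
    using \<delta> p_ge2 by (simp add: field_simps)
  have "likely M (2 * tau2\<^sup>2 / (real n * \<eta>\<^sup>2)) (\<lambda>\<omega>. \<bar>sqnorm n (rowcomb p (X \<omega>) (resid_coeff c)) / n - tau2\<bar> < \<eta>)"
    by (rule likely_sqnorm[OF \<eta>(1)])
  then have 1: "likely M (8 / (real n * \<eta>\<^sup>2)) (\<lambda>\<omega>. \<bar>sqnorm n (U \<omega>) / n - tau2\<bar> < \<eta>)"
  proof (rule likely_mono)
    have "tau2\<^sup>2 \<le> 2\<^sup>2" using t2 tau0 by (intro power_mono) auto
    then show "2 * tau2\<^sup>2 / (real n * \<eta>\<^sup>2) \<le> 8 / (real n * \<eta>\<^sup>2)" using n_pos \<eta> by (intro divide_right_mono) auto
  qed (simp add: rowcomb_resid_coeff[OF p_pos])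
  \<comment> \<open>The bound on the norm of \<open>U\<close> stays a premise here, so that its
    failure probability is paid once and not for every column.\<close>
  have 2: "likely M \<delta> (\<lambda>\<omega>. \<forall>k\<in>{1..<p}. sqnorm n (U \<omega>) / n < 2 * tau2 \<longrightarrow>
    \<bar>inner_upto n (U \<omega>) (\<lambda>i. X \<omega> i k)\<bar> \<le> n * (2 * l + t * sqrt (2 * tau2 / n)))"
    by (rule likely_mono[OF likely_ball[OF _ likely_cross[OF _ t]] _ pr]) auto
  have sq: "t * sqrt (2 * tau2 / n) \<le> 2 * t / sqrt n"
  proof -
    have "sqrt (2 * tau2) \<le> sqrt (2\<^sup>2)" using t2 by (intro real_sqrt_le_mono) auto
    then have "sqrt (2 * tau2) \<le> 2" by simp
    then have "t * sqrt (2 * tau2) / sqrt n \<le> t * 2 / sqrt n"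
      using t by (intro divide_right_mono mult_left_mono) auto
    then show ?thesis by (simp add: real_sqrt_divide mult.commute)
  qed
  show ?thesis
  proof (rule likely_mono[OF likely_conj[OF 2 1]], intro conjI ballI)
    fix \<omega> k
    assume *: "(\<forall>k\<in>{1..<p}. sqnorm n (U \<omega>) / n < 2 * tau2 \<longrightarrow>
      \<bar>inner_upto n (U \<omega>) (\<lambda>i. X \<omega> i k)\<bar> \<le> n * (2 * l + t * sqrt (2 * tau2 / n))) \<and>
      \<bar>sqnorm n (U \<omega>) / n - tau2\<bar> < \<eta>" and k: "k \<in> {1..<p}"
    have "sqnorm n (U \<omega>) / n < 2 * tau2" using * \<eta> by linarith
    then have "\<bar>inner_upto n (U \<omega>) (\<lambda>i. X \<omega> i k)\<bar> \<le> n * (2 * l + t * sqrt (2 * tau2 / n))" using * k by blast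
    also have "\<dots> \<le> n * (2 * l + 2 * t / sqrt n)" using sq by (intro mult_left_mono) auto
    finally show "\<bar>inner_upto n (U \<omega>) (\<lambda>i. X \<omega> i k)\<bar> \<le> n * (2 * l + 2 * sqrt (2 * ln (2 * p / \<delta>)) / sqrt n)"
      unfolding t_def .
  qed auto
qed

section \<open>Distance between the Lasso and the eligible vector\<close>

context
  fixes ghat :: "(nat \<Rightarrow> nat \<Rightarrow> real) \<Rightarrow> nat \<Rightarrow> real" and lam \<delta> \<eta> :: real
  assumes ghat: "\<And>x. is_lasso n p lam x (ghat x)" and lam: "0 \<le> lam"
    and \<delta>: "0 < \<delta>" "\<delta> \<le> 1" and \<eta>: "0 < \<eta>" "\<eta> \<le> tau2" and t2: "tau2 \<le> 2"
begin

abbreviation (input) "R \<omega> \<equiv> resid p (X \<omega>) (ghat (X \<omega>))"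

text \<open>For \<open>p \<ge> 2 / \<delta>\<close> the logarithm of \<open>2 * p / \<delta>\<close>
  is at most \<open>2 * ln p\<close>, so \<open>\<delta>\<close> disappears from the noise level,
  which is then at most \<open>(2 * C + 4) * rate n p\<close>. The slow rate asks for twice that,
  which is the origin of \<open>4 * C + 8\<close>.\<close>

lemma likely_close_large_p:
  assumes C: "0 \<le> C" "l \<le> C * rate n p" "(4 * C + 8) * rate n p \<le> lam" and P: "2 / \<delta> \<le> p"
  shows "likely M (\<delta> + 8 / (real n * \<eta>\<^sup>2)) (\<lambda>\<omega>. \<bar>sqnorm n (R \<omega>) / n - tau2\<bar> \<le> \<eta> + 4 * (lam * l1norm p c) \<and>
    lam * l1norm p (ghat (X \<omega>)) \<le> 3 * (lam * l1norm p c))"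
proof (rule likely_mono[OF likely_cross_all[OF \<delta> \<eta> t2]])
  fix \<omega>
  assume *: "\<bar>sqnorm n (U \<omega>) / n - tau2\<bar> < \<eta> \<and>
    (\<forall>k\<in>{1..<p}. \<bar>inner_upto n (U \<omega>) (\<lambda>i. X \<omega> i k)\<bar> \<le> n * (2 * l + 2 * sqrt (2 * ln (2 * p / \<delta>)) / sqrt n))"
  define \<mu> where "\<mu> = (2 * C + 4) * rate n p"
  have lp: "0 \<le> ln (real p)" using p_ge2 by simp
  have r0: "0 \<le> rate n p" unfolding rate_def using lp by simp
  have "2 * p / \<delta> \<le> p * p" using mult_right_mono[OF P, of p] by simp
  then have "ln (2 * p / \<delta>) \<le> ln (real p * real p)"
    using \<delta> p_ge2 by (subst ln_le_cancel_iff) auto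
  also have "\<dots> = 2 * ln p" using p_ge2 by (simp add: ln_mult)
  finally have "sqrt (2 * ln (2 * p / \<delta>)) \<le> sqrt (2\<^sup>2 * ln p)" by (intro real_sqrt_le_mono) auto
  also have "\<dots> = 2 * sqrt (ln p)" by (simp add: real_sqrt_mult)
  finally have "2 * sqrt (2 * ln (2 * p / \<delta>)) / sqrt n \<le> 2 * (2 * sqrt (ln p)) / sqrt n"
    by (intro divide_right_mono) auto
  also have "\<dots> = 4 * rate n p" by (simp add: rate_def real_sqrt_divide)
  finally have m: "2 * l + 2 * sqrt (2 * ln (2 * p / \<delta>)) / sqrt n \<le> \<mu>"
    using C(2) unfolding \<mu>_def by (simp add: algebra_simps)
  have cr: "\<bar>inner_upto n (U \<omega>) (\<lambda>i. X \<omega> i k)\<bar> \<le> real n * \<mu>" if "k \<in> {1..<p}" for k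
  proof -
    have "\<bar>inner_upto n (U \<omega>) (\<lambda>i. X \<omega> i k)\<bar> \<le> n * (2 * l + 2 * sqrt (2 * ln (2 * p / \<delta>)) / sqrt n)"
      using * that by blast
    also have "\<dots> \<le> real n * \<mu>" using m by (intro mult_left_mono) auto
    finally show ?thesis .
  qed
  have mu: "0 \<le> \<mu>" "2 * \<mu> \<le> lam" unfolding \<mu>_def using C r0 by (auto simp: algebra_simps)
  have B1: "\<bar>sqnorm n (R \<omega>) / n - sqnorm n (U \<omega>) / n\<bar> \<le> 4 * (lam * l1norm p c)"
    by (rule lasso_close_slow_rate(1)[OF ghat n_pos mu cr])
  have B2: "lam * l1norm p (ghat (X \<omega>)) \<le> 3 * (lam * l1norm p c)"
    by (rule lasso_close_slow_rate(2)[OF ghat n_pos mu cr])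
  show "\<bar>sqnorm n (R \<omega>) / n - tau2\<bar> \<le> \<eta> + 4 * (lam * l1norm p c) \<and>
    lam * l1norm p (ghat (X \<omega>)) \<le> 3 * (lam * l1norm p c)"
    using B1 B2 conjunct1[OF *] by linarith
qed simp

text \<open>With \<open>p\<close> bounded by \<open>P\<close>, penalty and noise level are both of
  order \<open>1 / sqrt n\<close>, and the fast rate turns this into order \<open>1 / n\<close>. In
  \<open>D\<close>, the term \<open>6 * A\<close> collects \<open>2 * A\<close> from
  \<open>lam\<close> and \<open>4 * A\<close> from twice the noise level.\<close>

lemma likely_close_small_p:
  assumes P: "p \<le> P" and A: "lam \<le> A / sqrt n" "l \<le> A / sqrt n" "0 \<le> A" "0 \<le> l"
  defines "D \<equiv> 2 * (6 * A + 4 * sqrt (2 * ln (2 * P / \<delta>)))\<^sup>2 * (2 * P / L)"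
  shows "likely M (\<delta> + 8 / (real n * \<eta>\<^sup>2) + 64 * P ^ 4 / (real n * L\<^sup>2))
   (\<lambda>\<omega>. \<bar>sqnorm n (R \<omega>) / n - tau2\<bar> \<le> \<eta> + D / n \<and>
    lam * l1norm p (ghat (X \<omega>)) \<le> lam * l1norm p c + D / n)"
proof -
  \<comment> \<open>Half of the smallest possible \<open>L / p\<close>, so that
    \<open>L / p - \<kappa>\<close> is still at least \<open>\<kappa>\<close>.\<close>
  define \<kappa> where "\<kappa> = L / (2 * P)"
  define t where "t = sqrt (2 * ln (2 * P / \<delta>))"
  have Pp: "0 < P" using P p_pos by linarith
  have \<kappa>: "\<kappa> > 0" unfolding \<kappa>_def using L_pos Pp by simp
  have pe: "16 * (real p)\<^sup>2 / (real n * \<kappa>\<^sup>2) \<le> 64 * P ^ 4 / (real n * L\<^sup>2)"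
  proof -
    have "16 * (real p)\<^sup>2 / (real n * \<kappa>\<^sup>2) \<le> 16 * (real P)\<^sup>2 / (real n * \<kappa>\<^sup>2)"
      using P by (intro divide_right_mono mult_left_mono power_mono) auto
    also have "\<dots> = 64 * P ^ 4 / (real n * L\<^sup>2)"
      unfolding \<kappa>_def using L_pos Pp by (simp add: field_simps power2_eq_square power4_eq_xxxx)
    finally show ?thesis .
  qed
  have G: "likely M (64 * P ^ 4 / (real n * L\<^sup>2))
    (\<lambda>\<omega>. \<forall>j<p. \<forall>k<p. \<bar>inner_upto n (\<lambda>i. X \<omega> i j) (\<lambda>i. X \<omega> i k) / n - S j k\<bar> \<le> \<kappa>)"
    by (rule likely_mono[OF likely_gram[OF \<kappa>] _ pe])
  show ?thesis
  proof (rule likely_mono[OF likely_conj[OF likely_cross_all[OF \<delta> \<eta> t2] G]])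
    fix \<omega>
    assume *: "(\<bar>sqnorm n (U \<omega>) / n - tau2\<bar> < \<eta> \<and>
      (\<forall>k\<in>{1..<p}. \<bar>inner_upto n (U \<omega>) (\<lambda>i. X \<omega> i k)\<bar> \<le> n * (2 * l + 2 * sqrt (2 * ln (2 * p / \<delta>)) / sqrt n))) \<and>
      (\<forall>j<p. \<forall>k<p. \<bar>inner_upto n (\<lambda>i. X \<omega> i j) (\<lambda>i. X \<omega> i k) / n - S j k\<bar> \<le> \<kappa>)"
    define \<mu> where "\<mu> = (2 * A + 2 * t) / sqrt n"
    have "1 \<le> 2 * P / \<delta>" using \<delta> Pp by (simp add: field_simps)
    then have t0: "0 \<le> t" unfolding t_def by simp
    have "2 * p / \<delta> \<le> 2 * P / \<delta>" using P \<delta> by (intro divide_right_mono) auto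
    then have "ln (2 * p / \<delta>) \<le> ln (2 * P / \<delta>)"
      using \<delta> p_pos Pp by (subst ln_le_cancel_iff) auto
    then have "sqrt (2 * ln (2 * p / \<delta>)) \<le> t" unfolding t_def by (intro real_sqrt_le_mono) auto
    then have "2 * sqrt (2 * ln (2 * p / \<delta>)) / sqrt n \<le> 2 * t / sqrt n" by (intro divide_right_mono) auto
    then have m: "2 * l + 2 * sqrt (2 * ln (2 * p / \<delta>)) / sqrt n \<le> \<mu>"
      using A(2) unfolding \<mu>_def by (simp add: add_divide_distrib)
    have cr: "\<bar>inner_upto n (U \<omega>) (\<lambda>i. X \<omega> i k)\<bar> \<le> real n * \<mu>" if "k \<in> {1..<p}" for k
    proof -
      have "\<bar>inner_upto n (U \<omega>) (\<lambda>i. X \<omega> i k)\<bar> \<le> n * (2 * l + 2 * sqrt (2 * ln (2 * p / \<delta>)) / sqrt n)"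
        using * that by blast
      also have "\<dots> \<le> real n * \<mu>" using m by (intro mult_left_mono) auto
      finally show ?thesis .
    qed
    have mu: "0 \<le> \<mu>" unfolding \<mu>_def using A t0 by simp
    have comp: "\<kappa> * (l1norm p v)\<^sup>2 \<le> sqnorm n (fit p (X \<omega>) v) / n" for v
    proof -
      have "L / P \<le> L / p" using P p_pos L_pos by (intro divide_left_mono) auto
      then have "\<kappa> \<le> L / p - \<kappa>" unfolding \<kappa>_def by (simp add: field_simps)
      then have "\<kappa> * (l1norm p v)\<^sup>2 \<le> (L / p - \<kappa>) * (l1norm p v)\<^sup>2" by (intro mult_right_mono) auto
      also have "\<dots> \<le> sqnorm n (fit p (X \<omega>) v) / n"
        using * L_pos by (intro gram_compatibility[OF n_pos p_pos _ ray]) auto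
      finally show ?thesis .
    qed
    define q where "q = (2 * lam + 2 * \<mu>)\<^sup>2 / \<kappa>"
    have B1: "\<bar>sqnorm n (R \<omega>) / n - sqnorm n (U \<omega>) / n\<bar> \<le> 2 * q"
      using lasso_close_fast_rate(1)[OF ghat n_pos mu lam \<kappa> cr comp] unfolding q_def by simp
    have B2: "lam * l1norm p (ghat (X \<omega>)) \<le> lam * l1norm p c + q"
      unfolding q_def by (rule lasso_close_fast_rate(2)[OF ghat n_pos mu lam \<kappa> cr comp])
    have "2 * lam + 2 * \<mu> \<le> (6 * A + 4 * t) / sqrt n"
    proof -
      have "(6 * A + 4 * t) / sqrt n = 2 * (A / sqrt n) + 2 * \<mu>" by (simp add: \<mu>_def add_divide_distrib)
      then show ?thesis using A(1) by linarith
    qed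
    then have "(2 * lam + 2 * \<mu>)\<^sup>2 \<le> ((6 * A + 4 * t) / sqrt n)\<^sup>2" using lam mu by (intro power_mono) auto
    also have "\<dots> = (6 * A + 4 * t)\<^sup>2 / n" by (simp add: power_divide)
    finally have "(2 * lam + 2 * \<mu>)\<^sup>2 / \<kappa> \<le> (6 * A + 4 * t)\<^sup>2 / n / \<kappa>" using \<kappa> by (intro divide_right_mono) auto
    also have "\<dots> = D / n / 2" unfolding D_def \<kappa>_def t_def using L_pos by (simp add: field_simps)
    finally have "q \<le> D / n / 2" unfolding q_def .
    then have Dn: "2 * q \<le> D / n" by simp
    have "0 \<le> D / n" unfolding D_def using L_pos by simp
    then show "\<bar>sqnorm n (R \<omega>) / n - tau2\<bar> \<le> \<eta> + D / n \<and>
      lam * l1norm p (ghat (X \<omega>)) \<le> lam * l1norm p c + D / n"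
      using B1 B2 conjunct1[OF conjunct1[OF *]] Dn by (intro conjI) linarith+
  qed simp
qed

end

end

end

section \<open>Asymptotics\<close>

text \<open>The infimum of the Rayleigh quotients is a lower bound only if these are bounded below;
  the negative sum of the absolute entries of \<open>S\<close> serves as a bound.\<close>

lemma min_eig_le:
  "min_eig p S * (\<Sum>j<p. (v j)\<^sup>2) \<le> qform p S v v"
proof (cases "\<exists>j<p. v j \<noteq> 0")
  case False
  then show ?thesis by (simp add: qform_def)
next
  case True
  define N where "N a = (\<Sum>j<p. (a j)\<^sup>2)" for a :: "nat \<Rightarrow> real"
  let ?R = "{qform p S a a / N a | a. \<exists>j<p. a j \<noteq> 0}"
  have N: "0 < N a" if "\<exists>j<p. a j \<noteq> 0" for a
    unfolding N_def using that by (auto intro!: sum_pos2)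
  have "bdd_below ?R"
  proof (rule bdd_belowI)
    fix y assume "y \<in> ?R"
    then obtain a where a: "\<exists>j<p. a j \<noteq> 0" and y: "y = qform p S a a / N a" by blast
    have le: "\<bar>a j\<bar> \<le> sqrt (N a)" if "j < p" for j
    proof -
      have "(a j)\<^sup>2 \<le> N a" unfolding N_def using that by (intro member_le_sum) auto
      then have "sqrt ((a j)\<^sup>2) \<le> sqrt (N a)" by (rule real_sqrt_le_mono)
      then show ?thesis by simp
    qed
    have "\<bar>a j * S j l * a l\<bar> \<le> \<bar>S j l\<bar> * N a" if "j < p" "l < p" for j l
    proof -
      have "\<bar>a j\<bar> * \<bar>a l\<bar> \<le> sqrt (N a) * sqrt (N a)" using le that N[OF a] by (intro mult_mono) auto
      then have "\<bar>S j l\<bar> * (\<bar>a j\<bar> * \<bar>a l\<bar>) \<le> \<bar>S j l\<bar> * N a" using N[OF a] by (intro mult_left_mono) auto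
      then show ?thesis by (simp add: abs_mult mult_ac)
    qed
    then have "\<bar>qform p S a a\<bar> \<le> (\<Sum>j<p. \<Sum>l<p. \<bar>S j l\<bar> * N a)"
      unfolding qform_def by (intro order_trans[OF sum_abs] sum_mono) auto
    also have "\<dots> = (\<Sum>j<p. \<Sum>l<p. \<bar>S j l\<bar>) * N a" by (simp add: sum_distrib_right)
    finally have "- (\<Sum>j<p. \<Sum>l<p. \<bar>S j l\<bar>) * N a \<le> qform p S a a" by linarith
    then show "- (\<Sum>j<p. \<Sum>l<p. \<bar>S j l\<bar>) \<le> y" unfolding y using N[OF a] by (subst pos_le_divide_eq) auto
  qed
  then have "min_eig p S \<le> qform p S v v / N v"
    unfolding min_eig_def qform_def[symmetric] N_def[symmetric] using True by (intro cInf_lower) auto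
  then show ?thesis using N[OF True] unfolding N_def by (simp add: pos_le_divide_eq)
qed

lemma eventually_over_n_le:
  fixes c e :: real
  assumes "e > 0"
  shows "eventually (\<lambda>n. c / real n \<le> e) sequentially"
  using order_tendstoD(2)[OF lim_const_over_n[of c], of e] assms by (auto elim!: eventually_mono)

lemma eventually_le_of_tendsto_0:
  fixes f :: "nat \<Rightarrow> real"
  assumes "f \<longlonglongrightarrow> 0" "e > 0"
  shows "eventually (\<lambda>n. f n \<le> e) sequentially"
  using order_tendstoD(2)[OF assms] by (auto elim!: eventually_mono)

section \<open>The normal distribution function and the studentised statistic\<close>

lemma Phi_eq_cdf: "Phi = cdf std_normal_distribution"
  by (simp add: fun_eq_iff Phi_def cdf_def)

lemma isCont_Phi: "isCont Phi z"
proof -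
  interpret real_distribution std_normal_distribution by (rule real_dist_normal_dist)
  have "emeasure std_normal_distribution {z} = (\<integral>\<^sup>+x. ennreal (std_normal_density x) * indicator {z} x \<partial>lborel)"
    by (rule emeasure_density) auto
  also have "\<dots> = (\<integral>\<^sup>+(x :: real). 0 \<partial>lborel)"
    by (rule nn_integral_cong_AE) (use AE_lborel_singleton[of z] in \<open>auto elim!: eventually_mono\<close>)
  finally have "measure std_normal_distribution {z} = 0" by (simp add: measure_def)
  then show ?thesis unfolding Phi_eq_cdf isCont_cdf .
qed

lemma (in prob_space) std_normal_prob_le:
  assumes "distributed M lborel T std_normal_density"
  shows "{\<omega> \<in> space M. T \<omega> \<le> y} \<in> sets M" "prob {\<omega> \<in> space M. T \<omega> \<le> y} = Phi y"
proof -
  have [measurable]: "T \<in> borel_measurable M" using distributed_measurable[OF assms] by simp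
  show "{\<omega> \<in> space M. T \<omega> \<le> y} \<in> sets M" by measurable
  have "Phi y = measure (distr M lborel T) {..y}"
    unfolding Phi_def distributed_distr_eq_density[OF assms] ..
  also have "\<dots> = prob {\<omega> \<in> space M. T \<omega> \<le> y}"
    by (subst measure_distr) (auto intro!: arg_cong[where f=prob])
  finally show "prob {\<omega> \<in> space M. T \<omega> \<le> y} = Phi y" ..
qed

lemma measurable_debiased:
  assumes [measurable]: "\<And>i j. i < n \<Longrightarrow> j < p \<Longrightarrow> (\<lambda>\<omega>. x \<omega> i j) \<in> borel_measurable M"
    "\<And>i. i < n \<Longrightarrow> (\<lambda>\<omega>. e \<omega> i) \<in> borel_measurable M"
    "\<And>j. (\<lambda>\<omega>. g \<omega> j) \<in> borel_measurable M" "\<And>j. (\<lambda>\<omega>. b \<omega> j) \<in> borel_measurable M"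
    and p: "0 < p"
  shows "(\<lambda>\<omega>. debiased n p lam (x \<omega>) (resp p (x \<omega>) (e \<omega>) \<beta>) (g \<omega>) (b \<omega>)) \<in> borel_measurable M"
    "(\<lambda>\<omega>. sighat n p lam (x \<omega>) (g \<omega>)) \<in> borel_measurable M"
proof -
  have [measurable]: "(\<lambda>\<omega>. resid p (x \<omega>) (g \<omega>) i) \<in> borel_measurable M" if "i < n" for i
    using that p unfolding resid_def fit_def by auto
  have [measurable]: "(\<lambda>\<omega>. tautilde n p lam (x \<omega>) (g \<omega>)) \<in> borel_measurable M"
    unfolding tautilde_def sqnorm_def l1norm_def by simp
  show "(\<lambda>\<omega>. debiased n p lam (x \<omega>) (resp p (x \<omega>) (e \<omega>) \<beta>) (g \<omega>) (b \<omega>)) \<in> borel_measurable M"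
    unfolding debiased_def sum_thetahat_inner[OF p] inner_upto_def resp_def by simp
  show "(\<lambda>\<omega>. sighat n p lam (x \<omega>) (g \<omega>)) \<in> borel_measurable M"
    unfolding sighat_eq[OF p] sqnorm_def by simp
qed

text \<open>The denominator \<open>tautilde\<close> divides both the noise term and the square root
  of \<open>sighat\<close>, hence cancels in the leading term. What is left there is the
  self-normalised product, whose law is known exactly; the denominator survives only next to the
  remainder \<open>R\<close>.\<close>

lemma studentized_decomposition:
  fixes deb :: real
  assumes p: "0 < p" and n: "n > 0" and tau: "tautilde n p lam x g > 0" and r: "sqnorm n (resid p x g) > 0"
    and R: "R = deb - (\<Sum>j<p. thetahat n p lam x g j * (\<Sum>i<n. x i j * e i)) / n"
  shows "sqrt n * deb / sqrt (sighat n p lam x g) = inner_upto n (normalized n (resid p x g)) e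
    + sqrt n * R * tautilde n p lam x g / sqrt (sqnorm n (resid p x g) / n)"
proof -
  define t where "t = tautilde n p lam x g"
  define q where "q = sqnorm n (resid p x g)"
  define I where "I = inner_upto n (resid p x g) e"
  have deb: "deb = R + I / t / n" unfolding R sum_thetahat_inner[OF p] t_def I_def by simp
  have sg: "sqrt (sighat n p lam x g) = sqrt (q / n) / t"
    unfolding sighat_eq[OF p] real_sqrt_divide[of _ "_\<^sup>2"] using tau by (simp add: t_def q_def)
  have "sqrt n * (I / t / n) / (sqrt (q / n) / t) = I / sqrt q"
  proof -
    have "sqrt n * (I / t / n) / (sqrt (q / n) / t) = I * (sqrt n * sqrt n) / (n * sqrt q)"
      using tau n r unfolding t_def[symmetric] q_def[symmetric] by (simp add: real_sqrt_divide field_simps)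
    then show ?thesis using n by simp
  qed
  moreover have "inner_upto n (normalized n (resid p x g)) e = I / sqrt q"
    unfolding I_def q_def using r by (intro inner_normalized) auto
  ultimately show ?thesis
    unfolding deb sg t_def[symmetric] q_def[symmetric] distrib_left add_divide_distrib by simp
qed

lemma abs_SUP_diff_le:
  fixes f :: "'b \<Rightarrow> real"
  assumes "B \<noteq> {}" "\<And>b. b \<in> B \<Longrightarrow> \<bar>f b - y\<bar> \<le> e"
  shows "\<bar>(SUP b\<in>B. f b) - y\<bar> \<le> e"
proof -
  have f: "y - e \<le> f b" "f b \<le> y + e" if "b \<in> B" for b using assms(2)[OF that] by linarith+
  have "(SUP b\<in>B. f b) \<le> y + e" using assms(1) f by (intro cSUP_least) auto
  moreover obtain b where b: "b \<in> B" using assms(1) by auto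
  have "f b \<le> (SUP b\<in>B. f b)" using f b by (intro cSUP_upper bdd_aboveI2) auto
  ultimately show ?thesis using f(1)[OF b] by linarith
qed

text \<open>The hypotheses of the theorem with their existential constants fixed: \<open>L\<close>
  bounds the eigenvalues below, \<open>c2\<close> bounds \<open>lamL\<close> above. Rate conditions
  hold eventually, whereas positivity of the eigenvalues holds for every \<open>n\<close>, which
  gives \<open>gamma0\<close> its meaning throughout.\<close>

locale debiased_lasso =
  fixes M :: "nat \<Rightarrow> 'a measure"
    and X :: "nat \<Rightarrow> 'a \<Rightarrow> nat \<Rightarrow> nat \<Rightarrow> real" and E :: "nat \<Rightarrow> 'a \<Rightarrow> nat \<Rightarrow> real"
    and p :: "nat \<Rightarrow> nat" and S :: "nat \<Rightarrow> nat \<Rightarrow> nat \<Rightarrow> real" and B :: "nat \<Rightarrow> (nat \<Rightarrow> real) set"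
    and bhat :: "nat \<Rightarrow> (nat \<Rightarrow> nat \<Rightarrow> real) \<Rightarrow> (nat \<Rightarrow> real) \<Rightarrow> nat \<Rightarrow> real"
    and ghat :: "nat \<Rightarrow> (nat \<Rightarrow> nat \<Rightarrow> real) \<Rightarrow> nat \<Rightarrow> real"
    and lamS :: "nat \<Rightarrow> real" and gamS :: "nat \<Rightarrow> nat \<Rightarrow> real" and lamL :: "nat \<Rightarrow> real"
    and L c2 Cs :: real
  assumes prob: "\<And>n. prob_space (M n)"
    and p_ge2: "\<And>n. p n \<ge> 2"
    and S_sym: "\<And>n j l. S n j l = S n l j"
    and S_diag: "\<And>n j. j < p n \<Longrightarrow> S n j j = 1"
    and eig_pos: "\<And>n. min_eig (p n) (S n) > 0"
    and L_pos: "L > 0" and eig_ge: "eventually (\<lambda>n. L \<le> min_eig (p n) (S n)) sequentially"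
    and gauss: "\<And>n. gaussian_data (M n) n (p n) (S n) (X n) (E n)"
    and B_ne: "\<And>n. B n \<noteq> {}"
    and ghat_meas: "\<And>n j. (\<lambda>\<omega>. ghat n (X n \<omega>) j) \<in> borel_measurable (M n)"
    and bhat_meas: "\<And>n \<beta> j. \<beta> \<in> B n \<Longrightarrow>
          (\<lambda>\<omega>. bhat n (X n \<omega>) (resp (p n) (X n \<omega>) (E n \<omega>) \<beta>) j) \<in> borel_measurable (M n)"
    and ghat: "\<And>n x. is_lasso n (p n) (lamL n) x (ghat n x)"
    and elig: "\<And>n k. k \<in> {1..<p n} \<Longrightarrow>
          \<bar>\<Sum>j\<in>{1..<p n}. S n k j * (gamS n j - gamma0 (p n) (S n) j)\<bar> \<le> lamS n"
    and elig_lim: "(\<lambda>n. lamS n * l1norm (p n) (gamS n)) \<longlonglongrightarrow> 0"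
    and Cs: "Cs > 0" and lamS_le: "eventually (\<lambda>n. lamS n \<le> Cs * rate n (p n)) sequentially"
    and rate_lim: "(\<lambda>n. rate n (p n) * l1norm (p n) (gamS n)) \<longlonglongrightarrow> 0"
    and c2: "c2 > 0" and lamL_le: "eventually (\<lambda>n. lamL n \<le> c2 * rate n (p n)) sequentially"
    and lamL_ge: "eventually (\<lambda>n. (4 * Cs + 8) * rate n (p n) \<le> lamL n) sequentially"
    and bhat_rate: "unif_oP M B (\<lambda>n \<beta> \<omega>. sqrt (ln (real (p n))) *
          (\<Sum>j<p n. \<bar>bhat n (X n \<omega>) (resp (p n) (X n \<omega>) (E n \<omega>) \<beta>) j - \<beta> j\<bar>)) (\<lambda>n. 1)"
begin

lemma design:
  assumes n: "n > 0"
  shows "gaussian_design (M n) n (p n) (S n) (X n) (E n)"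
proof (intro gaussian_design.intro gaussian_design_axioms.intro)
  fix w :: "nat \<Rightarrow> real" assume "\<exists>j<p n. w j \<noteq> 0"
  then obtain j where "j < p n" "w j \<noteq> 0" by blast
  then have "0 < (\<Sum>j<p n. (w j)\<^sup>2)" by (intro sum_pos2[of _ j]) auto
  then have "0 < min_eig (p n) (S n) * (\<Sum>j<p n. (w j)\<^sup>2)" using eig_pos[of n] by simp
  then show "0 < qform (p n) (S n) w w" using min_eig_le[of "p n" "S n" w] by linarith
qed (fact prob n p_ge2 S_sym gauss | rule S_diag, assumption)+

lemma p_pos: "0 < p n" using p_ge2[of n] by simp

lemma rate_nonneg: "0 \<le> rate n (p n)"
  unfolding rate_def using p_ge2[of n] by simp

lemma rate_pos: "n > 0 \<Longrightarrow> 0 < rate n (p n)"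
  unfolding rate_def using p_ge2[of n] by simp

lemma lamS_nonneg: "0 \<le> lamS n"
proof -
  have "1 \<in> {1..<p n}" using p_ge2[of n] by simp
  from elig[OF this] show ?thesis by linarith
qed

lemma gamS_deviation:
  assumes n: "n > 0" and k: "k \<in> {1..<p n}"
  shows "\<bar>qform (p n) (S n) (unit_coeff k) (resid_coeff (gamS n))\<bar> \<le> lamS n"
proof -
  have kp: "k < p n" using k by simp
  have "(\<Sum>j\<in>{1..<p n}. S n k j * (gamS n j - gamma0 (p n) (S n) j)) = (\<Sum>j\<in>{1..<p n}. S n k j * gamS n j) - S n k 0"
    using gaussian_design.gamma0_normal_equations[OF design[OF n] k]
    by (simp add: right_diff_distrib sum_subtractf)
  then show ?thesis using elig[OF k] unfolding qform_unit_resid[OF kp] by simp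
qed

definition tauS :: "nat \<Rightarrow> real" where
  "tauS n = qform (p n) (S n) (unit_coeff 0) (resid_coeff (gamS n))"

text \<open>By symmetry the matrix can be applied to \<open>gamma0\<close> first, where the normal
  equations replace it by the covariances with the first variable.\<close>

lemma tauS_eq:
  assumes n: "n > 0"
  shows "1 - (\<Sum>j\<in>{1..<p n}. \<Sum>k\<in>{1..<p n}. gamma0 (p n) (S n) j * S n j k * gamS n k) = tauS n"
proof -
  have "(\<Sum>j\<in>{1..<p n}. \<Sum>k\<in>{1..<p n}. gamma0 (p n) (S n) j * S n j k * gamS n k) =
      (\<Sum>k\<in>{1..<p n}. gamS n k * (\<Sum>j\<in>{1..<p n}. S n k j * gamma0 (p n) (S n) j))"
    unfolding sum_distrib_left
    by (subst sum.swap, intro sum.cong refl) (metis S_sym mult.assoc mult.commute)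
  also have "\<dots> = (\<Sum>k\<in>{1..<p n}. S n 0 k * gamS n k)"
  proof (intro sum.cong refl)
    fix k assume "k \<in> {1..<p n}"
    from gaussian_design.gamma0_normal_equations[OF design[OF n] this]
    show "gamS n k * (\<Sum>j\<in>{1..<p n}. S n k j * gamma0 (p n) (S n) j) = S n 0 k * gamS n k"
      by (metis S_sym mult.commute)
  qed
  finally show ?thesis unfolding tauS_def qform_unit_resid[OF p_pos] S_diag[OF p_pos] by simp
qed

section \<open>Limits of the mean squared residual and of the denominator\<close>

definition sq :: "nat \<Rightarrow> 'a \<Rightarrow> real" where
  "sq n \<omega> = sqnorm n (resid (p n) (X n \<omega>) (ghat n (X n \<omega>))) / n"

definition tt :: "nat \<Rightarrow> 'a \<Rightarrow> real" where
  "tt n \<omega> = tautilde n (p n) (lamL n) (X n \<omega>) (ghat n (X n \<omega>))"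

lemma tt_eq: "tt n \<omega> = sq n \<omega> + lamL n * l1norm (p n) (ghat n (X n \<omega>))"
  unfolding tt_def sq_def tautilde_def ..

lemma lamL_pos: "eventually (\<lambda>n. n > 0 \<and> 0 < lamL n) sequentially"
  using lamL_ge eventually_gt_at_top[of 0]
proof eventually_elim
  case (elim n)
  have "0 < (4 * Cs + 8) * rate n (p n)" using rate_pos[of n] elim Cs by simp
  then show ?case using elim by linarith
qed

lemma lamL_lim:
  assumes "e > 0"
  shows "eventually (\<lambda>n. lamL n * l1norm (p n) (gamS n) \<le> e) sequentially"
proof -
  have "eventually (\<lambda>n. rate n (p n) * l1norm (p n) (gamS n) \<le> e / c2) sequentially"
    using assms c2 by (intro eventually_le_of_tendsto_0[OF rate_lim]) auto
  then show ?thesis using lamL_le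
  proof eventually_elim
    case (elim n)
    have "lamL n * l1norm (p n) (gamS n) \<le> c2 * rate n (p n) * l1norm (p n) (gamS n)"
      using elim by (intro mult_right_mono) auto
    also have "\<dots> \<le> c2 * (e / c2)" unfolding mult.assoc using elim(1) c2 by (intro mult_left_mono) auto
    also have "\<dots> = e" using c2 by simp
    finally show ?case .
  qed
qed

lemma ray_n:
  assumes "L \<le> min_eig (p n) (S n)"
  shows "L * (\<Sum>j<p n. (v j)\<^sup>2) \<le> qform (p n) (S n) v v"
proof -
  have "L * (\<Sum>j<p n. (v j)\<^sup>2) \<le> min_eig (p n) (S n) * (\<Sum>j<p n. (v j)\<^sup>2)"
    using assms by (intro mult_right_mono sum_nonneg) auto
  then show ?thesis using min_eig_le[of "p n" "S n" v] by linarith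
qed

lemma tauS_bounds: "eventually (\<lambda>n. L / 2 \<le> tauS n \<and> tauS n \<le> 2) sequentially"
proof -
  have "eventually (\<lambda>n. lamS n * l1norm (p n) (gamS n) \<le> min (L / 2) 1) sequentially"
    using L_pos by (intro eventually_le_of_tendsto_0[OF elig_lim]) auto
  then show ?thesis using eig_ge eventually_gt_at_top[of 0]
  proof eventually_elim
    case (elim n)
    note F = design[OF elim(3)] gamS_deviation[OF elim(3)] ray_n[OF elim(2)] L_pos
    show ?case
      using gaussian_design.tau2_tauS[OF F] gaussian_design.tau2_ge[OF F]
        gaussian_design.tauS_le[OF F] elim(1) unfolding tauS_def[symmetric] by linarith
  qed
qed

text \<open>The case distinction reflects that \<open>lamL\<close> only dominates the noise level on an event of
  probability close to one when \<open>p\<close> is large; for bounded \<open>p\<close> the empirical Gram matrix is consistent instead.\<close>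

lemma sq_tt_close:
  assumes e: "e > 0" and \<delta>: "\<delta> > 0"
  shows "eventually (\<lambda>n. likely (M n) \<delta> (\<lambda>\<omega>. \<bar>sq n \<omega> - tauS n\<bar> \<le> e \<and> \<bar>tt n \<omega> - tauS n\<bar> \<le> e)) sequentially"
proof -
  define \<delta>' where "\<delta>' = min 1 \<delta> / 4"
  have \<delta>': "0 < \<delta>'" "\<delta>' \<le> 1" "\<delta>' \<le> \<delta> / 4" using \<delta> unfolding \<delta>'_def by auto
  define \<eta> where "\<eta> = min (e / 4) L"
  have \<eta>: "0 < \<eta>" "\<eta> \<le> e / 4" "\<eta> \<le> L" using e L_pos unfolding \<eta>_def by auto
  \<comment> \<open>Fixed before \<open>n\<close>, since the dimension may alternate between the two
    cases along the sequence; \<open>D\<close> and the Gram error are then constants over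
    \<open>n\<close>.\<close>
  define P where "P = Suc (nat \<lceil>2 / \<delta>'\<rceil>)"
  have P: "2 / \<delta>' \<le> P" "1 \<le> P" unfolding P_def using \<delta>' by linarith+
  define A where "A = max Cs c2 * sqrt (ln P)"
  have A0: "0 \<le> A" unfolding A_def using Cs P by auto
  define D where "D = 2 * (6 * A + 4 * sqrt (2 * ln (2 * P / \<delta>')))\<^sup>2 * (2 * P / L)"
  \<comment> \<open>Error budget: \<open>e / 4\<close> each for the concentration and for replacing
    \<open>tau2\<close> by \<open>tauS\<close>, the rest for the Lasso. Probability budget:
    \<open>\<delta> / 4\<close> each for the columns, the norm and the Gram matrix. The bound
    \<open>1 / 4\<close> keeps \<open>tau2\<close> below 2.\<close>
  have "eventually (\<lambda>n. lamS n * l1norm (p n) (gamS n) \<le> min (e / 4) (1 / 4)) sequentially"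
    using e by (intro eventually_le_of_tendsto_0[OF elig_lim]) auto
  moreover have "eventually (\<lambda>n. lamL n * l1norm (p n) (gamS n) \<le> e / 48) sequentially"
    using e by (intro lamL_lim) auto
  moreover have "eventually (\<lambda>n. 8 / \<eta>\<^sup>2 / real n \<le> \<delta> / 4) sequentially"
    using \<delta> by (intro eventually_over_n_le) auto
  moreover have "eventually (\<lambda>n. 64 * real P ^ 4 / L\<^sup>2 / real n \<le> \<delta> / 4) sequentially"
    using \<delta> by (intro eventually_over_n_le) auto
  moreover have "eventually (\<lambda>n. D / real n \<le> e / 8) sequentially"
    using e by (intro eventually_over_n_le) auto
  ultimately show ?thesis
    using eig_ge lamS_le lamL_le lamL_ge lamL_pos
  proof eventually_elim
    case (elim n)
    have n: "n > 0" and lam0: "0 \<le> lamL n" using elim(10) by auto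
    note F = design[OF n] gamS_deviation[OF n] ray_n[OF elim(6)] L_pos
    define t2 where "t2 = qform (p n) (S n) (resid_coeff (gamS n)) (resid_coeff (gamS n))"
    have t2: "\<bar>t2 - tauS n\<bar> \<le> min (e / 4) (1 / 4)" "L \<le> t2" "tauS n \<le> 1 + 1 / 4"
      using gaussian_design.tau2_tauS[OF F] gaussian_design.tau2_ge[OF F]
        gaussian_design.tauS_le[OF F] elim(1) unfolding tauS_def[symmetric] t2_def[symmetric] by linarith+
    have t22: "t2 \<le> 2" "\<eta> \<le> t2" using t2 \<eta> by linarith+
    interpret prob_space "M n" by (rule prob)
    note G = F ghat lam0 \<delta>'(1,2) \<eta>(1) t22(2)[unfolded t2_def] t22(1)[unfolded t2_def]
    have lg: "0 \<le> lamL n * l1norm (p n) (ghat n (X n \<omega>))" for \<omega> using lam0 by simp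
    have pr: "\<delta>' + 8 / (n * \<eta>\<^sup>2) \<le> \<delta> / 2"
      using elim(3) \<delta>' by (simp add: field_simps)
    show ?case
    proof (cases "2 / \<delta>' \<le> p n")
      case True
      have "likely (M n) (\<delta>' + 8 / (n * \<eta>\<^sup>2)) (\<lambda>\<omega>. \<bar>sq n \<omega> - t2\<bar> \<le> \<eta> + 4 * (lamL n * l1norm (p n) (gamS n)) \<and>
          lamL n * l1norm (p n) (ghat n (X n \<omega>)) \<le> 3 * (lamL n * l1norm (p n) (gamS n)))"
        using gaussian_design.likely_close_large_p[OF G _ elim(7,9) True] Cs
        unfolding sq_def t2_def by simp
      then show ?thesis
      proof (rule likely_mono)
        fix \<omega>
        assume "\<bar>sq n \<omega> - t2\<bar> \<le> \<eta> + 4 * (lamL n * l1norm (p n) (gamS n)) \<and>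
          lamL n * l1norm (p n) (ghat n (X n \<omega>)) \<le> 3 * (lamL n * l1norm (p n) (gamS n))"
        then show "\<bar>sq n \<omega> - tauS n\<bar> \<le> e \<and> \<bar>tt n \<omega> - tauS n\<bar> \<le> e"
          using t2(1) elim(2) \<eta> e lg[of \<omega>] unfolding tt_eq by (elim conjE, intro conjI) linarith+
      qed (use pr \<delta> in linarith)
    next
      case False
      then have pP: "p n \<le> P" using P by linarith
      have rP: "rate n (p n) \<le> sqrt (ln P) / sqrt n"
        unfolding rate_def real_sqrt_divide using pP p_pos[of n] n
        by (intro divide_right_mono real_sqrt_le_mono) auto
      have AA: "a * rate n (p n) \<le> A / sqrt n" if "0 < a" "a \<le> max Cs c2" for a
      proof -
        have "a * rate n (p n) \<le> max Cs c2 * (sqrt (ln P) / sqrt n)"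
          using that rP rate_nonneg by (intro mult_mono) auto
        then show ?thesis by (simp add: A_def)
      qed
      have A: "lamL n \<le> A / sqrt n" "lamS n \<le> A / sqrt n"
        using AA[of c2] AA[of Cs] elim(7,8) Cs c2 by auto
      have "likely (M n) (\<delta>' + 8 / (n * \<eta>\<^sup>2) + 64 * P ^ 4 / (n * L\<^sup>2)) (\<lambda>\<omega>. \<bar>sq n \<omega> - t2\<bar> \<le> \<eta> + D / n \<and>
          lamL n * l1norm (p n) (ghat n (X n \<omega>)) \<le> lamL n * l1norm (p n) (gamS n) + D / n)"
        using gaussian_design.likely_close_small_p[OF G pP A A0 lamS_nonneg]
        unfolding sq_def t2_def D_def by simp
      then show ?thesis
      proof (rule likely_mono)
        fix \<omega>
        assume "\<bar>sq n \<omega> - t2\<bar> \<le> \<eta> + D / n \<and>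
          lamL n * l1norm (p n) (ghat n (X n \<omega>)) \<le> lamL n * l1norm (p n) (gamS n) + D / n"
        then show "\<bar>sq n \<omega> - tauS n\<bar> \<le> e \<and> \<bar>tt n \<omega> - tauS n\<bar> \<le> e"
          using t2(1) elim(2,5) \<eta> e lg[of \<omega>] unfolding tt_eq by (elim conjE, intro conjI) linarith+
      next
        show "\<delta>' + 8 / (n * \<eta>\<^sup>2) + 64 * P ^ 4 / (n * L\<^sup>2) \<le> \<delta>"
        proof -
          have "64 * P ^ 4 / (n * L\<^sup>2) \<le> \<delta> / 4" using elim(4) by (simp add: mult.commute)
          then show ?thesis using pr \<delta> by linarith
        qed
      qed
    qed
  qed
qed

section \<open>Remainder, variance and limit law, uniformly over the model class\<close>

definition bh :: "nat \<Rightarrow> (nat \<Rightarrow> real) \<Rightarrow> 'a \<Rightarrow> nat \<Rightarrow> real" where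
  "bh n \<beta> \<omega> = bhat n (X n \<omega>) (resp (p n) (X n \<omega>) (E n \<omega>) \<beta>)"

definition deb :: "nat \<Rightarrow> (nat \<Rightarrow> real) \<Rightarrow> 'a \<Rightarrow> real" where
  "deb n \<beta> \<omega> = debiased n (p n) (lamL n) (X n \<omega>) (resp (p n) (X n \<omega>) (E n \<omega>) \<beta>) (ghat n (X n \<omega>)) (bh n \<beta> \<omega>) - \<beta> 0"

definition rem :: "nat \<Rightarrow> (nat \<Rightarrow> real) \<Rightarrow> 'a \<Rightarrow> real" where
  "rem n \<beta> \<omega> = deb n \<beta> \<omega> - (\<Sum>j<p n. thetahat n (p n) (lamL n) (X n \<omega>) (ghat n (X n \<omega>)) j *
     (\<Sum>i<n. X n \<omega> i j * E n \<omega> i)) / real n"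

text \<open>The remainder is at most \<open>lamL / tt\<close> times the l1 error. The factor
  \<open>sqrt (ln p)\<close> inside \<open>lamL\<close> is consumed by the rate assumed for
  \<open>bhat\<close>, and \<open>1 / sqrt n\<close> is left over. The three bounds are kept on one
  event because the limit law uses them together.\<close>

lemma remainder_likely:
  assumes \<eta>: "\<eta> > 0" and e: "e > 0" and \<delta>: "\<delta> > 0"
  shows "eventually (\<lambda>n. \<forall>\<beta>\<in>B n. likely (M n) \<delta> (\<lambda>\<omega>. \<bar>rem n \<beta> \<omega>\<bar> \<le> \<eta> / sqrt n \<and>
    \<bar>sq n \<omega> - tauS n\<bar> \<le> e \<and> \<bar>tt n \<omega> - tauS n\<bar> \<le> e)) sequentially"
proof -
  define e' where "e' = min e (L / 4)"
  have e': "e' > 0" "e' \<le> e" "e' \<le> L / 4" using e L_pos unfolding e'_def by auto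
  \<comment> \<open>Solves \<open>c2 / (L / 4) * \<eta>' = \<eta>\<close>, where
    \<open>L / 4\<close> is the lower bound for \<open>tt\<close> on the event.\<close>
  define \<eta>' where "\<eta>' = \<eta> * (L / 4) / c2"
  have \<eta>': "\<eta>' > 0" using \<eta> L_pos c2 unfolding \<eta>'_def by simp
  have "eventually (\<lambda>n. \<forall>\<beta>\<in>B n. measure (M n) {\<omega> \<in> space (M n). \<bar>sqrt (ln (real (p n))) *
          (\<Sum>j<p n. \<bar>bh n \<beta> \<omega> j - \<beta> j\<bar>)\<bar> > \<eta>' * 1} \<le> \<delta> / 2) sequentially"
    using bhat_rate \<eta>' \<delta> half_gt_zero[OF \<delta>] unfolding unif_oP_def bh_def by blast
  moreover have "eventually (\<lambda>n. likely (M n) (\<delta> / 2) (\<lambda>\<omega>. \<bar>sq n \<omega> - tauS n\<bar> \<le> e' \<and> \<bar>tt n \<omega> - tauS n\<bar> \<le> e')) sequentially"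
    using e' \<delta> by (intro sq_tt_close) auto
  ultimately show ?thesis using lamL_le lamL_pos tauS_bounds
  proof eventually_elim
    case (elim n)
    have n: "n > 0" and lam0: "0 \<le> lamL n" using elim(4) by auto
    interpret prob_space "M n" by (rule prob)
    show ?case
    proof
      fix \<beta> assume \<beta>: "\<beta> \<in> B n"
      have [measurable]: "(\<lambda>\<omega>. bh n \<beta> \<omega> j) \<in> borel_measurable (M n)" for j
        unfolding bh_def by (rule bhat_meas[OF \<beta>])
      have "likely (M n) (\<delta> / 2) (\<lambda>\<omega>. \<not> \<bar>sqrt (ln (real (p n))) * (\<Sum>j<p n. \<bar>bh n \<beta> \<omega> j - \<beta> j\<bar>)\<bar> > \<eta>' * 1)"
        using elim(1) \<beta> by (intro likelyI) auto
      from likely_conj[OF this elim(2)]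
      show "likely (M n) \<delta> (\<lambda>\<omega>. \<bar>rem n \<beta> \<omega>\<bar> \<le> \<eta> / sqrt n \<and> \<bar>sq n \<omega> - tauS n\<bar> \<le> e \<and> \<bar>tt n \<omega> - tauS n\<bar> \<le> e)"
      proof (rule likely_mono)
        fix \<omega>
        assume *: "\<not> \<bar>sqrt (ln (real (p n))) * (\<Sum>j<p n. \<bar>bh n \<beta> \<omega> j - \<beta> j\<bar>)\<bar> > \<eta>' * 1 \<and>
          \<bar>sq n \<omega> - tauS n\<bar> \<le> e' \<and> \<bar>tt n \<omega> - tauS n\<bar> \<le> e'"
        define d where "d = (\<Sum>j<p n. \<bar>bh n \<beta> \<omega> j - \<beta> j\<bar>)"
        have d0: "0 \<le> d" unfolding d_def by (intro sum_nonneg) auto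
        have d: "sqrt (ln (real (p n))) * d \<le> \<eta>'" using conjunct1[OF *] unfolding d_def by linarith
        have tt: "L / 4 \<le> tt n \<omega>" using conjunct2[OF conjunct2[OF *]] e'(3) elim(5) by linarith
        have "\<bar>rem n \<beta> \<omega>\<bar> \<le> lamL n / tt n \<omega> * d"
          unfolding rem_def deb_def d_def tt_def
          by (rule debiased_remainder[OF ghat lam0 n p_pos]) (use tt L_pos in \<open>auto simp: tt_def\<close>)
        also have "\<dots> \<le> c2 * rate n (p n) / (L / 4) * d"
          using tt L_pos d0 elim(3) lam0 by (intro mult_right_mono frac_le) auto
        also have "\<dots> = c2 / (L / 4) * (sqrt (ln (real (p n))) * d) / sqrt n"
          by (simp add: rate_def real_sqrt_divide mult_ac)
        also have "\<dots> \<le> c2 / (L / 4) * \<eta>' / sqrt n"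
          using d c2 L_pos by (intro divide_right_mono mult_left_mono) auto
        also have "\<dots> = \<eta> / sqrt n" using c2 L_pos unfolding \<eta>'_def by simp
        finally show "\<bar>rem n \<beta> \<omega>\<bar> \<le> \<eta> / sqrt n \<and> \<bar>sq n \<omega> - tauS n\<bar> \<le> e \<and> \<bar>tt n \<omega> - tauS n\<bar> \<le> e"
          using * e' by (intro conjI) linarith+
      qed simp
    qed
  qed
qed

theorem remainder_oP: "unif_oP M B rem (\<lambda>n. 1 / sqrt (real n))"
  unfolding unif_oP_def
proof (intro allI impI)
  fix \<eta> \<delta> :: real assume "\<eta> > 0" "\<delta> > 0"
  from remainder_likely[OF this(1) zero_less_one this(2)]
  show "\<forall>\<^sub>F n in sequentially. \<forall>\<beta>\<in>B n. measure (M n) {\<omega> \<in> space (M n). \<eta> * (1 / sqrt n) < \<bar>rem n \<beta> \<omega>\<bar>} \<le> \<delta>"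
  proof eventually_elim
    case (elim n)
    show ?case
    proof
      fix \<beta> assume "\<beta> \<in> B n"
      with elim have "likely (M n) \<delta> (\<lambda>\<omega>. \<bar>rem n \<beta> \<omega>\<bar> \<le> \<eta> / sqrt n \<and> \<bar>sq n \<omega> - tauS n\<bar> \<le> 1 \<and> \<bar>tt n \<omega> - tauS n\<bar> \<le> 1)"
        by blast
      then show "measure (M n) {\<omega> \<in> space (M n). \<eta> * (1 / sqrt n) < \<bar>rem n \<beta> \<omega>\<bar>} \<le> \<delta>"
        by (rule prob_space.likely_prob_le[OF prob]) auto
    qed
  qed
qed

theorem sighat_limit:
  assumes \<eta>: "\<eta> > 0"
  shows "(\<lambda>n. measure (M n) {\<omega> \<in> space (M n).
    \<bar>sighat n (p n) (lamL n) (X n \<omega>) (ghat n (X n \<omega>)) - 1 / tauS n\<bar> > \<eta>}) \<longlonglongrightarrow> 0"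
proof (rule tendstoI)
  fix \<epsilon> :: real assume \<epsilon>: "\<epsilon> > 0"
  \<comment> \<open>The ratio estimate is used with \<open>a = L / 2\<close>: the first entry gives
    \<open>e \<le> a / 2\<close>, the second makes its bound \<open>14 * e / a\<^sup>2\<close> at
    most \<open>\<eta>\<close>.\<close>
  define e where "e = min (L / 4) (\<eta> * (L / 2)\<^sup>2 / 14)"
  have e: "e > 0" "e \<le> L / 2 / 2" "14 * e / (L / 2)\<^sup>2 \<le> \<eta>"
    using \<eta> L_pos unfolding e_def by (auto simp: min_def field_simps)
  show "\<forall>\<^sub>F n in sequentially. dist (measure (M n) {\<omega> \<in> space (M n).
    \<bar>sighat n (p n) (lamL n) (X n \<omega>) (ghat n (X n \<omega>)) - 1 / tauS n\<bar> > \<eta>}) 0 < \<epsilon>"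
    using sq_tt_close[OF e(1) half_gt_zero[OF \<epsilon>]] tauS_bounds
  proof eventually_elim
    case (elim n)
    have "measure (M n) {\<omega> \<in> space (M n).
      \<bar>sighat n (p n) (lamL n) (X n \<omega>) (ghat n (X n \<omega>)) - 1 / tauS n\<bar> > \<eta>} \<le> \<epsilon> / 2"
    proof (rule prob_space.likely_prob_le[OF prob elim(1)])
      fix \<omega> assume "\<bar>sq n \<omega> - tauS n\<bar> \<le> e \<and> \<bar>tt n \<omega> - tauS n\<bar> \<le> e"
      then have "\<bar>sq n \<omega> / (tt n \<omega>)\<^sup>2 - 1 / tauS n\<bar> \<le> 14 * e / (L / 2)\<^sup>2"
        using e(2) L_pos elim(2) by (intro abs_ratio_square_le) auto
      then show "\<not> \<bar>sighat n (p n) (lamL n) (X n \<omega>) (ghat n (X n \<omega>)) - 1 / tauS n\<bar> > \<eta>"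
        using e(3) unfolding sighat_eq[OF p_pos] sq_def tt_def by linarith
    qed
    then show ?case using \<epsilon> by (simp add: measure_nonneg)
  qed
qed

text \<open>The residual map is continuous, hence Borel, even though \<open>ghat\<close> may not be.
  Uniqueness of the residual then identifies its values on the design and on the truncated
  design.\<close>

lemma noise_normal:
  assumes n: "n > 0" and lam: "lamL n > 0"
  shows "distributed (M n) lborel (\<lambda>\<omega>. inner_upto n (normalized n (resid (p n) (X n \<omega>) (ghat n (X n \<omega>)))) (E n \<omega>)) std_normal_density"
proof -
  define r where "r x = resid (p n) x (ghat n x)" for x
  let ?X = "\<lambda>\<omega> i j. if i < n \<and> j < p n then X n \<omega> i j else 0"
  have "continuous_on UNIV (\<lambda>x. r x i)" if "i < n" for i
    unfolding r_def by (rule lasso_resid_continuous[OF ghat lam n that])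
  then have "(\<lambda>x. r x i) \<in> borel_measurable borel" if "i < n" for i
    using that by (intro borel_measurable_continuous_onI) auto
  from gaussian_design.distr_noise_projection[OF design[OF n] this]
  have d: "distributed (M n) lborel (\<lambda>\<omega>. inner_upto n (normalized n (r (?X \<omega>))) (E n \<omega>)) std_normal_density" .
  have "r (X n \<omega>) i = r (?X \<omega>) i" if "i < n" for \<omega> i
    unfolding r_def using lam n that by (intro lasso_resid_unique[OF ghat ghat _ n p_pos]) auto
  then have "normalized n (r (X n \<omega>)) i = normalized n (r (?X \<omega>)) i" if "i < n" for \<omega> i
    using that sqnorm_cong[of n "r (X n \<omega>)" "r (?X \<omega>)"] unfolding normalized_def by simp
  then have "inner_upto n (normalized n (r (X n \<omega>))) (E n \<omega>) = inner_upto n (normalized n (r (?X \<omega>))) (E n \<omega>)" for \<omega>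
    unfolding inner_upto_def by (intro sum.cong) auto
  then show ?thesis using d unfolding r_def by simp
qed

text \<open>The approximating variable \<open>G\<close> is exactly standard normal for every
  \<open>n\<close> with \<open>lamL n > 0\<close> and does not involve \<open>\<beta>\<close>. Hence
  each probability lies between \<open>Phi (z - \<rho>) - \<epsilon> / 4\<close> and
  \<open>Phi (z + \<rho>) + \<epsilon> / 4\<close> with the same bounds for all
  \<open>\<beta>\<close>, and the supremum costs nothing.\<close>

theorem studentized_limit:
  "(\<lambda>n. SUP \<beta>\<in>B n. measure (M n) {\<omega> \<in> space (M n).
    sqrt n * deb n \<beta> \<omega> / sqrt (sighat n (p n) (lamL n) (X n \<omega>) (ghat n (X n \<omega>))) \<le> z}) \<longlonglongrightarrow> Phi z"
proof (rule tendstoI)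
  fix \<epsilon> :: real assume \<epsilon>: "\<epsilon> > 0"
  define W where "W n \<beta> \<omega> = sqrt n * deb n \<beta> \<omega> / sqrt (sighat n (p n) (lamL n) (X n \<omega>) (ghat n (X n \<omega>)))" for n \<beta> \<omega>
  have "eventually (\<lambda>y. dist (Phi y) (Phi z) < \<epsilon> / 4) (at z)"
    using isCont_Phi[of z] \<epsilon> unfolding isCont_def by (intro tendstoD) auto
  then obtain \<rho>' where \<rho>': "\<rho>' > 0" "\<And>y. y \<noteq> z \<Longrightarrow> dist y z < \<rho>' \<Longrightarrow> dist (Phi y) (Phi z) < \<epsilon> / 4"
    unfolding eventually_at by blast
  define \<rho> where "\<rho> = \<rho>' / 2"
  have \<rho>: "\<rho> > 0" "\<bar>Phi (z + \<rho>) - Phi z\<bar> < \<epsilon> / 4" "\<bar>Phi (z - \<rho>) - Phi z\<bar> < \<epsilon> / 4"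
    using \<rho>'(1) \<rho>'(2)[of "z + \<rho>"] \<rho>'(2)[of "z - \<rho>"] unfolding \<rho>_def by (auto simp: dist_real_def)
  define e where "e = min 1 (L / 4)"
  have e: "e > 0" "e \<le> 1" "e \<le> L / 4" using L_pos unfolding e_def by auto
  \<comment> \<open>On the event \<open>tt\<close> is at most 3 and \<open>sq\<close> at least
    \<open>L / 4\<close>, so this makes the remainder of the studentised statistic at most
    \<open>\<rho>\<close>.\<close>
  define \<eta> where "\<eta> = \<rho> * sqrt (L / 4) / 3"
  have \<eta>: "\<eta> > 0" unfolding \<eta>_def using \<rho> L_pos by simp
  have \<epsilon>4: "\<epsilon> / 4 > 0" using \<epsilon> by simp
  have "eventually (\<lambda>n. \<bar>(SUP \<beta>\<in>B n. measure (M n) {\<omega> \<in> space (M n). W n \<beta> \<omega> \<le> z}) - Phi z\<bar> \<le> \<epsilon> / 2) sequentially"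
    using remainder_likely[OF \<eta> e(1) \<epsilon>4] lamL_pos tauS_bounds
  proof eventually_elim
    case (elim n)
    have n: "n > 0" and lam: "0 < lamL n" using elim(2) by auto
    interpret gd: gaussian_design "M n" n "p n" "S n" "X n" "E n" by (rule design[OF n])
    define G where "G \<omega> = inner_upto n (normalized n (resid (p n) (X n \<omega>) (ghat n (X n \<omega>)))) (E n \<omega>)" for \<omega>
    note G = gd.std_normal_prob_le[OF noise_normal[OF n lam, folded G_def]]
    show ?case
    proof (rule abs_SUP_diff_le[OF B_ne])
      fix \<beta> assume \<beta>: "\<beta> \<in> B n"
      have [measurable]: "W n \<beta> \<in> borel_measurable (M n)"
      proof -
        note m = measurable_debiased[where x="X n" and e="E n" and g="\<lambda>\<omega>. ghat n (X n \<omega>)" and b="bh n \<beta>" and M="M n" and n=n and p="p n" and lam="lamL n"]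
        have [measurable]: "deb n \<beta> \<in> borel_measurable (M n)"
          unfolding deb_def using bhat_meas[OF \<beta>] ghat_meas p_pos gd.X_measurable gd.E_measurable
          by (intro borel_measurable_diff m(1)) (auto simp: bh_def)
        have [measurable]: "(\<lambda>\<omega>. sighat n (p n) (lamL n) (X n \<omega>) (ghat n (X n \<omega>))) \<in> borel_measurable (M n)"
          using bhat_meas[OF \<beta>] ghat_meas p_pos gd.X_measurable gd.E_measurable
          by (intro m(2)) (auto simp: bh_def)
        show ?thesis unfolding W_def by simp
      qed
      have WG: "likely (M n) (\<epsilon> / 4) (\<lambda>\<omega>. \<bar>W n \<beta> \<omega> - G \<omega>\<bar> \<le> \<rho>)"
      proof (rule gd.likely_mono[OF elim(1)[rule_format, OF \<beta>]])
        fix \<omega>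
        assume *: "\<bar>rem n \<beta> \<omega>\<bar> \<le> \<eta> / sqrt n \<and> \<bar>sq n \<omega> - tauS n\<bar> \<le> e \<and> \<bar>tt n \<omega> - tauS n\<bar> \<le> e"
        have b: "L / 4 \<le> sq n \<omega>" "L / 4 \<le> tt n \<omega>" "tt n \<omega> \<le> 3"
          using conjunct2[OF *] e elim(3) by linarith+
        have pos: "tautilde n (p n) (lamL n) (X n \<omega>) (ghat n (X n \<omega>)) > 0"
          "sqnorm n (resid (p n) (X n \<omega>) (ghat n (X n \<omega>))) > 0"
        proof -
          show "tautilde n (p n) (lamL n) (X n \<omega>) (ghat n (X n \<omega>)) > 0"
            using b L_pos unfolding tt_def by linarith
          have "sq n \<omega> > 0" using b L_pos by linarith
          then show "sqnorm n (resid (p n) (X n \<omega>) (ghat n (X n \<omega>))) > 0"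
            using n unfolding sq_def by (simp add: zero_less_divide_iff)
        qed
        have "W n \<beta> \<omega> = G \<omega> + sqrt n * rem n \<beta> \<omega> * tt n \<omega> / sqrt (sq n \<omega>)"
          unfolding W_def G_def tt_def sq_def by (rule studentized_decomposition[OF p_pos n pos]) (simp add: rem_def)
        then have "\<bar>W n \<beta> \<omega> - G \<omega>\<bar> = sqrt n * \<bar>rem n \<beta> \<omega>\<bar> * tt n \<omega> / sqrt (sq n \<omega>)"
          using b L_pos by (simp add: abs_mult)
        also have "\<dots> \<le> sqrt n * (\<eta> / sqrt n) * 3 / sqrt (L / 4)"
          using b L_pos conjunct1[OF *] \<eta> by (intro frac_le mult_mono real_sqrt_le_mono) auto
        also have "\<dots> = \<rho>" using n L_pos unfolding \<eta>_def by simp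
        finally show "\<bar>W n \<beta> \<omega> - G \<omega>\<bar> \<le> \<rho>" .
      qed simp
      have "measure (M n) {\<omega> \<in> space (M n). W n \<beta> \<omega> \<le> z} \<le> Phi (z + \<rho>) + \<epsilon> / 4"
        unfolding G(2)[of "z + \<rho>", symmetric] by (rule gd.likely_prob_le_add[OF WG _ G(1)]) linarith
      moreover have "{\<omega> \<in> space (M n). W n \<beta> \<omega> \<le> z} \<in> sets (M n)" by measurable
      then have "Phi (z - \<rho>) \<le> measure (M n) {\<omega> \<in> space (M n). W n \<beta> \<omega> \<le> z} + \<epsilon> / 4"
        unfolding G(2)[of "z - \<rho>", symmetric] by (intro gd.likely_prob_le_add[OF WG]) linarith+
      ultimately show "\<bar>measure (M n) {\<omega> \<in> space (M n). W n \<beta> \<omega> \<le> z} - Phi z\<bar> \<le> \<epsilon> / 2"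
        using \<rho> by linarith
    qed
  qed
  then show "\<forall>\<^sub>F n in sequentially. dist (SUP \<beta>\<in>B n. measure (M n) {\<omega> \<in> space (M n).
    sqrt n * deb n \<beta> \<omega> / sqrt (sighat n (p n) (lamL n) (X n \<omega>) (ghat n (X n \<omega>))) \<le> z}) (Phi z) < \<epsilon>"
    unfolding W_def[symmetric] dist_real_def
    by (rule eventually_mono) (use \<epsilon> in linarith)
qed

end

theorem theorem4p1:
  fixes Cs :: real
  assumes "Cs > 0"
  shows "\<exists>K>0. \<forall>(M :: nat \<Rightarrow> 'a measure)
      (X :: nat \<Rightarrow> 'a \<Rightarrow> nat \<Rightarrow> nat \<Rightarrow> real) (E :: nat \<Rightarrow> 'a \<Rightarrow> nat \<Rightarrow> real)
      (p :: nat \<Rightarrow> nat) (S :: nat \<Rightarrow> nat \<Rightarrow> nat \<Rightarrow> real) (B :: nat \<Rightarrow> (nat \<Rightarrow> real) set)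
      (bhat :: nat \<Rightarrow> (nat \<Rightarrow> nat \<Rightarrow> real) \<Rightarrow> (nat \<Rightarrow> real) \<Rightarrow> nat \<Rightarrow> real)
      (ghat :: nat \<Rightarrow> (nat \<Rightarrow> nat \<Rightarrow> real) \<Rightarrow> nat \<Rightarrow> real)
      (lamS :: nat \<Rightarrow> real) (gamS :: nat \<Rightarrow> nat \<Rightarrow> real) (lamL :: nat \<Rightarrow> real).
    ( (\<forall>n. prob_space (M n))
    \<and> (\<forall>n. p n \<ge> 2)
    \<and> (\<forall>n j l. S n j l = S n l j)
    \<and> (\<forall>n j. j < p n \<longrightarrow> S n j j = 1)
    \<and> (\<forall>n. min_eig (p n) (S n) > 0)
    \<and> (\<exists>C. eventually (\<lambda>n. 1 / min_eig (p n) (S n) \<le> C) sequentially)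
    \<and> (\<forall>n. gaussian_data (M n) n (p n) (S n) (X n) (E n))
    \<and> (\<forall>n. B n \<noteq> {})
    \<and> (\<forall>n j. (\<lambda>\<omega>. ghat n (X n \<omega>) j) \<in> borel_measurable (M n))
    \<and> (\<forall>n. \<forall>\<beta>\<in>B n. \<forall>j.
          (\<lambda>\<omega>. bhat n (X n \<omega>) (resp (p n) (X n \<omega>) (E n \<omega>) \<beta>) j) \<in> borel_measurable (M n))
    \<and> (\<forall>n Xm c. lasso_obj n (p n) (lamL n) Xm (ghat n Xm) \<le> lasso_obj n (p n) (lamL n) Xm c)
    \<and> (\<forall>n. \<forall>k\<in>{1..<p n}.
          \<bar>\<Sum>j\<in>{1..<p n}. S n k j * (gamS n j - gamma0 (p n) (S n) j)\<bar> \<le> lamS n)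
    \<and> ((\<lambda>n. lamS n * (\<Sum>j\<in>{1..<p n}. \<bar>gamS n j\<bar>)) \<longlonglongrightarrow> 0)
    \<and> eventually (\<lambda>n. lamS n \<le> Cs * rate n (p n)) sequentially
    \<and> ((\<lambda>n. rate n (p n) * (\<Sum>j\<in>{1..<p n}. \<bar>gamS n j\<bar>)) \<longlonglongrightarrow> 0)
    \<and> (\<exists>c1>0. \<exists>c2>0. eventually (\<lambda>n. c1 * rate n (p n) \<le> lamL n \<and> lamL n \<le> c2 * rate n (p n)) sequentially)
    \<and> eventually (\<lambda>n. K * rate n (p n) \<le> lamL n) sequentially
    \<and> unif_oP M B (\<lambda>n \<beta> \<omega>. sqrt (ln (real (p n))) *
          (\<Sum>j<p n. \<bar>bhat n (X n \<omega>) (resp (p n) (X n \<omega>) (E n \<omega>) \<beta>) j - \<beta> j\<bar>)) (\<lambda>n. 1) )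
    \<longrightarrow>
    ( unif_oP M B (\<lambda>n \<beta> \<omega>.
          debiased n (p n) (lamL n) (X n \<omega>) (resp (p n) (X n \<omega>) (E n \<omega>) \<beta>) (ghat n (X n \<omega>))
             (bhat n (X n \<omega>) (resp (p n) (X n \<omega>) (E n \<omega>) \<beta>)) - \<beta> 0
          - (\<Sum>j<p n. thetahat n (p n) (lamL n) (X n \<omega>) (ghat n (X n \<omega>)) j *
               (\<Sum>i<n. X n \<omega> i j * E n \<omega> i)) / real n)
        (\<lambda>n. 1 / sqrt (real n))
    \<and> (\<forall>z. (\<lambda>n. SUP \<beta>\<in>B n. measure (M n) {\<omega> \<in> space (M n).
          sqrt (real n) *
            (debiased n (p n) (lamL n) (X n \<omega>) (resp (p n) (X n \<omega>) (E n \<omega>) \<beta>) (ghat n (X n \<omega>))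
               (bhat n (X n \<omega>) (resp (p n) (X n \<omega>) (E n \<omega>) \<beta>)) - \<beta> 0)
          / sqrt (sighat n (p n) (lamL n) (X n \<omega>) (ghat n (X n \<omega>))) \<le> z}) \<longlonglongrightarrow> Phi z)
    \<and> (\<forall>\<eta>>0. (\<lambda>n. measure (M n) {\<omega> \<in> space (M n).
          \<bar>sighat n (p n) (lamL n) (X n \<omega>) (ghat n (X n \<omega>))
            - 1 / (1 - (\<Sum>j\<in>{1..<p n}. \<Sum>k\<in>{1..<p n}. gamma0 (p n) (S n) j * S n j k * gamS n k))\<bar> > \<eta>})
        \<longlonglongrightarrow> 0) )"
proof -
  have main: "unif_oP M B (\<lambda>n \<beta> \<omega>.
          debiased n (p n) (lamL n) (X n \<omega>) (resp (p n) (X n \<omega>) (E n \<omega>) \<beta>) (ghat n (X n \<omega>))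
             (bhat n (X n \<omega>) (resp (p n) (X n \<omega>) (E n \<omega>) \<beta>)) - \<beta> 0
          - (\<Sum>j<p n. thetahat n (p n) (lamL n) (X n \<omega>) (ghat n (X n \<omega>)) j *
               (\<Sum>i<n. X n \<omega> i j * E n \<omega> i)) / real n)
        (\<lambda>n. 1 / sqrt (real n))
    \<and> (\<forall>z. (\<lambda>n. SUP \<beta>\<in>B n. measure (M n) {\<omega> \<in> space (M n).
          sqrt (real n) *
            (debiased n (p n) (lamL n) (X n \<omega>) (resp (p n) (X n \<omega>) (E n \<omega>) \<beta>) (ghat n (X n \<omega>))
               (bhat n (X n \<omega>) (resp (p n) (X n \<omega>) (E n \<omega>) \<beta>)) - \<beta> 0)
          / sqrt (sighat n (p n) (lamL n) (X n \<omega>) (ghat n (X n \<omega>))) \<le> z}) \<longlonglongrightarrow> Phi z)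
    \<and> (\<forall>\<eta>>0. (\<lambda>n. measure (M n) {\<omega> \<in> space (M n).
          \<bar>sighat n (p n) (lamL n) (X n \<omega>) (ghat n (X n \<omega>))
            - 1 / (1 - (\<Sum>j\<in>{1..<p n}. \<Sum>k\<in>{1..<p n}. gamma0 (p n) (S n) j * S n j k * gamS n k))\<bar> > \<eta>})
        \<longlonglongrightarrow> 0)"
    if "debiased_lasso M X E p S B bhat ghat lamS gamS lamL L c2 Cs"
    for M :: "nat \<Rightarrow> 'a measure" and X E p S B bhat ghat lamS gamS lamL L c2
  proof -
    interpret debiased_lasso M X E p S B bhat ghat lamS gamS lamL L c2 Cs by fact
    have sig: "(\<lambda>n. measure (M n) {\<omega> \<in> space (M n).
          \<bar>sighat n (p n) (lamL n) (X n \<omega>) (ghat n (X n \<omega>))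
            - 1 / (1 - (\<Sum>j\<in>{1..<p n}. \<Sum>k\<in>{1..<p n}. gamma0 (p n) (S n) j * S n j k * gamS n k))\<bar> > \<eta>})
        \<longlonglongrightarrow> 0" if "\<eta> > 0" for \<eta>
      \<comment> \<open>The two centring terms are identified through the normal equations, which
        are available for \<open>n > 0\<close>; an eventual equality suffices for the limit.\<close>
      by (rule Lim_transform_eventually[OF sighat_limit[OF that] eventually_mono[OF eventually_gt_at_top[of 0]]])
        (simp only: tauS_eq)
    note rem = remainder_oP[unfolded unif_oP_def rem_def deb_def bh_def]
    note stud = studentized_limit[unfolded deb_def bh_def]
    show ?thesis
      unfolding unif_oP_def by (intro conjI, fact rem, intro allI, rule stud, intro allI impI, rule sig)
  qed
  \<comment> \<open>Taking \<open>max C 1\<close> makes the reciprocal a positive eigenvalue bound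
    whatever the sign of \<open>C\<close>.\<close>
  have locale_holds: "debiased_lasso M X E p S B bhat ghat lamS gamS lamL (1 / max C 1) c2 Cs"
    if "\<forall>n. prob_space (M n)" "\<forall>n. p n \<ge> 2" "\<forall>n j l. S n j l = S n l j"
      "\<forall>n j. j < p n \<longrightarrow> S n j j = 1" "\<forall>n. min_eig (p n) (S n) > 0"
      "eventually (\<lambda>n. 1 / min_eig (p n) (S n) \<le> C) sequentially"
      "\<forall>n. gaussian_data (M n) n (p n) (S n) (X n) (E n)" "\<forall>n. B n \<noteq> {}"
      "\<forall>n j. (\<lambda>\<omega>. ghat n (X n \<omega>) j) \<in> borel_measurable (M n)"
      and bhat: "\<forall>n. \<forall>\<beta>\<in>B n. \<forall>j. (\<lambda>\<omega>. bhat n (X n \<omega>) (resp (p n) (X n \<omega>) (E n \<omega>) \<beta>) j) \<in> borel_measurable (M n)"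
      and "\<forall>n Xm c. lasso_obj n (p n) (lamL n) Xm (ghat n Xm) \<le> lasso_obj n (p n) (lamL n) Xm c"
      and elig: "\<forall>n. \<forall>k\<in>{1..<p n}. \<bar>\<Sum>j\<in>{1..<p n}. S n k j * (gamS n j - gamma0 (p n) (S n) j)\<bar> \<le> lamS n"
      and "(\<lambda>n. lamS n * (\<Sum>j\<in>{1..<p n}. \<bar>gamS n j\<bar>)) \<longlonglongrightarrow> 0"
      "eventually (\<lambda>n. lamS n \<le> Cs * rate n (p n)) sequentially"
      "(\<lambda>n. rate n (p n) * (\<Sum>j\<in>{1..<p n}. \<bar>gamS n j\<bar>)) \<longlonglongrightarrow> 0"
      "c2 > 0" "eventually (\<lambda>n. c1 * rate n (p n) \<le> lamL n \<and> lamL n \<le> c2 * rate n (p n)) sequentially"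
      "eventually (\<lambda>n. (4 * Cs + 8) * rate n (p n) \<le> lamL n) sequentially"
      "unif_oP M B (\<lambda>n \<beta> \<omega>. sqrt (ln (real (p n))) *
          (\<Sum>j<p n. \<bar>bhat n (X n \<omega>) (resp (p n) (X n \<omega>) (E n \<omega>) \<beta>) j - \<beta> j\<bar>)) (\<lambda>n. 1)"
    for M :: "nat \<Rightarrow> 'a measure" and X E p S B bhat ghat lamS gamS lamL C c1 c2
  proof (rule debiased_lasso.intro)
    show "prob_space (M n)" for n using that(1) by blast
    show "2 \<le> p n" for n using that(2) by blast
    show "S n j l = S n l j" for n j l using that(3) by blast
    show "j < p n \<Longrightarrow> S n j j = 1" for n j using that(4) by blast
    show pos: "0 < min_eig (p n) (S n)" for n using that(5) by blast
    show "eventually (\<lambda>n. 1 / max C 1 \<le> min_eig (p n) (S n)) sequentially"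
      using that(6)
    proof eventually_elim
      case (elim n)
      then have "1 / min_eig (p n) (S n) \<le> max C 1" by simp
      then show ?case using pos[of n] by (simp add: field_simps)
    qed
    show "gaussian_data (M n) n (p n) (S n) (X n) (E n)" for n using that(7) by blast
    show "B n \<noteq> {}" for n using that(8) by blast
    show "(\<lambda>\<omega>. ghat n (X n \<omega>) j) \<in> borel_measurable (M n)" for n j using that(9) by blast
    show "(\<lambda>\<omega>. bhat n (X n \<omega>) (resp (p n) (X n \<omega>) (E n \<omega>) \<beta>) j) \<in> borel_measurable (M n)"
      if "\<beta> \<in> B n" for n \<beta> j using bhat that by blast
    show "is_lasso n (p n) (lamL n) x (ghat n x)" for n x
      using that(11) unfolding is_lasso_def by blast
    show "\<bar>\<Sum>j\<in>{1..<p n}. S n k j * (gamS n j - gamma0 (p n) (S n) j)\<bar> \<le> lamS n"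
      if "k \<in> {1..<p n}" for n k using elig that by blast
    show "eventually (\<lambda>n. lamL n \<le> c2 * rate n (p n)) sequentially"
      using that(17) by (rule eventually_mono) simp
    show "(\<lambda>n. lamS n * l1norm (p n) (gamS n)) \<longlonglongrightarrow> 0"
      "(\<lambda>n. rate n (p n) * l1norm (p n) (gamS n)) \<longlonglongrightarrow> 0"
      unfolding l1norm_def by (fact that(13) that(15))+
    show "0 < 1 / max C 1" by simp
  qed (fact assms that(14) that(16) that(18) that(19))+
  show ?thesis
    \<comment> \<open>The witness is the multiple of the rate that dominates twice the noise level
      in large dimensions; it involves \<open>Cs\<close> alone, as the order of the quantifiers
      demands.\<close>
    by (rule exI[of _ "4 * Cs + 8"], rule conjI, use assms in simp, intro allI impI, elim conjE exE,
      rule main, rule locale_holds, assumption+)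
qed

end
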